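(* Let $L>0$, $T>0$, $d_l,d_r>0$, $0<\ell_l<\ell_0<\ell_r<L$, let $\omega_l\subset\subset(0,\ell_l)$ and $\omega_r\subset\subset(\ell_r,L)$ be open sets, and set $\mathcal{O}_l=\omega_l\times(0,T)$, $\mathcal{O}_r=\omega_r\times(0,T)$. Assume that $u_0\in H_0^1(0,\ell_0)$ with $u_0\ge0$, and $v_0\in H_0^1(\ell_0,L)$ with $v_0\le 0$ and $v_0\not\equiv 0$. If $(h_l,h_r)\in L^2(\mathcal{O}_l)\times L^2(\mathcal{O}_r)$, $h_r\equiv 0$, and the associated strong solution $(u,v,\ell)$ on $(0,T)$ of the two-phase Stefan problem (see context) satisfies $\ell(t)<L$ for all $t\in[0,T]$, then necessarily $$v(\cdot,T)\not\equiv 0\quad\text{in }(\ell(T),L).$$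
   Context: Two-phase Stefan problem. With $Q_l=\{(x,t):t\in(0,T),\ 0<x<\ell(t)\}$ and $Q_r=\{(x,t):t\in(0,T),\ \ell(t)<x<L\}$, the system for $(u,v,\ell)$ is $$\begin{cases}u_t-d_lu_{xx}=h_l1_{\omega_l}&\text{in }Q_l,\\ v_t-d_rv_{xx}=h_r1_{\omega_r}&\text{in }Q_r,\\ u(0,t)=0,\quad v(L,t)=0&\text{on }(0,T),\\ u(\cdot,0)=u_0&\text{in }(0,\ell_0),\\ v(\cdot,0)=v_0&\text{in }(\ell_0,L),\\ u(\ell(t),t)=v(\ell(t),t)=0&\text{on }(0,T),\\ -\ell'(t)=d_lu_x(\ell(t),t)-d_rv_x(\ell(t),t)&\text{in }(0,T).\end{cases}$$ Here $d_l,d_r$ are the diffusion coefficients, $\ell(t)$ is the position of the interface between the two phases, and $h_l1_{\omega_l}$ denotes extension by zero outside $\mathcal{O}_l$ (similarly for $h_r$). A strong solution on $(0,T)$ is a triple $(u,v,\ell)$ satisfying the system with $\ell\in H^1(0,T)$, $\ell(0)=\ell_0$, $\ell(t)\in(\ell_l,\ell_r)$ for all $t\in[0,T]$, and $u,u_x,u_t,u_{xx}\in L^2(Q_l)$, $v,v_x,v_t,v_{xx}\in L^2(Q_r)$. *)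

theory Defs
  imports "HOL-Analysis.Analysis"
begin

section \<open>Test functions, weak derivatives and Sobolev classes\<close>

definition dir_deriv :: "'a::euclidean_space \<Rightarrow> ('a \<Rightarrow> real) \<Rightarrow> 'a \<Rightarrow> real" where
  "dir_deriv b f x = deriv (\<lambda>s. f (x + s *\<^sub>R b)) 0"

primrec Ck :: "nat \<Rightarrow> ('a::euclidean_space \<Rightarrow> real) \<Rightarrow> bool" where
  "Ck 0 f \<longleftrightarrow> continuous_on UNIV f"
| "Ck (Suc k) f \<longleftrightarrow>
     (\<forall>b\<in>Basis. (\<forall>x. (\<lambda>s. f (x + s *\<^sub>R b)) differentiable (at 0)) \<and> Ck k (dir_deriv b f))"

definition test_function :: "'a::euclidean_space set \<Rightarrow> ('a \<Rightarrow> real) \<Rightarrow> bool" where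
  "test_function \<Omega> \<phi> \<longleftrightarrow>
     (\<forall>k. Ck k \<phi>) \<and> (\<exists>K. compact K \<and> K \<subseteq> \<Omega> \<and> (\<forall>x. x \<notin> K \<longrightarrow> \<phi> x = 0))"

definition locally_integrable :: "'a::euclidean_space set \<Rightarrow> ('a \<Rightarrow> real) \<Rightarrow> bool" where
  "locally_integrable \<Omega> f \<longleftrightarrow> (\<forall>K. compact K \<and> K \<subseteq> \<Omega> \<longrightarrow> set_integrable lebesgue K f)"

definition has_weak_deriv ::
    "'a::euclidean_space set \<Rightarrow> 'a \<Rightarrow> ('a \<Rightarrow> real) \<Rightarrow> ('a \<Rightarrow> real) \<Rightarrow> bool" where
  "has_weak_deriv \<Omega> b f g \<longleftrightarrow>
     locally_integrable \<Omega> f \<and> locally_integrable \<Omega> g \<and>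
     (\<forall>\<phi>. test_function \<Omega> \<phi> \<longrightarrow>
        (LINT x:\<Omega>|lebesgue. f x * dir_deriv b \<phi> x) = - (LINT x:\<Omega>|lebesgue. g x * \<phi> x))"

definition L2_on :: "'a::euclidean_space set \<Rightarrow> ('a \<Rightarrow> real) \<Rightarrow> bool" where
  "L2_on \<Omega> f \<longleftrightarrow>
     set_borel_measurable lebesgue \<Omega> f \<and> set_integrable lebesgue \<Omega> (\<lambda>x. (f x)\<^sup>2)"

text \<open>The closure of the test functions in the \<open>H\<^sup>1\<close> norm, on an open subset of the line.\<close>

definition H10_on :: "real set \<Rightarrow> (real \<Rightarrow> real) \<Rightarrow> bool" where
  "H10_on I f \<longleftrightarrow>
     (\<exists>f'. L2_on I f \<and> L2_on I f' \<and> has_weak_deriv I 1 f f' \<and>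
        (\<exists>\<phi>. (\<forall>n::nat. test_function I (\<phi> n)) \<and>
             (\<lambda>n. LINT x:I|lebesgue. (\<phi> n x - f x)\<^sup>2) \<longlonglongrightarrow> 0 \<and>
             (\<lambda>n. LINT x:I|lebesgue. (deriv (\<phi> n) x - f' x)\<^sup>2) \<longlonglongrightarrow> 0))"

section \<open>Boundary values\<close>

text \<open>
  Functions on a space-time domain \<open>Q\<close> are determined only up to null sets, so their boundary
  values are taken as essential limits along almost every slice: \<open>ess_tendsto S f p c\<close> says
  that, after modification on a null set, \<open>f\<close> tends to \<open>c\<close> at \<open>p\<close> within \<open>S\<close>. By Fubini the
  two trace predicates below do not depend on the representative of \<open>f\<close>. A function with a
  square integrable weak derivative in the direction of the slices is absolutely continuous
  along almost every slice, up to a null set, so for such functions these are the usual traces.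
\<close>

definition ess_tendsto :: "real set \<Rightarrow> (real \<Rightarrow> real) \<Rightarrow> real \<Rightarrow> real \<Rightarrow> bool" where
  "ess_tendsto S f p c \<longleftrightarrow>
     (\<exists>F. (AE s\<in>S in lebesgue. F s = f s) \<and> (F \<longlongrightarrow> c) (at p within S))"

text \<open>\<open>f(p(t), t) = c(t)\<close> for almost every \<open>t \<in> (0, T)\<close>.\<close>

definition lateral_trace ::
    "(real \<times> real) set \<Rightarrow> real \<Rightarrow> (real \<times> real \<Rightarrow> real) \<Rightarrow> (real \<Rightarrow> real) \<Rightarrow> (real \<Rightarrow> real) \<Rightarrow> bool"
  where
  "lateral_trace Q T f p c \<longleftrightarrow>
     (AE t\<in>{0<..<T} in lebesgue. ess_tendsto {x. (x, t) \<in> Q} (\<lambda>x. f (x, t)) (p t) (c t))"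

text \<open>\<open>f(x, \<tau>) = g(x)\<close> for almost every \<open>x \<in> I\<close>.\<close>

definition time_trace ::
    "(real \<times> real) set \<Rightarrow> real set \<Rightarrow> (real \<times> real \<Rightarrow> real) \<Rightarrow> real \<Rightarrow> (real \<Rightarrow> real) \<Rightarrow> bool"
  where
  "time_trace Q I f \<tau> g \<longleftrightarrow>
     (AE x\<in>I in lebesgue. ess_tendsto {t. (x, t) \<in> Q} (\<lambda>t. f (x, t)) \<tau> (g x))"

section \<open>The two-phase Stefan problem\<close>

text \<open>Space-time points are pairs \<open>(x, t)\<close>; \<open>(1, 0)\<close> is the space direction, \<open>(0, 1)\<close> the time
  direction.\<close>

definition Q_left :: "real \<Rightarrow> (real \<Rightarrow> real) \<Rightarrow> (real \<times> real) set" where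
  "Q_left T l = {(x, t). 0 < t \<and> t < T \<and> 0 < x \<and> x < l t}"

definition Q_right :: "real \<Rightarrow> real \<Rightarrow> (real \<Rightarrow> real) \<Rightarrow> (real \<times> real) set" where
  "Q_right T L l = {(x, t). 0 < t \<and> t < T \<and> l t < x \<and> x < L}"

text \<open>
  \<open>phase Q d h w w\<^sub>x\<close>: the functions \<open>w, w\<^sub>x, w\<^sub>t, w\<^sub>x\<^sub>x\<close> belong to \<open>L\<^sup>2(Q)\<close> and
  \<open>w\<^sub>t - d w\<^sub>x\<^sub>x = h\<close> almost everywhere in \<open>Q\<close>.
\<close>

definition phase ::
    "(real \<times> real) set \<Rightarrow> real \<Rightarrow> (real \<times> real \<Rightarrow> real) \<Rightarrow>
     (real \<times> real \<Rightarrow> real) \<Rightarrow> (real \<times> real \<Rightarrow> real) \<Rightarrow> bool" where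
  "phase Q d h w w\<^sub>x \<longleftrightarrow>
     L2_on Q w \<and> L2_on Q w\<^sub>x \<and> has_weak_deriv Q (1, 0) w w\<^sub>x \<and>
     (\<exists>w\<^sub>t w\<^sub>x\<^sub>x. L2_on Q w\<^sub>t \<and> L2_on Q w\<^sub>x\<^sub>x \<and>
        has_weak_deriv Q (0, 1) w w\<^sub>t \<and> has_weak_deriv Q (1, 0) w\<^sub>x w\<^sub>x\<^sub>x \<and>
        (AE z\<in>Q in lebesgue. w\<^sub>t z - d * w\<^sub>x\<^sub>x z = h z))"

text \<open>
  The interface \<open>l \<in> H\<^sup>1(0, T)\<close> is evaluated pointwise on \<open>[0, T]\<close>, hence it is represented by
  its continuous representative on \<open>[0, T]\<close>.
\<close>

definition strong_solution ::
    "real \<Rightarrow> real \<Rightarrow> real \<Rightarrow> real \<Rightarrow> real \<Rightarrow> real \<Rightarrow> real set \<Rightarrow> real set \<Rightarrow>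
     (real \<times> real \<Rightarrow> real) \<Rightarrow> (real \<times> real \<Rightarrow> real) \<Rightarrow>
     (real \<Rightarrow> real) \<Rightarrow> (real \<Rightarrow> real) \<Rightarrow> real \<Rightarrow>
     (real \<times> real \<Rightarrow> real) \<Rightarrow> (real \<times> real \<Rightarrow> real) \<Rightarrow> (real \<Rightarrow> real) \<Rightarrow> bool" where
  "strong_solution L T d\<^sub>l d\<^sub>r l\<^sub>l l\<^sub>r \<omega>\<^sub>l \<omega>\<^sub>r h\<^sub>l h\<^sub>r u\<^sub>0 v\<^sub>0 l\<^sub>0 u v l \<longleftrightarrow>
     (let Q\<^sub>l = Q_left T l; Q\<^sub>r = Q_right T L l in
      continuous_on {0..T} l \<and> l 0 = l\<^sub>0 \<and> (\<forall>t\<in>{0..T}. l\<^sub>l < l t \<and> l t < l\<^sub>r) \<and>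
      (\<exists>u\<^sub>x v\<^sub>x l' a b.
         L2_on {0<..<T} l \<and> L2_on {0<..<T} l' \<and> has_weak_deriv {0<..<T} 1 l l' \<and>
         phase Q\<^sub>l d\<^sub>l (\<lambda>z. indicat_real (\<omega>\<^sub>l \<times> {0<..<T}) z * h\<^sub>l z) u u\<^sub>x \<and>
         phase Q\<^sub>r d\<^sub>r (\<lambda>z. indicat_real (\<omega>\<^sub>r \<times> {0<..<T}) z * h\<^sub>r z) v v\<^sub>x \<and>
         lateral_trace Q\<^sub>l T u (\<lambda>_. 0) (\<lambda>_. 0) \<and>
         lateral_trace Q\<^sub>r T v (\<lambda>_. L) (\<lambda>_. 0) \<and>
         time_trace Q\<^sub>l {0<..<l\<^sub>0} u 0 u\<^sub>0 \<and>
         time_trace Q\<^sub>r {l\<^sub>0<..<L} v 0 v\<^sub>0 \<and>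
         lateral_trace Q\<^sub>l T u l (\<lambda>_. 0) \<and>
         lateral_trace Q\<^sub>r T v l (\<lambda>_. 0) \<and>
         lateral_trace Q\<^sub>l T u\<^sub>x l a \<and>
         lateral_trace Q\<^sub>r T v\<^sub>x l b \<and>
         (AE t\<in>{0<..<T} in lebesgue. - l' t = d\<^sub>l * a t - d\<^sub>r * b t)))"

end

theory Submission
  imports Defs "HOL-Real_Asymp.Real_Asymp"
begin

text \<open>
  Testing the equation for \<open>v\<close> with a smoothed positive part of \<open>v\<close> gives \<open>v \<le> 0\<close>. The moving
  interface is only \<open>H\<^sup>1\<close> in time, so the test function is cut off near it; the error is controlled
  by \<open>|v(x, t)| \<le> \<integral> |v\<^sub>x(s, t)| ds\<close> over \<open>\<ell>(t) < s < x\<close> and vanishes in the limit, because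
  \<open>\<ell>' v\<^sub>x\<close> is integrable. Then, for every \<open>x\<^sub>0\<close> in the initial domain,
  \<open>\<phi>(x, t) = exp (\<mu> t) max(0, r\<^sup>2 - (x - c(t))\<^sup>2)\<^sup>3\<close> is, for large \<open>\<mu>\<close>, a subsolution of the backward
  heat equation, supported in a tube around a curve \<open>c\<close> that starts at \<open>x\<^sub>0\<close> and stays in the
  domain. Testing with \<open>\<phi>\<close> yields \<open>\<integral> v(\<cdot>, T) \<phi>(\<cdot>, T) \<le> \<integral> v\<^sub>0 \<phi>(\<cdot>, 0) \<le> 0\<close>, so a vanishing final
  state forces \<open>v\<^sub>0 = 0\<close> near \<open>x\<^sub>0\<close>.
\<close>


section \<open>Absolutely continuous functions on an interval\<close>

text \<open>The regularity is used only along lines: after Fubini every term is a one-dimensional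
  integral involving an absolutely continuous function. So \<open>abscont\<close> records an
  integrable derivative together with the fundamental theorem on each subinterval, and half-open
  intervals make these integrals add up. The obstacle is the shape of the domain. A line of fixed
  \<open>t\<close> meets it in one interval, but a line of fixed \<open>x\<close> may cross the
  interface infinitely often, so the weak time derivative determines \<open>v\<close> there only up
  to one constant per component. Integration in time is therefore done against weights that vanish
  near the interface, and this is what both the cut-off and the tube provide. In the energy step the
  weight also carries the factor \<open>T - t\<close>: it removes the contribution of the final
  time, and its derivative \<open>- 1\<close> produces the space-time integral of the energy. In the
  duality step the cube makes the bump \<open>C\<^sup>2\<close> in space; near the edge of the tube
  its second space derivative is positive and linear in the height
  \<open>max(0, r\<^sup>2 - (x - c(t))\<^sup>2)\<close>, while all other terms are of higher order
  in it, so a large \<open>\<mu>\<close> settles the rest.\<close>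

definition abscont :: "real \<Rightarrow> real \<Rightarrow> (real \<Rightarrow> real) \<Rightarrow> (real \<Rightarrow> real) \<Rightarrow> bool" where
  "abscont a b f f' \<longleftrightarrow> set_integrable lborel {a<..b} f' \<and>
     (\<forall>s t. a \<le> s \<longrightarrow> s \<le> t \<longrightarrow> t \<le> b \<longrightarrow> f t - f s = (LBINT x:{s<..t}. f' x))"

lemma abscontD:
  assumes "abscont a b f f'"
  shows "set_integrable lborel {a<..b} f'"
    and "a \<le> s \<Longrightarrow> s \<le> t \<Longrightarrow> t \<le> b \<Longrightarrow> f t - f s = (LBINT x:{s<..t}. f' x)"
  using assms by (auto simp: abscont_def)

lemma abscont_subinterval:
  assumes "abscont a b f f'" "a \<le> c" "d \<le> b"
  shows "abscont c d f f'"
proof -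
  have "set_integrable lborel {c<..d} f'"
    by (rule set_integrable_subset[OF abscontD(1)[OF assms(1)]]) (use assms in auto)
  then show ?thesis
    using assms unfolding abscont_def by auto
qed

lemma set_integrable_Ioc_iff_Icc:
  fixes f :: "real \<Rightarrow> real"
  shows "set_integrable lborel {a<..b} f \<longleftrightarrow> set_integrable lborel {a..b} f"
  unfolding set_integrable_def
  by (rule integrable_discrete_difference[where X="{a}"]) (auto simp: indicator_def)

lemma LINT_Ioc_eq_Icc:
  fixes f :: "real \<Rightarrow> real"
  shows "(LBINT x:{a<..b}. f x) = (LBINT x:{a..b}. f x)"
  unfolding set_lebesgue_integral_def
  by (rule integral_discrete_difference[where X="{a}"]) (auto simp: indicator_def)

lemma abscont_continuous_on:
  assumes ac: "abscont a b f f'"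
  shows "continuous_on {a..b} f"
proof -
  have int: "set_integrable lborel {a..b} f'"
    using abscontD(1)[OF ac] by (simp add: set_integrable_Ioc_iff_Icc)
  have "continuous_on {a..b} (\<lambda>x. f a + integral {a..x} f')"
    by (intro continuous_intros indefinite_integral_continuous_1 set_borel_integral_eq_integral(1) int)
  then show ?thesis
  proof (rule continuous_on_eq)
    fix x assume x: "x \<in> {a..b}"
    have "set_integrable lborel {a..x} f'"
      by (rule set_integrable_subset[OF int]) (use x in auto)
    then have "(LBINT y:{a<..x}. f' y) = integral {a..x} f'"
      by (simp add: LINT_Ioc_eq_Icc set_borel_integral_eq_integral(2))
    then show "f a + integral {a..x} f' = f x"
      using abscontD(2)[OF ac, of a x] x by auto
  qed
qed

lemma LINT_Ioc_combine:
  fixes f :: "real \<Rightarrow> real"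
  assumes "set_integrable lborel {a<..c} f" "a \<le> b" "b \<le> c"
  shows "(LBINT x:{a<..c}. f x) = (LBINT x:{a<..b}. f x) + (LBINT x:{b<..c}. f x)"
proof -
  have eq: "{a<..c} = {a<..b} \<union> {b<..c}" using assms by auto
  show ?thesis
    unfolding eq
    by (rule set_integral_Un) (use assms in \<open>auto intro: set_integrable_subset\<close>)
qed

lemma abscont_join:
  assumes ab: "abscont a b f f'" and bc: "abscont b c f f'" and "a \<le> b" "b \<le> c"
  shows "abscont a c f f'"
proof -
  have eq: "{a<..c} = {a<..b} \<union> {b<..c}" using assms by auto
  have int: "set_integrable lborel {a<..c} f'"
    unfolding eq by (rule set_integrable_Un) (use ab bc in \<open>auto dest: abscontD\<close>)
  moreover have "f t - f s = (LBINT x:{s<..t}. f' x)"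
    if "a \<le> s" "s \<le> t" "t \<le> c" for s t
  proof -
    consider "t \<le> b" | "b \<le> s" | "s \<le> b" "b \<le> t" by linarith
    then show ?thesis
    proof cases
      case 3
      have "(LBINT x:{s<..t}. f' x) = (LBINT x:{s<..b}. f' x) + (LBINT x:{b<..t}. f' x)"
        by (rule LINT_Ioc_combine) (use that 3 int in \<open>auto intro: set_integrable_subset\<close>)
      then show ?thesis using abscontD(2)[OF ab, of s b] abscontD(2)[OF bc, of b t] that 3 by simp
    qed (use that abscontD(2)[OF ab] abscontD(2)[OF bc] in auto)
  qed
  ultimately show ?thesis by (auto simp: abscont_def)
qed

text \<open>The property survives gluing of adjacent intervals, so bisection reduces it to short
  intervals around each point. This permits reasons that change from point to point, as on time
  slices, where some points lie in the domain and at the others only the weight vanishes.\<close>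

lemma abscont_local:
  assumes "a \<le> b"
    and loc: "\<And>x. a \<le> x \<Longrightarrow> x \<le> b \<Longrightarrow>
      \<exists>d>0. \<forall>s t. a \<le> s \<longrightarrow> s \<le> x \<longrightarrow> x \<le> t \<longrightarrow> t \<le> b \<longrightarrow> t - s < d \<longrightarrow> abscont s t f f'"
  shows "abscont a b f f'"
proof -
  have "a \<le> a \<longrightarrow> b \<le> b \<longrightarrow> abscont a b f f'"
    using \<open>a \<le> b\<close>
  proof (induct rule: Bolzano[where P = "\<lambda>s t. a \<le> s \<longrightarrow> t \<le> b \<longrightarrow> abscont s t f f'"])
    case (trans s t u)
    then show ?case using abscont_join by auto
  next
    case (local x)
    then show ?case using loc[of x] by blast
  qed
  then show ?thesis by simp
qed

text \<open>Measurability of \<open>g\<close> is assumed because \<open>lborel\<close> is not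
  complete: agreement almost everywhere with a measurable function does not make \<open>g\<close>
  measurable.\<close>

lemma abscont_cong_AE:
  assumes ac: "abscont a b f f'" and ae: "AE x in lborel. x \<in> {a<..b} \<longrightarrow> f' x = g x"
    and meas: "set_borel_measurable lborel {a<..b} g"
  shows "abscont a b f g"
proof -
  have m': "set_borel_measurable lborel {a<..b} f'"
    using abscontD(1)[OF ac] unfolding set_integrable_def set_borel_measurable_def by auto
  have "set_integrable lborel {a<..b} g"
    using abscontD(1)[OF ac] m' meas ae
    unfolding set_integrable_def set_borel_measurable_def
    by (subst integrable_cong_AE[where g = "\<lambda>x. indicator {a<..b} x *\<^sub>R f' x"]) (auto simp: indicator_def)
  moreover have "f t - f s = (LBINT x:{s<..t}. g x)"
    if "a \<le> s" "s \<le> t" "t \<le> b" for s t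
  proof -
    have "(LBINT x:{s<..t}. f' x) = (LBINT x:{s<..t}. g x)"
      unfolding set_lebesgue_integral_def
    proof (rule integral_cong_AE)
      have sub: "{s<..t} \<subseteq> {a<..b}" using that by auto
      show "(\<lambda>x. indicat_real {s<..t} x *\<^sub>R f' x) \<in> borel_measurable lborel"
        "(\<lambda>x. indicat_real {s<..t} x *\<^sub>R g x) \<in> borel_measurable lborel"
        using set_borel_measurable_subset[OF m' _ sub] set_borel_measurable_subset[OF meas _ sub]
        by (auto simp: set_borel_measurable_def)
      show "AE x in lborel. indicat_real {s<..t} x *\<^sub>R f' x = indicat_real {s<..t} x *\<^sub>R g x"
        using ae by eventually_elim (use that in \<open>auto simp: indicator_def\<close>)
    qed
    then show ?thesis using abscontD(2)[OF ac] that by simp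
  qed
  ultimately show ?thesis by (simp add: abscont_def)
qed

lemma abscont_cong:
  assumes "abscont a b f f'" "\<And>x. x \<in> {a..b} \<Longrightarrow> f x = g x" "\<And>x. x \<in> {a<..b} \<Longrightarrow> f' x = g' x"
  shows "abscont a b g g'"
proof -
  have "set_integrable lborel {a<..b} g'"
    using abscontD(1)[OF assms(1)] assms(3) by (subst set_integrable_cong[OF refl, where f'=f']) auto
  moreover have "g t - g s = (LBINT x:{s<..t}. g' x)" if "a \<le> s" "s \<le> t" "t \<le> b" for s t
  proof -
    have "(LBINT x:{s<..t}. f' x) = (LBINT x:{s<..t}. g' x)"
      by (rule set_lebesgue_integral_cong) (use that assms(3) in auto)
    then show ?thesis using abscontD(2)[OF assms(1) that] that assms(2)[of s] assms(2)[of t] by simp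
  qed
  ultimately show ?thesis by (simp add: abscont_def)
qed

lemma abscont_C1:
  assumes "\<And>x. x \<in> {a..b} \<Longrightarrow> (f has_real_derivative f' x) (at x within {a..b})"
    and cont: "continuous_on {a..b} f'"
  shows "abscont a b f f'"
proof -
  have "set_integrable lborel {a..b} f'"
    by (rule borel_integrable_compact[unfolded set_integrable_def[symmetric]])
      (use cont in auto)
  moreover have "f t - f s = (LBINT x:{s<..t}. f' x)" if "a \<le> s" "s \<le> t" "t \<le> b" for s t
  proof -
    have "(LBINT x. indicator {s..t} x *\<^sub>R f' x) = f t - f s"
    proof (rule integral_FTC_atLeastAtMost)
      fix x assume "s \<le> x" "x \<le> t"
      then show "(f has_vector_derivative f' x) (at x within {s..t})"
        using assms(1)[of x] that
        by (auto simp: has_real_derivative_iff_has_vector_derivative intro: has_vector_derivative_within_subset)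
    qed (use that cont in \<open>auto intro: continuous_on_subset\<close>)
    then show ?thesis unfolding LINT_Ioc_eq_Icc unfolding set_lebesgue_integral_def by simp
  qed
  ultimately show ?thesis by (simp add: abscont_def set_integrable_Ioc_iff_Icc)
qed

lemma set_integrable_mult_continuous:
  fixes f g :: "real \<Rightarrow> real"
  assumes f: "set_integrable lborel {a<..b} f" and g: "continuous_on {a..b} g"
  shows "set_integrable lborel {a<..b} (\<lambda>x. f x * g x)"
proof -
  have "compact (g ` {a..b})" using g by (intro compact_continuous_image) auto
  then obtain B where B: "\<And>x. x \<in> {a..b} \<Longrightarrow> \<bar>g x\<bar> \<le> B"
    by (metis bounded_iff compact_imp_bounded imageI real_norm_def)
  have mg: "set_borel_measurable lborel {a<..b} g"
  proof -
    have "continuous_on {a<..b} g" by (rule continuous_on_subset[OF g]) auto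
    then show ?thesis
      using borel_measurable_continuous_on_indicator[of "{a<..b}" g]
      by (simp add: set_borel_measurable_def)
  qed
  have mf: "set_borel_measurable lborel {a<..b} f"
    using f unfolding set_integrable_def set_borel_measurable_def by auto
  have eq: "indicator {a<..b} x *\<^sub>R (f x * g x)
      = (indicator {a<..b} x *\<^sub>R f x) * (indicator {a<..b} x *\<^sub>R g x)" for x
    by (auto simp: indicator_def)
  have mfg: "set_borel_measurable lborel {a<..b} (\<lambda>x. f x * g x)"
    using mf mg unfolding set_borel_measurable_def eq by (rule borel_measurable_times)
  show ?thesis
  proof (rule set_integrable_bound[OF _ mfg])
    show "set_integrable lborel {a<..b} (\<lambda>x. f x * B)" using f by simp
    show "AE x in lborel. x \<in> {a<..b} \<longrightarrow> norm (f x * g x) \<le> norm (f x * B)"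
    proof (rule AE_I2, rule impI)
      fix x assume "x \<in> {a<..b}"
      then have "\<bar>g x\<bar> \<le> \<bar>B\<bar>" using B[of x] by auto
      then show "norm (f x * g x) \<le> norm (f x * B)" by (simp add: abs_mult mult_left_mono)
    qed
  qed
qed

lemma abs_LINT_le:
  fixes f :: "real \<Rightarrow> real"
  assumes f: "set_integrable lborel S f" and g: "set_integrable lborel S g"
    and le: "\<And>x. x \<in> S \<Longrightarrow> \<bar>f x\<bar> \<le> g x"
  shows "\<bar>LBINT x:S. f x\<bar> \<le> (LBINT x:S. g x)"
proof -
  have "\<bar>LBINT x:S. f x\<bar> \<le> (LBINT x:S. \<bar>f x\<bar>)"
    unfolding set_lebesgue_integral_def
    using integral_abs_bound[of lborel "\<lambda>x. indicator S x *\<^sub>R f x"] by (simp add: abs_mult)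
  also have "\<dots> \<le> (LBINT x:S. g x)"
    by (rule set_integral_mono) (use assms in \<open>auto intro: set_integrable_abs\<close>)
  finally show ?thesis .
qed

text \<open>The error of the fundamental theorem and the integral of \<open>m\<close> are both
  additive over adjacent intervals, so a bound valid on short intervals spreads to all of them by
  bisection with the same factor \<open>\<omega>\<close>, which then tends to 0. This is the common
  core of the product rule and the chain rule, where \<open>\<omega>\<close> bounds an
  oscillation.\<close>

lemma abscont_by_local_error:
  assumes ab: "a \<le> b" and int: "set_integrable lborel {a<..b} f'" and m: "set_integrable lborel {a<..b} m"
    and err: "\<And>\<omega> x. \<omega> > 0 \<Longrightarrow> a \<le> x \<Longrightarrow> x \<le> b \<Longrightarrow>
      \<exists>d>0. \<forall>s t. a \<le> s \<longrightarrow> s \<le> x \<longrightarrow> x \<le> t \<longrightarrow> t \<le> b \<longrightarrow> t - s < d \<longrightarrow>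
        \<bar>f t - f s - (LBINT x:{s<..t}. f' x)\<bar> \<le> \<omega> * (LBINT x:{s<..t}. m x)"
  shows "abscont a b f f'"
proof -
  have "f t - f s = (LBINT x:{s<..t}. f' x)" if st: "a \<le> s" "s \<le> t" "t \<le> b" for s t
  proof -
    let ?D = "\<lambda>s t. f t - f s - (LBINT x:{s<..t}. f' x)"
    let ?M = "\<lambda>s t. LBINT x:{s<..t}. m x"
    have bound: "\<bar>?D s t\<bar> \<le> \<omega> * ?M s t" if "\<omega> > 0" for \<omega>
    proof -
      have "a \<le> s \<longrightarrow> t \<le> b \<longrightarrow> \<bar>?D s t\<bar> \<le> \<omega> * ?M s t"
        using \<open>s \<le> t\<close>
      proof (induct rule: Bolzano[where P = "\<lambda>s t. a \<le> s \<longrightarrow> t \<le> b \<longrightarrow> \<bar>?D s t\<bar> \<le> \<omega> * ?M s t"])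
        case (trans p q r)
        show ?case
        proof (intro impI)
          assume "a \<le> p" "r \<le> b"
          then have sub: "set_integrable lborel {p<..r} f'" "set_integrable lborel {p<..r} m"
            using int m by (auto intro: set_integrable_subset)
          have "?D p r = ?D p q + ?D q r"
            using LINT_Ioc_combine[OF sub(1) trans(3,4)] by simp
          moreover have "\<omega> * ?M p r = \<omega> * ?M p q + \<omega> * ?M q r"
            unfolding LINT_Ioc_combine[OF sub(2) trans(3,4)] by (rule distrib_left)
          moreover have "\<bar>?D p q\<bar> \<le> \<omega> * ?M p q" "\<bar>?D q r\<bar> \<le> \<omega> * ?M q r"
            using trans \<open>a \<le> p\<close> \<open>r \<le> b\<close> by auto
          ultimately show "\<bar>?D p r\<bar> \<le> \<omega> * ?M p r"
            by linarith
        qed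
      next
        case (local x)
        then show ?case using err[OF that, of x] st by (smt (verit))
      qed
      then show ?thesis using st by simp
    qed
    have "\<bar>?D s t\<bar> \<le> 0"
    proof (rule field_le_epsilon)
      fix e :: real assume "e > 0"
      \<comment> \<open>The case \<open>\<omega> = 1\<close> shows that the mass is nonnegative, so
        the choice of \<open>\<omega>\<close> below is legitimate; the \<open>+ 1\<close> avoids a
        division by zero.\<close>
      have M0: "?M s t \<ge> 0" using bound[of 1] by simp
      have "\<bar>?D s t\<bar> \<le> e / (?M s t + 1) * ?M s t"
        by (rule bound) (use \<open>e > 0\<close> M0 in auto)
      also have "\<dots> \<le> e" using \<open>e > 0\<close> M0 by (simp add: field_simps)
      finally show "\<bar>?D s t\<bar> \<le> 0 + e" by simp
    qed
    then show ?thesis by simp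
  qed
  with int show ?thesis by (simp add: abscont_def)
qed

section \<open>Product rule and chain rule for absolutely continuous functions\<close>

lemma continuous_on_local_osc:
  fixes f :: "real \<Rightarrow> real"
  assumes "continuous_on {a..b} f" "x \<in> {a..b}" "\<omega> > 0"
  obtains d where "d > 0"
    "\<And>s t y z. a \<le> s \<Longrightarrow> s \<le> x \<Longrightarrow> x \<le> t \<Longrightarrow> t \<le> b \<Longrightarrow> t - s < d \<Longrightarrow> y \<in> {s..t} \<Longrightarrow> z \<in> {s..t} \<Longrightarrow> \<bar>f y - f z\<bar> \<le> \<omega>"
proof -
  from assms obtain d where d: "d > 0" "\<And>y. y \<in> {a..b} \<Longrightarrow> dist y x < d \<Longrightarrow> dist (f y) (f x) < \<omega>/2"
    unfolding continuous_on_iff by (metis half_gt_zero)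
  show ?thesis
  proof (rule that[OF d(1)])
    fix s t y z
    assume *: "a \<le> s" "s \<le> x" "x \<le> t" "t \<le> b" "t - s < d" "y \<in> {s..t}" "z \<in> {s..t}"
    have "dist y x < d" "dist z x < d" using * by (auto simp: dist_real_def)
    then have "dist (f y) (f x) < \<omega>/2" "dist (f z) (f x) < \<omega>/2"
      using * d(2)[of y] d(2)[of z] by auto
    then show "\<bar>f y - f z\<bar> \<le> \<omega>" unfolding dist_real_def by linarith
  qed
qed

lemma abscont_mult:
  assumes ab: "a \<le> b" and f: "abscont a b f f'" and g: "abscont a b g g'"
  shows "abscont a b (\<lambda>x. f x * g x) (\<lambda>x. f' x * g x + f x * g' x)"
proof (rule abscont_by_local_error[OF ab, where m = "\<lambda>x. \<bar>f' x\<bar> + \<bar>g' x\<bar>"])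
  note cf = abscont_continuous_on[OF f] and cg = abscont_continuous_on[OF g]
  note intf = abscontD(1)[OF f] and intg = abscontD(1)[OF g]
  have i1: "set_integrable lborel {a<..b} (\<lambda>x. f' x * g x)"
    by (rule set_integrable_mult_continuous[OF intf cg])
  have i2: "set_integrable lborel {a<..b} (\<lambda>x. f x * g' x)"
    using set_integrable_mult_continuous[OF intg cf] by (simp add: mult.commute)
  show "set_integrable lborel {a<..b} (\<lambda>x. f' x * g x + f x * g' x)"
    using i1 i2 by simp
  show "set_integrable lborel {a<..b} (\<lambda>x. \<bar>f' x\<bar> + \<bar>g' x\<bar>)"
    using intf intg by (intro set_integral_add set_integrable_abs)
  fix \<omega> x :: real assume \<omega>: "\<omega> > 0" and "a \<le> x" "x \<le> b"
  then have x: "x \<in> {a..b}" by simp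
  obtain d1 where d1: "d1 > 0" "\<And>s t y z. a \<le> s \<Longrightarrow> s \<le> x \<Longrightarrow> x \<le> t \<Longrightarrow> t \<le> b \<Longrightarrow> t - s < d1 \<Longrightarrow> y \<in> {s..t} \<Longrightarrow> z \<in> {s..t} \<Longrightarrow> \<bar>f y - f z\<bar> \<le> \<omega>"
    using continuous_on_local_osc[OF cf x \<omega>] by metis
  obtain d2 where d2: "d2 > 0" "\<And>s t y z. a \<le> s \<Longrightarrow> s \<le> x \<Longrightarrow> x \<le> t \<Longrightarrow> t \<le> b \<Longrightarrow> t - s < d2 \<Longrightarrow> y \<in> {s..t} \<Longrightarrow> z \<in> {s..t} \<Longrightarrow> \<bar>g y - g z\<bar> \<le> \<omega>"
    using continuous_on_local_osc[OF cg x \<omega>] by metis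
  show "\<exists>d>0. \<forall>s t. a \<le> s \<longrightarrow> s \<le> x \<longrightarrow> x \<le> t \<longrightarrow> t \<le> b \<longrightarrow> t - s < d \<longrightarrow>
        \<bar>f t * g t - f s * g s - (LBINT x:{s<..t}. f' x * g x + f x * g' x)\<bar>
          \<le> \<omega> * (LBINT x:{s<..t}. \<bar>f' x\<bar> + \<bar>g' x\<bar>)"
  proof (intro exI[of _ "min d1 d2"] conjI allI impI)
    fix s t assume st: "a \<le> s" "s \<le> x" "x \<le> t" "t \<le> b" "t - s < min d1 d2"
    have sub: "set_integrable lborel {s<..t} h" if "set_integrable lborel {a<..b} h" for h :: "real \<Rightarrow> real"
      by (rule set_integrable_subset[OF that]) (use st in auto)
    have "f t * g t - f s * g s = f t * (g t - g s) + g s * (f t - f s)" by (simp add: algebra_simps)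
    also have "\<dots> = (LBINT x:{s<..t}. f t * g' x + g s * f' x)"
      using abscontD(2)[OF f, of s t] abscontD(2)[OF g, of s t] st sub[OF intf] sub[OF intg]
      by (subst set_integral_add) auto
    finally have "f t * g t - f s * g s - (LBINT x:{s<..t}. f' x * g x + f x * g' x)
        = (LBINT x:{s<..t}. (f t * g' x + g s * f' x) - (f' x * g x + f x * g' x))"
      using sub[OF intf] sub[OF intg] sub[OF i1] sub[OF i2]
      by (subst set_integral_diff) (auto intro!: set_integral_add)
    also have "\<bar>\<dots>\<bar> \<le> (LBINT x:{s<..t}. \<omega> * (\<bar>f' x\<bar> + \<bar>g' x\<bar>))"
    proof (rule abs_LINT_le)
      show "set_integrable lborel {s<..t} (\<lambda>x. (f t * g' x + g s * f' x) - (f' x * g x + f x * g' x))"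
        using sub[OF intf] sub[OF intg] sub[OF i1] sub[OF i2]
        by (intro set_integral_diff set_integral_add) auto
      show "set_integrable lborel {s<..t} (\<lambda>x. \<omega> * (\<bar>f' x\<bar> + \<bar>g' x\<bar>))"
        using sub[OF intf] sub[OF intg]
        by (intro set_integrable_mult_right set_integral_add set_integrable_abs) auto
      fix y assume y: "y \<in> {s<..t}"
      have fy: "\<bar>f t - f y\<bar> \<le> \<omega>" using d1(2)[of s t t y] st y by auto
      have gy: "\<bar>g s - g y\<bar> \<le> \<omega>" using d2(2)[of s t s y] st y by auto
      have "\<bar>(f t * g' y + g s * f' y) - (f' y * g y + f y * g' y)\<bar>
          = \<bar>(f t - f y) * g' y + (g s - g y) * f' y\<bar>" by (simp add: algebra_simps)
      also have "\<dots> \<le> \<bar>f t - f y\<bar> * \<bar>g' y\<bar> + \<bar>g s - g y\<bar> * \<bar>f' y\<bar>"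
        by (metis abs_mult abs_triangle_ineq)
      also have "\<dots> \<le> \<omega> * \<bar>g' y\<bar> + \<omega> * \<bar>f' y\<bar>"
        using fy gy by (intro add_mono mult_right_mono) auto
      finally show "\<bar>(f t * g' y + g s * f' y) - (f' y * g y + f y * g' y)\<bar> \<le> \<omega> * (\<bar>f' y\<bar> + \<bar>g' y\<bar>)"
        by (simp add: algebra_simps)
    qed
    also have "\<dots> = \<omega> * (LBINT x:{s<..t}. \<bar>f' x\<bar> + \<bar>g' x\<bar>)" by simp
    finally show "\<bar>f t * g t - f s * g s - (LBINT x:{s<..t}. f' x * g x + f x * g' x)\<bar>
          \<le> \<omega> * (LBINT x:{s<..t}. \<bar>f' x\<bar> + \<bar>g' x\<bar>)" .
  qed (use d1 d2 in auto)
qed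

lemma abscont_compose:
  assumes ab: "a \<le> b" and f: "abscont a b f f'"
    and H: "\<And>y. (H has_real_derivative H' y) (at y)" and cH': "continuous_on UNIV H'"
  shows "abscont a b (\<lambda>x. H (f x)) (\<lambda>x. H' (f x) * f' x)"
proof (rule abscont_by_local_error[OF ab, where m = "\<lambda>x. \<bar>f' x\<bar>"])
  note cf = abscont_continuous_on[OF f]
  note intf = abscontD(1)[OF f]
  have cHf: "continuous_on {a..b} (\<lambda>x. H' (f x))"
    by (rule continuous_on_compose2[OF cH' cf]) auto
  show i1: "set_integrable lborel {a<..b} (\<lambda>x. H' (f x) * f' x)"
    using set_integrable_mult_continuous[OF intf cHf] by (simp add: mult.commute)
  show "set_integrable lborel {a<..b} (\<lambda>x. \<bar>f' x\<bar>)"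
    using intf by (rule set_integrable_abs)
  fix \<omega> x :: real assume \<omega>: "\<omega> > 0" and "a \<le> x" "x \<le> b"
  then have x: "x \<in> {a..b}" by simp
  obtain d where d: "d > 0" "\<And>s t y z. a \<le> s \<Longrightarrow> s \<le> x \<Longrightarrow> x \<le> t \<Longrightarrow> t \<le> b \<Longrightarrow> t - s < d \<Longrightarrow> y \<in> {s..t} \<Longrightarrow> z \<in> {s..t} \<Longrightarrow> \<bar>H' (f y) - H' (f z)\<bar> \<le> \<omega>"
    using continuous_on_local_osc[OF cHf x \<omega>] by metis
  show "\<exists>d>0. \<forall>s t. a \<le> s \<longrightarrow> s \<le> x \<longrightarrow> x \<le> t \<longrightarrow> t \<le> b \<longrightarrow> t - s < d \<longrightarrow>
        \<bar>H (f t) - H (f s) - (LBINT x:{s<..t}. H' (f x) * f' x)\<bar> \<le> \<omega> * (LBINT x:{s<..t}. \<bar>f' x\<bar>)"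
  proof (intro exI[of _ d] conjI allI impI)
    fix s t assume st: "a \<le> s" "s \<le> x" "x \<le> t" "t \<le> b" "t - s < d"
    have sub: "set_integrable lborel {s<..t} h" if "set_integrable lborel {a<..b} h" for h :: "real \<Rightarrow> real"
      by (rule set_integrable_subset[OF that]) (use st in auto)
    \<comment> \<open>The mean value theorem gives a slope of \<open>H\<close> at some value between
      \<open>f s\<close> and \<open>f t\<close>; the intermediate value theorem writes this value as
      \<open>f \<tau>\<close>, so that the oscillation bound for \<open>H' (f x)\<close> applies to
      it.\<close>
    obtain \<tau> where \<tau>: "\<tau> \<in> {s..t}" "H (f t) - H (f s) = H' (f \<tau>) * (f t - f s)"
    proof -
      have cst: "continuous_on {s..t} f" by (rule continuous_on_subset[OF cf]) (use st in auto)
      obtain \<xi> where \<xi>: "min (f s) (f t) \<le> \<xi>" "\<xi> \<le> max (f s) (f t)" "H (f t) - H (f s) = H' \<xi> * (f t - f s)"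
      proof (cases "f s" "f t" rule: linorder_cases)
        case less
        from MVT2[OF less H] obtain z where "f s < z" "z < f t" "H (f t) - H (f s) = (f t - f s) * H' z" by metis
        with less show ?thesis using that[of z] by (simp add: algebra_simps)
      next
        case equal
        then show ?thesis using that[of "f s"] by simp
      next
        case greater
        from MVT2[OF greater H] obtain z where "f t < z" "z < f s" "H (f s) - H (f t) = (f s - f t) * H' z" by metis
        with greater show ?thesis using that[of z] by (simp add: algebra_simps)
      qed
      have "connected (f ` {s..t})" by (intro connected_continuous_image cst) auto
      moreover have "f s \<in> f ` {s..t}" "f t \<in> f ` {s..t}" using st by auto
      ultimately have "\<xi> \<in> f ` {s..t}"
        using \<xi>(1,2) unfolding connected_iff_interval by (metis (no_types, lifting) max_def min_def)
      then show ?thesis using that \<xi>(3) by auto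
    qed
    have "H (f t) - H (f s) = (LBINT x:{s<..t}. H' (f \<tau>) * f' x)"
      using abscontD(2)[OF f, of s t] st \<tau>(2) by simp
    then have "H (f t) - H (f s) - (LBINT x:{s<..t}. H' (f x) * f' x)
        = (LBINT x:{s<..t}. H' (f \<tau>) * f' x - H' (f x) * f' x)"
      using sub[OF intf] sub[OF i1] by (subst set_integral_diff) auto
    also have "\<bar>\<dots>\<bar> \<le> (LBINT x:{s<..t}. \<omega> * \<bar>f' x\<bar>)"
    proof (rule abs_LINT_le)
      show "set_integrable lborel {s<..t} (\<lambda>x. H' (f \<tau>) * f' x - H' (f x) * f' x)"
        using sub[OF intf] sub[OF i1] by (intro set_integral_diff) auto
      show "set_integrable lborel {s<..t} (\<lambda>x. \<omega> * \<bar>f' x\<bar>)"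
        using sub[OF intf] by (intro set_integrable_mult_right set_integrable_abs) auto
      fix y assume y: "y \<in> {s<..t}"
      have "\<bar>H' (f \<tau>) - H' (f y)\<bar> \<le> \<omega>" using d(2)[of s t \<tau> y] st y \<tau> by auto
      then have "\<bar>H' (f \<tau>) - H' (f y)\<bar> * \<bar>f' y\<bar> \<le> \<omega> * \<bar>f' y\<bar>" by (rule mult_right_mono) simp
      then show "\<bar>H' (f \<tau>) * f' y - H' (f y) * f' y\<bar> \<le> \<omega> * \<bar>f' y\<bar>"
        by (simp add: abs_mult[symmetric] left_diff_distrib)
    qed
    also have "\<dots> = \<omega> * (LBINT x:{s<..t}. \<bar>f' x\<bar>)" by simp
    finally show "\<bar>H (f t) - H (f s) - (LBINT x:{s<..t}. H' (f x) * f' x)\<bar> \<le> \<omega> * (LBINT x:{s<..t}. \<bar>f' x\<bar>)" .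
  qed (use d in auto)
qed

section \<open>Smooth bumps and test functions\<close>

text \<open>On the line \<open>Basis\<close> consists of 1 alone, so the recursion behind
  \<open>Ck\<close> becomes the usual one by ordinary derivatives.\<close>

lemma Ck_Suc_realI:
  fixes f :: "real \<Rightarrow> real"
  assumes "\<And>x. (f has_real_derivative f' x) (at x)" "Ck k f'"
  shows "Ck (Suc k) f"
proof -
  have d: "((\<lambda>s. f (x + s)) has_real_derivative f' x) (at 0)" for x
    using assms(1)[of x] DERIV_shift[of f "f' x" 0 x] by (simp add: add.commute)
  then have "dir_deriv 1 f = f'"
    unfolding dir_deriv_def fun_eq_iff using DERIV_imp_deriv by auto
  with assms(2) d show ?thesis
    by (auto simp: real_differentiable_def)
qed

lemma Ck_Suc_realD:
  fixes f :: "real \<Rightarrow> real"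
  assumes "Ck (Suc k) f"
  shows "(f has_real_derivative deriv f x) (at x)" and "Ck k (deriv f)" and "dir_deriv 1 f = deriv f"
proof -
  have "(f has_real_derivative dir_deriv 1 f x) (at x)" for x
  proof -
    from assms obtain D where D: "((\<lambda>s. f (x + s)) has_real_derivative D) (at 0)"
      by (auto simp: real_differentiable_def)
    then have "dir_deriv 1 f x = D" by (auto simp: dir_deriv_def DERIV_imp_deriv)
    with D show ?thesis
      using DERIV_shift[of f D 0 x] by (simp add: add.commute)
  qed
  then have d: "(f has_real_derivative dir_deriv 1 f x) (at x)" for x .
  have eq: "dir_deriv 1 f = deriv f" using DERIV_imp_deriv[OF d] by auto
  then show "dir_deriv 1 f = deriv f" .
  show "(f has_real_derivative deriv f x) (at x)" using d eq by simp
  show "Ck k (deriv f)" using assms eq by simp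
qed

lemma Ck_add_real:
  fixes f g :: "real \<Rightarrow> real"
  shows "Ck k f \<Longrightarrow> Ck k g \<Longrightarrow> Ck k (\<lambda>x. f x + g x)"
proof (induction k arbitrary: f g)
  case 0
  then show ?case by (auto intro: continuous_intros)
next
  case (Suc k)
  show ?case
    by (rule Ck_Suc_realI[where f' = "\<lambda>x. deriv f x + deriv g x"])
      (auto intro!: derivative_intros Suc.IH Ck_Suc_realD Suc.prems simp del: Ck.simps)
qed

lemma Ck_continuous_real:
  fixes f :: "real \<Rightarrow> real"
  assumes "Ck k f"
  shows "continuous_on UNIV f"
proof (cases k)
  case (Suc j)
  then show ?thesis
    using Ck_Suc_realD(1)[of j f] assms by (metis DERIV_isCont continuous_at_imp_continuous_on)
qed (use assms in auto)

text \<open>All orders are assumed at once, so that both Leibniz terms, each pairing a derivative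
  with the other factor, satisfy the induction hypothesis without any counting of orders.\<close>

lemma Ck_mult_real:
  fixes f g :: "real \<Rightarrow> real"
  assumes "\<And>k. Ck k f" "\<And>k. Ck k g"
  shows "Ck k (\<lambda>x. f x * g x)"
  using assms
proof (induction k arbitrary: f g)
  case 0
  have "continuous_on UNIV f" "continuous_on UNIV g"
    using 0 Ck_continuous_real by blast+
  then show ?case by (auto intro: continuous_intros)
next
  case (Suc k)
  note f = Ck_Suc_realD[OF Suc.prems(1)] and g = Ck_Suc_realD[OF Suc.prems(2)]
  show ?case
  proof (rule Ck_Suc_realI)
    show "((\<lambda>x. f x * g x) has_real_derivative (deriv f x * g x + f x * deriv g x)) (at x)" for x
      using DERIV_mult[OF f(1) g(1), of x] by (simp add: algebra_simps)
    show "Ck k (\<lambda>x. deriv f x * g x + f x * deriv g x)"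
      by (intro Ck_add_real Suc.IH f(2) g(2) Suc.prems)
  qed
qed

lemma Ck_tensor:
  fixes f g :: "real \<Rightarrow> real"
  assumes "\<And>k. Ck k f" "\<And>k. Ck k g"
  shows "Ck k (\<lambda>z::real \<times> real. f (fst z) * g (snd z))"
    and "dir_deriv (1, 0) (\<lambda>z::real \<times> real. f (fst z) * g (snd z)) = (\<lambda>z. deriv f (fst z) * g (snd z))"
    and "dir_deriv (0, 1) (\<lambda>z::real \<times> real. f (fst z) * g (snd z)) = (\<lambda>z. f (fst z) * deriv g (snd z))"
proof -
  \<comment> \<open>This fact and its companions \<open>d2\<close>, \<open>e1\<close>,
    \<open>e2\<close> bind their own \<open>f\<close> and \<open>g\<close>, because the induction on
    the order below varies both factors.\<close>
  have d1: "((\<lambda>s. f (fst (z + s *\<^sub>R (1, 0))) * g (snd (z + s *\<^sub>R (1, 0)))) has_real_derivative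
      deriv f (fst z) * g (snd z)) (at 0)"
    if f: "\<And>k. Ck k f" for f g :: "real \<Rightarrow> real" and z :: "real \<times> real"
  proof -
    have "((\<lambda>s. f (fst z + s)) has_real_derivative deriv f (fst z)) (at 0)"
      using Ck_Suc_realD(1)[OF f, of "fst z"] DERIV_shift[of f _ 0 "fst z"] by (simp add: add.commute)
    from DERIV_cmult_right[OF this, of "g (snd z)"] show ?thesis by simp
  qed
  have d2: "((\<lambda>s. f (fst (z + s *\<^sub>R (0, 1))) * g (snd (z + s *\<^sub>R (0, 1)))) has_real_derivative
      f (fst z) * deriv g (snd z)) (at 0)"
    if g: "\<And>k. Ck k g" for f g :: "real \<Rightarrow> real" and z :: "real \<times> real"
  proof -
    have "((\<lambda>s. g (snd z + s)) has_real_derivative deriv g (snd z)) (at 0)"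
      using Ck_Suc_realD(1)[OF g, of "snd z"] DERIV_shift[of g _ 0 "snd z"] by (simp add: add.commute)
    from DERIV_cmult[OF this, of "f (fst z)"] show ?thesis by simp
  qed
  have e1: "dir_deriv (1, 0) (\<lambda>z::real \<times> real. f (fst z) * g (snd z)) = (\<lambda>z. deriv f (fst z) * g (snd z))"
    if f: "\<And>k. Ck k f" for f g :: "real \<Rightarrow> real"
    unfolding dir_deriv_def fun_eq_iff using DERIV_imp_deriv[OF d1[OF that]] by blast
  have e2: "dir_deriv (0, 1) (\<lambda>z::real \<times> real. f (fst z) * g (snd z)) = (\<lambda>z. f (fst z) * deriv g (snd z))"
    if g: "\<And>k. Ck k g" for f g :: "real \<Rightarrow> real"
    unfolding dir_deriv_def fun_eq_iff using DERIV_imp_deriv[OF d2[OF that]] by blast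
  show "dir_deriv (1, 0) (\<lambda>z::real \<times> real. f (fst z) * g (snd z)) = (\<lambda>z. deriv f (fst z) * g (snd z))"
    by (rule e1[OF assms(1)])
  show "dir_deriv (0, 1) (\<lambda>z::real \<times> real. f (fst z) * g (snd z)) = (\<lambda>z. f (fst z) * deriv g (snd z))"
    by (rule e2[OF assms(2)])
  show "Ck k (\<lambda>z::real \<times> real. f (fst z) * g (snd z))"
    using assms
  proof (induction k arbitrary: f g)
    case 0
    have "continuous_on UNIV f" "continuous_on UNIV g"
      using 0 Ck_continuous_real by blast+
    then show ?case
      by (auto intro!: continuous_intros continuous_on_compose2[of UNIV f] continuous_on_compose2[of UNIV g])
  next
    case (Suc k)
    have B: "(Basis :: (real \<times> real) set) = {(1, 0), (0, 1)}"
      by (auto simp: Basis_prod_def)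
    have "Ck k (\<lambda>z::real \<times> real. deriv f (fst z) * g (snd z))"
      by (rule Suc.IH) (use Suc.prems Ck_Suc_realD(2) in blast)+
    moreover have "Ck k (\<lambda>z::real \<times> real. f (fst z) * deriv g (snd z))"
      by (rule Suc.IH) (use Suc.prems Ck_Suc_realD(2) in blast)+
    moreover have "(\<lambda>s. f (fst (z + s *\<^sub>R (1, 0))) * g (snd (z + s *\<^sub>R (1, 0)))) differentiable (at 0)"
      "(\<lambda>s. f (fst (z + s *\<^sub>R (0, 1))) * g (snd (z + s *\<^sub>R (0, 1)))) differentiable (at 0)" for z
      using d1[OF Suc.prems(1)] d2[OF Suc.prems(2)] unfolding real_differentiable_def by blast+
    ultimately show ?case
      unfolding Ck.simps B
      using e1[OF Suc.prems(1), of g] e2[OF Suc.prems(2), of f]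
      by (auto simp only: insert_iff empty_iff)
  qed
qed

lemma test_function_Ioo:
  fixes f :: "real \<Rightarrow> real"
  shows "test_function {a<..<b} f \<longleftrightarrow>
    (\<forall>k. Ck k f) \<and> (\<exists>a' b'. a < a' \<and> b' < b \<and> (\<forall>x. x \<notin> {a'..b'} \<longrightarrow> f x = 0))"
proof
  assume "test_function {a<..<b} f"
  then obtain K where K: "\<forall>k. Ck k f" "compact K" "K \<subseteq> {a<..<b}" "\<And>x. x \<notin> K \<Longrightarrow> f x = 0"
    by (auto simp: test_function_def)
  have "\<exists>a' b'. a < a' \<and> b' < b \<and> (\<forall>x. x \<notin> {a'..b'} \<longrightarrow> f x = 0)"
  proof (cases "K = {}")
    case True
    \<comment> \<open>With an empty support \<open>f\<close> is zero everywhere; the bounds only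
      have to lie on the correct side of \<open>a\<close> and \<open>b\<close>.\<close>
    then show ?thesis using K(4) by (intro exI[of _ "a+1"] exI[of _ "b-1"]) auto
  next
    case False
    obtain p where p: "p \<in> K" "\<And>x. x \<in> K \<Longrightarrow> p \<le> x" using compact_attains_inf[OF K(2) False] by auto
    obtain q where q: "q \<in> K" "\<And>x. x \<in> K \<Longrightarrow> x \<le> q" using compact_attains_sup[OF K(2) False] by auto
    show ?thesis
    proof (intro exI conjI allI impI)
      show "a < p" "q < b" using p q K(3) by auto
      show "f x = 0" if "x \<notin> {p..q}" for x
        using that p(2)[of x] q(2)[of x] K(4)[of x] by (meson atLeastAtMost_iff)
    qed
  qed
  with K show "(\<forall>k. Ck k f) \<and> (\<exists>a' b'. a < a' \<and> b' < b \<and> (\<forall>x. x \<notin> {a'..b'} \<longrightarrow> f x = 0))" by auto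
next
  assume "(\<forall>k. Ck k f) \<and> (\<exists>a' b'. a < a' \<and> b' < b \<and> (\<forall>x. x \<notin> {a'..b'} \<longrightarrow> f x = 0))"
  then obtain a' b' where "\<forall>k. Ck k f" "a < a'" "b' < b" "\<forall>x. x \<notin> {a'..b'} \<longrightarrow> f x = 0" by auto
  then show "test_function {a<..<b} f"
    unfolding test_function_def by (auto intro!: exI[of _ "{a'..b'}"])
qed

lemma test_function_tensor:
  fixes f g :: "real \<Rightarrow> real"
  assumes "test_function {a<..<b} f" "test_function {c<..<d} g"
    and "{a<..<b} \<times> {c<..<d} \<subseteq> \<Omega>"
  shows "test_function \<Omega> (\<lambda>z::real \<times> real. f (fst z) * g (snd z))"
proof -
  from assms obtain K1 K2 where K: "compact K1" "K1 \<subseteq> {a<..<b}" "\<And>x. x \<notin> K1 \<Longrightarrow> f x = 0"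
    "compact K2" "K2 \<subseteq> {c<..<d}" "\<And>x. x \<notin> K2 \<Longrightarrow> g x = 0"
    by (auto simp: test_function_def)
  show ?thesis
    unfolding test_function_def
  proof (intro conjI allI exI[of _ "K1 \<times> K2"])
    show "Ck k (\<lambda>z::real \<times> real. f (fst z) * g (snd z))" for k
      using assms by (intro Ck_tensor(1)) (auto simp: test_function_def)
    show "compact (K1 \<times> K2)" using K by (intro compact_Times)
    show "K1 \<times> K2 \<subseteq> \<Omega>" using K assms(3) by auto
    show "z \<notin> K1 \<times> K2 \<longrightarrow> f (fst z) * g (snd z) = 0" for z
      using K by (cases z) auto
  qed
qed

text \<open>For \<open>p = 1\<close> this is the classical function \<open>exp (- (1 / y))\<close>
  continued by zero. Admitting polynomials in \<open>1 / y\<close> gives a family closed under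
  differentiation, with \<open>p\<close> replaced by \<open>X\<^sup>2 (p - p')\<close>, so one
  derivative formula proves smoothness by induction.\<close>

definition flat :: "real poly \<Rightarrow> real \<Rightarrow> real" where
  "flat p y = (if y > 0 then poly p (1 / y) * exp (- (1 / y)) else 0)"

lemma poly_times_exp_neg_tendsto_0:
  fixes p :: "real poly"
  shows "((\<lambda>u. poly p u * exp (- u)) \<longlongrightarrow> 0) at_top"
proof -
  have "((\<lambda>u. \<Sum>i\<le>degree p. coeff p i * (u ^ i / exp u)) \<longlongrightarrow> (\<Sum>i\<le>degree p. coeff p i * 0)) at_top"
    by (intro tendsto_intros tendsto_power_div_exp_0)
  moreover have "(\<Sum>i\<le>degree p. coeff p i * (u ^ i / exp u)) = poly p u * exp (- u)" for u
    by (simp add: poly_altdef sum_distrib_right exp_minus divide_inverse mult.assoc)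
  ultimately show ?thesis by simp
qed

lemma flat_tendsto_0: "(flat p \<longlongrightarrow> 0) (at 0)"
proof -
  have "((\<lambda>y. poly p (1 / y) * exp (- (1 / y))) \<longlongrightarrow> 0) (at_right 0)"
    using filterlim_compose[OF poly_times_exp_neg_tendsto_0[of p] filterlim_inverse_at_top_right]
    by (simp add: inverse_eq_divide)
  then have "(flat p \<longlongrightarrow> 0) (at_right 0)"
    by (rule Lim_transform_eventually) (auto simp: flat_def eventually_at_filter)
  moreover have "(flat p \<longlongrightarrow> 0) (at_left 0)"
    by (rule Lim_transform_eventually[OF tendsto_const]) (auto simp: flat_def eventually_at_filter)
  ultimately show ?thesis by (simp add: filterlim_split_at)
qed

lemma flat_has_derivative:
  "(flat p has_real_derivative flat ([:0, 0, 1:] * (p - pderiv p)) x) (at x)"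
proof -
  consider "x > 0" | "x < 0" | "x = 0" by linarith
  then show ?thesis
  proof cases
    case 1
    have "((\<lambda>y. poly p (1 / y) * exp (- (1 / y))) has_real_derivative
      (poly (pderiv p) (1 / x) * (- (1 / x^2))) * exp (- (1 / x)) +
      poly p (1/x) * (exp (- (1 / x)) * (1 / x^2))) (at x)"
      using 1 by (auto intro!: derivative_eq_intros DERIV_chain'[where g = "poly p"] simp: power2_eq_square field_simps)
    also have "(poly (pderiv p) (1 / x) * (- (1 / x^2))) * exp (- (1 / x)) +
      poly p (1/x) * (exp (- (1 / x)) * (1 / x^2)) = flat ([:0, 0, 1:] * (p - pderiv p)) x"
      using 1 by (simp add: flat_def power2_eq_square field_simps)
    finally show ?thesis
      by (rule has_field_derivative_transform_within_open[where S = "{0<..}"]) (use 1 in \<open>auto simp: flat_def\<close>)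
  next
    case 2
    have "((\<lambda>y. 0) has_real_derivative flat ([:0, 0, 1:] * (p - pderiv p)) x) (at x)"
      using 2 by (auto simp: flat_def)
    then show ?thesis
      by (rule has_field_derivative_transform_within_open[where S = "{..<0}"]) (use 2 in \<open>auto simp: flat_def\<close>)
  next
    case 3
    \<comment> \<open>At the origin the difference quotient is again a member of the family, with
      polynomial \<open>X p\<close>, and such functions tend to 0.\<close>
    have "((\<lambda>y. (flat p y - flat p 0) / (y - 0)) \<longlongrightarrow> 0) (at 0)"
      by (rule Lim_transform_eventually[OF flat_tendsto_0[of "[:0, 1:] * p"]])
        (auto simp: flat_def eventually_at_filter)
    then show ?thesis
      using 3 by (simp add: has_field_derivative_iff flat_def)
  qed
qed

lemma Ck_flat_affine: "Ck k (\<lambda>x. flat p (A * x + B))"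
proof (induction k arbitrary: p)
  case 0
  have "continuous_on UNIV (flat p)"
    using flat_has_derivative by (metis DERIV_isCont continuous_at_imp_continuous_on)
  then show ?case
    by (auto intro!: continuous_intros continuous_on_compose2[of UNIV "flat p"])
next
  case (Suc k)
  show ?case
  proof (rule Ck_Suc_realI)
    fix x
    have "((\<lambda>x. flat p (A * x + B)) has_real_derivative flat ([:0, 0, 1:] * (p - pderiv p)) (A * x + B) * A) (at x)"
      by (rule DERIV_chain'[OF _ flat_has_derivative]) (auto intro!: derivative_eq_intros)
    then show "((\<lambda>x. flat p (A * x + B)) has_real_derivative flat (smult A ([:0, 0, 1:] * (p - pderiv p))) (A * x + B)) (at x)"
      by (simp add: flat_def algebra_simps split: if_splits)
  qed (rule Suc)
qed

text \<open>The first factor becomes positive at \<open>a + 1 / (n + 1)\<close>, the second ceases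
  to be positive at \<open>b - 1 / (n + 1)\<close>, and the slope \<open>Suc n\<close> drives both
  towards 1 in between: a smooth approximation of the indicator of \<open>(a, b)\<close> with values
  in \<open>[0, 1]\<close>. The arguments are kept in the affine form that
  \<open>Ck_flat_affine\<close> expects.\<close>

definition hump :: "nat \<Rightarrow> real \<Rightarrow> real \<Rightarrow> real \<Rightarrow> real" where
  "hump n a b x = flat 1 (real (Suc n) * x + (- real (Suc n) * a - 1)) * flat 1 (- real (Suc n) * x + (real (Suc n) * b - 1))"

lemma flat_1_bounds: "0 \<le> flat 1 y" "flat 1 y \<le> 1"
  by (auto simp: flat_def)

lemma hump_bounds: "0 \<le> hump n a b x" "hump n a b x \<le> 1"
  unfolding hump_def using flat_1_bounds by (auto intro!: mult_nonneg_nonneg mult_le_one)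

lemma test_function_hump: "test_function {a<..<b} (hump n a b)"
  unfolding test_function_Ioo
proof (intro conjI allI exI impI)
  show "Ck k (hump n a b)" for k
    unfolding hump_def by (intro Ck_mult_real Ck_flat_affine)
  show "a < a + 1 / real (Suc n)" "b - 1 / real (Suc n) < b" by auto
  fix x assume "x \<notin> {a + 1 / real (Suc n)..b - 1 / real (Suc n)}"
  then have "x < a + 1 / real (Suc n) \<or> x > b - 1 / real (Suc n)" by auto
  then have "real (Suc n) * x + (- real (Suc n) * a - 1) \<le> 0 \<or> - real (Suc n) * x + (real (Suc n) * b - 1) \<le> 0"
    by (auto simp: field_simps)
  then show "hump n a b x = 0"
    unfolding hump_def flat_def by auto
qed

lemma flat_1_affine_tendsto:
  assumes "c > 0"
  shows "(\<lambda>n. flat 1 (real (Suc n) * c - 1)) \<longlonglongrightarrow> 1"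
proof -
  have lim: "LIM n sequentially. real (Suc n) * c - 1 :> at_top"
    using assms by real_asymp
  have "((\<lambda>y::real. exp (- (1 / y))) \<longlongrightarrow> 1) at_top" by real_asymp
  then have "(flat 1 \<longlongrightarrow> 1) at_top"
    by (rule Lim_transform_eventually) (use eventually_gt_at_top[of 0] in eventually_elim, auto simp: flat_def)
  from filterlim_compose[OF this lim] show ?thesis .
qed

lemma hump_tendsto: "(\<lambda>n. hump n a b x) \<longlonglongrightarrow> indicator {a<..<b} x"
proof (cases "x \<in> {a<..<b}")
  case True
  have eq: "hump n a b x = flat 1 (real (Suc n) * (x - a) - 1) * flat 1 (real (Suc n) * (b - x) - 1)" for n
    unfolding hump_def by (simp add: algebra_simps)
  have "(\<lambda>n. hump n a b x) \<longlonglongrightarrow> 1 * 1"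
    unfolding eq by (intro tendsto_mult flat_1_affine_tendsto) (use True in auto)
  with True show ?thesis by simp
next
  case False
  have "hump n a b x = 0" for n
    using False test_function_hump[of a b n] unfolding test_function_def by auto
  with False show ?thesis by simp
qed

section \<open>Primitives of test functions\<close>

lemma ex_global_antiderivative:
  fixes f :: "real \<Rightarrow> real"
  assumes "continuous_on UNIV f"
  obtains F where "\<And>x. (F has_real_derivative f x) (at x)"
proof -
  have "\<exists>F. \<forall>x. -\<infinity> < ereal x \<longrightarrow> ereal x < \<infinity> \<longrightarrow> (F has_vector_derivative f x) (at x)"
    by (rule einterval_antiderivative) (use assms in \<open>auto simp: continuous_on_eq_continuous_at\<close>)
  then show ?thesis using that by (auto simp: has_real_derivative_iff_has_vector_derivative)
qed

lemma test_function_integrable: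
  fixes f :: "real \<Rightarrow> real"
  assumes "test_function {a<..<b} f"
  shows "integrable lborel f" "continuous_on UNIV f"
proof -
  from assms obtain a' b' where ab: "\<forall>k. Ck k f" "\<And>x. x \<notin> {a'..b'} \<Longrightarrow> f x = 0"
    unfolding test_function_Ioo by auto
  show c: "continuous_on UNIV f" using ab(1) Ck_continuous_real by blast
  have "integrable lborel (\<lambda>x. indicator {a'..b'} x *\<^sub>R f x)"
    by (rule borel_integrable_compact) (use c in \<open>auto intro: continuous_on_subset\<close>)
  moreover have "(\<lambda>x. indicator {a'..b'} x *\<^sub>R f x) = f"
    using ab(2) by (force simp: indicator_def)
  ultimately show "integrable lborel f" by simp
qed

text \<open>The primitive that vanishes to the left of the support is constant to the right of it,
  with the total integral as value. Mean zero is therefore exactly what makes the primitive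
  compactly supported.\<close>

lemma test_function_antiderivative:
  fixes f :: "real \<Rightarrow> real"
  assumes f: "test_function {a<..<b} f" and int0: "(LBINT x. f x) = 0"
  obtains F where "test_function {a<..<b} F" "\<And>x. (F has_real_derivative f x) (at x)"
proof -
  from f obtain a0 b0 where ab0: "\<And>k. Ck k f" "a < a0" "b0 < b" "\<And>x. x \<notin> {a0..b0} \<Longrightarrow> f x = 0"
    unfolding test_function_Ioo by blast
  show ?thesis
  proof (cases "a0 \<le> b0")
    case False
    then have f0: "f x = 0" for x using ab0(4) by auto
    have "Ck k (\<lambda>x::real. 0::real)" for k
    proof (induction k)
      case (Suc k)
      then show ?case by (intro Ck_Suc_realI[where f' = "\<lambda>_. 0"]) auto
    qed auto
    then have "test_function {a<..<b} (\<lambda>x. 0)"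
      unfolding test_function_def by auto
    then show ?thesis using that[of "\<lambda>x. 0"] f0 by simp
  next
    case True
    obtain F where F: "\<And>x. (F has_real_derivative f x) (at x)"
      using ex_global_antiderivative test_function_integrable(2)[OF f] by blast
    have contF: "continuous_on UNIV F"
      using F by (metis DERIV_isCont continuous_at_imp_continuous_on)
    have F0: "(F has_real_derivative 0) (at x)" if "x < a0 \<or> x > b0" for x
      using F[of x] ab0(4)[of x] that by auto
    let ?G = "\<lambda>x. F x - F a0"
    have G: "(?G has_real_derivative f x) (at x)" for x
      using F[of x] by (auto intro!: derivative_eq_intros)
    have "(LBINT x. indicator {a0..b0} x *\<^sub>R f x) = F b0 - F a0"
      by (rule integral_FTC_atLeastAtMost)
        (use True F test_function_integrable(2)[OF f] in
          \<open>auto simp: has_real_derivative_iff_has_vector_derivative intro: has_vector_derivative_at_within continuous_on_subset\<close>)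
    moreover have "(\<lambda>x. indicator {a0..b0} x *\<^sub>R f x) = f"
      using ab0(4) by (force simp: indicator_def)
    ultimately have Fb: "F b0 = F a0" using int0 by simp
    have "?G x = 0" if "x \<notin> {a0..b0}" for x
    proof (cases "x < a0")
      case True
      have "F a0 = F x"
        by (rule DERIV_isconst_end[OF True])
          (use contF F0 ab0(4) in \<open>auto intro: continuous_on_subset\<close>)
      then show ?thesis by simp
    next
      case False
      then have x: "b0 < x" using that by auto
      have "F x = F b0"
        by (rule DERIV_isconst_end[OF x])
          (use contF F0 ab0(4) in \<open>auto intro: continuous_on_subset\<close>)
      then show ?thesis using Fb by simp
    qed
    moreover have "Ck k ?G" for k
    proof (cases k)
      case 0
      then show ?thesis using Ck_continuous_real[OF Ck_Suc_realI[OF G ab0(1), of 0]] by simp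
    qed (use Ck_Suc_realI[OF G ab0(1)] in simp)
    ultimately have "test_function {a<..<b} ?G"
      unfolding test_function_Ioo using ab0 by blast
    then show ?thesis using that G by blast
  qed
qed

section \<open>Weak derivatives along slices\<close>

lemmas lborel_pair_integral_x = lborel_pair.integral_fst'[unfolded lborel_prod]
lemmas lborel_pair_integral_t = lborel_pair.integral_snd[unfolded lborel_prod]
lemmas lborel_pair_integrable_x = lborel_pair.integrable_fst'[unfolded lborel_prod]
lemmas lborel_pair_integrable_t = lborel_pair.integrable_snd[unfolded lborel_prod]
lemmas lborel_pair_AE_integrable_x = lborel_pair.AE_integrable_fst'[unfolded lborel_prod]
lemmas lborel_pair_AE_integrable_t = lborel_pair.AE_integrable_snd[unfolded lborel_prod]
lemmas lborel_pair_AE = lborel_pair.AE_pair[unfolded lborel_prod]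
lemmas lborel_pair_Fubini_integrable = lborel_pair.Fubini_integrable[unfolded lborel_prod]

lemma lborel_pair_iterated_t:
  fixes f :: "real \<times> real \<Rightarrow> real"
  assumes "integrable lborel f"
  shows "(LBINT t. (LBINT x. f (x, t))) = (LBINT z. f z)"
    and "integrable lborel (\<lambda>t. \<integral>x. f (x, t) \<partial>lborel)"
    and "AE t in lborel. integrable lborel (\<lambda>x. f (x, t))"
proof -
  have eq: "(\<lambda>(x, t). f (x, t)) = f" by auto
  show "(LBINT t. (LBINT x. f (x, t))) = (LBINT z. f z)"
    using lborel_pair_integral_t[of "\<lambda>x t. f (x, t)"] assms unfolding eq .
  show "integrable lborel (\<lambda>t. \<integral>x. f (x, t) \<partial>lborel)"
    using lborel_pair_integrable_t[of "\<lambda>x t. f (x, t)"] assms unfolding eq .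
  show "AE t in lborel. integrable lborel (\<lambda>x. f (x, t))"
    using lborel_pair_AE_integrable_t[of "\<lambda>x t. f (x, t)"] assms unfolding eq .
qed

text \<open>The exceptional set itself may fail to be measurable; enclosing it in a Borel null set
  makes the exchange of the two coordinates legitimate.\<close>

lemma lborel_pair_AE_t:
  assumes "AE z in lborel. P (z :: real \<times> real)"
  shows "AE t in lborel. AE x in lborel. P (x, t)"
proof -
  obtain N :: "(real \<times> real) set" where N: "{z. \<not> P z} \<subseteq> N" "N \<in> sets borel" "emeasure lborel N = 0"
    by (rule AE_E[OF assms]) simp
  have "N \<in> null_sets lborel" using N by (intro null_setsI) simp_all
  then have "AE z in lborel. z \<notin> N" by (rule AE_not_in)
  then have "AE x in lborel. AE t in lborel. (x, t) \<notin> N" by (rule lborel_pair_AE)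
  moreover have "{z \<in> space (lborel \<Otimes>\<^sub>M lborel). (fst z, snd z) \<notin> N} \<in> sets (lborel \<Otimes>\<^sub>M lborel)"
  proof -
    have "{z \<in> space (lborel \<Otimes>\<^sub>M lborel). (fst z, snd z) \<notin> N} = UNIV - N" by (auto simp: lborel_prod)
    then show ?thesis using N(2) unfolding lborel_prod by simp
  qed
  ultimately have "AE t in lborel. AE x in lborel. (x, t) \<notin> N"
    using lborel_pair.AE_commute[of "\<lambda>x t. (x, t) \<notin> N"] by simp
  then show ?thesis
  proof eventually_elim
    case (elim t)
    then show ?case by eventually_elim (use N(1) in blast)
  qed
qed

section \<open>Functions determined by their integrals over rectangles\<close>

lemma sets_borel_rectangles:
  "sets (borel :: (real \<times> real) measure) = sigma_sets UNIV {{a<..<b} \<times> {c<..<d} | a b c d. True}"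
proof -
  have "box (a, c) (b, d) = {a<..<b} \<times> {c<..<d}" for a b c d :: real
    by (auto simp: mem_box Basis_prod_def)
  then have "range (\<lambda>(p, q). box p q :: (real \<times> real) set) = {{a<..<b} \<times> {c<..<d} | a b c d. True}"
    by (auto simp: image_def)
  then show ?thesis
    by (subst borel_eq_box) simp
qed

text \<open>The sets over which \<open>u\<close> has integral zero form a Dynkin class, and open
  rectangles are an intersection-stable generator of the Borel sets. The whole plane is reached by
  exhaustion beforehand, because the complement step subtracts from it.\<close>

lemma AE_zero_if_integral_rectangles_zero:
  fixes u :: "real \<times> real \<Rightarrow> real"
  assumes u: "integrable lborel u"
    and rect: "\<And>a b c d. (LBINT z:{a<..<b} \<times> {c<..<d}. u z) = 0"
  shows "AE z in lborel. u z = 0"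
proof (rule sigma_finite_measure.density_zero[OF sigma_finite_lborel u])
  let ?G = "{{a<..<b} \<times> {c<..<d} | a b c d. True} :: (real \<times> real) set set"
  have su: "set_integrable lborel A u" if "A \<in> sets borel" for A
    unfolding set_integrable_def using that u by (intro integrable_mult_indicator) auto
  have stable: "Int_stable ?G"
  proof (rule Int_stableI)
    fix A B :: "(real \<times> real) set" assume "A \<in> ?G" "B \<in> ?G"
    then obtain a b c d a' b' c' d' :: real where "A = {a<..<b} \<times> {c<..<d}" "B = {a'<..<b'} \<times> {c'<..<d'}"
      by auto
    then have "A \<inter> B = {max a a'<..<min b b'} \<times> {max c c'<..<min d d'}" by auto
    then show "A \<inter> B \<in> ?G" by blast
  qed
  have sb: "sigma_sets UNIV ?G = sets borel" using sets_borel_rectangles by simp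
  have all: "(LBINT z. u z) = 0"
  proof -
    let ?I = "\<lambda>n::nat. {- real n<..<real n} \<times> {- real n<..<real n}"
    have "(\<lambda>n. \<integral>z. indicator (?I n) z *\<^sub>R u z \<partial>lborel) \<longlonglongrightarrow> (LBINT z. u z)"
    proof (rule integral_dominated_convergence[where w = "\<lambda>z. \<bar>u z\<bar>"])
      have "(\<lambda>n. indicator (?I n) z *\<^sub>R u z) \<longlonglongrightarrow> u z" for z
      proof (rule tendsto_eventually)
        obtain N :: nat where N: "\<bar>fst z\<bar> + \<bar>snd z\<bar> < real N" using reals_Archimedean2 by blast
        show "eventually (\<lambda>n. indicator (?I n) z *\<^sub>R u z = u z) sequentially"
          using eventually_ge_at_top[of N]
        proof eventually_elim
          case (elim n)
          then have "real N \<le> real n" by simp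
          with N have "z \<in> ?I n" by (auto simp: mem_Times_iff)
          then show ?case by simp
        qed
      qed
      then show "AE z in lborel. (\<lambda>n. indicator (?I n) z *\<^sub>R u z) \<longlonglongrightarrow> u z" by simp
      have "?I n \<in> sets borel" for n by (intro borel_Times) auto
      then show "(\<lambda>z. indicator (?I n) z *\<^sub>R u z) \<in> borel_measurable lborel" for n
        using u by (intro borel_measurable_scaleR borel_measurable_indicator) auto
    qed (use u in \<open>auto simp: indicator_def\<close>)
    moreover have "(LBINT z. indicator (?I n) z *\<^sub>R u z) = 0" for n
      using rect[of "- real n" "real n" "- real n" "real n"] by (simp add: set_lebesgue_integral_def)
    ultimately have "(\<lambda>n::nat. 0::real) \<longlonglongrightarrow> (LBINT z. u z)" by (simp only:)
    from LIMSEQ_unique[OF this tendsto_const] show ?thesis by simp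
  qed
  fix A :: "(real \<times> real) set" assume "A \<in> sets lborel"
  then have "A \<in> sigma_sets UNIV ?G" using sb by simp
  note A = this
  have "?G \<subseteq> Pow UNIV" by simp
  from stable this A show "set_lebesgue_integral lborel A u = 0"
  proof (induct rule: sigma_sets_induct_disjoint)
    case (basic A)
    then show ?case using rect by auto
  next
    case (compl A)
    then have A: "A \<in> sets borel" using sb by simp
    have "(LBINT z. u z) = (LBINT z:A \<union> (UNIV - A). u z)"
      by (simp add: set_lebesgue_integral_def)
    also have "\<dots> = set_lebesgue_integral lborel A u + set_lebesgue_integral lborel (UNIV - A) u"
      by (rule set_integral_Un) (use A su in auto)
    finally show ?case using all compl by simp
  next
    case (union A)
    then have Ab: "A i \<in> sets borel" for i unfolding sb by auto
    have "set_lebesgue_integral lborel (\<Union>i. A i) u = (\<Sum>i. set_lebesgue_integral lborel (A i) u)"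
      by (intro lebesgue_integral_countable_add su sets.countable_UN)
        (use Ab union in \<open>auto simp: disjoint_family_on_def\<close>)
    then show ?case using union by simp
  next
    case empty
    show ?case by (simp add: set_lebesgue_integral_def)
  qed
qed

lemma integral_hump_tendsto:
  fixes u :: "real \<times> real \<Rightarrow> real"
  assumes u: "integrable lborel u"
  shows "(\<lambda>n. \<integral>z. u z * (hump n r s (fst z) * hump n p q (snd z)) \<partial>lborel)
    \<longlonglongrightarrow> (LBINT z:{r<..<s} \<times> {p<..<q}. u z)"
  unfolding set_lebesgue_integral_def
proof (rule integral_dominated_convergence[where w = "\<lambda>z. \<bar>u z\<bar>"])
  have c: "continuous_on UNIV (hump n a b)" for n a b
    using test_function_integrable(2)[OF test_function_hump] .
  have m: "hump n a b \<in> borel_measurable borel" for n a b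
    using borel_measurable_continuous_onI[OF c] .
  note [measurable] = m
  show "(\<lambda>z. u z * (hump n r s (fst z) * hump n p q (snd z))) \<in> borel_measurable lborel" for n
  proof -
    have "(\<lambda>z::real \<times> real. hump n r s (fst z) * hump n p q (snd z)) \<in> borel_measurable borel"
      by (intro borel_measurable_continuous_onI continuous_intros continuous_on_compose2[OF c]) auto
    then show ?thesis using u by auto
  qed
  show "(\<lambda>z. indicat_real ({r<..<s} \<times> {p<..<q}) z *\<^sub>R u z) \<in> borel_measurable lborel"
    using u by (auto intro!: borel_measurable_times borel_measurable_indicator borel_Times)
  show "AE z in lborel. (\<lambda>n. u z * (hump n r s (fst z) * hump n p q (snd z))) \<longlonglongrightarrow> indicat_real ({r<..<s} \<times> {p<..<q}) z *\<^sub>R u z"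
  proof (rule AE_I2)
    fix z :: "real \<times> real"
    have "(\<lambda>n. u z * (hump n r s (fst z) * hump n p q (snd z))) \<longlonglongrightarrow> u z * (indicator {r<..<s} (fst z) * indicator {p<..<q} (snd z))"
      by (intro tendsto_intros hump_tendsto)
    moreover have "u z * (indicator {r<..<s} (fst z) * indicator {p<..<q} (snd z)) = indicat_real ({r<..<s} \<times> {p<..<q}) z *\<^sub>R u z"
      by (cases z) (auto simp: indicator_def)
    ultimately show "(\<lambda>n. u z * (hump n r s (fst z) * hump n p q (snd z))) \<longlonglongrightarrow> indicat_real ({r<..<s} \<times> {p<..<q}) z *\<^sub>R u z"
      by simp
  qed
  show "AE z in lborel. norm (u z * (hump n r s (fst z) * hump n p q (snd z))) \<le> \<bar>u z\<bar>" for n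
  proof (rule AE_I2)
    fix z :: "real \<times> real"
    have "\<bar>hump n r s (fst z) * hump n p q (snd z)\<bar> \<le> 1"
      using hump_bounds by (simp add: abs_mult mult_le_one)
    then show "norm (u z * (hump n r s (fst z) * hump n p q (snd z))) \<le> \<bar>u z\<bar>"
      by (simp add: abs_mult mult_left_le)
  qed
qed (use u in auto)

lemma integral_hump_1d_tendsto:
  assumes "p \<le> q"
  shows "(\<lambda>n. \<integral>x. hump n p q x \<partial>lborel) \<longlonglongrightarrow> q - p"
proof -
  have "(\<lambda>n. \<integral>x. hump n p q x \<partial>lborel) \<longlonglongrightarrow> (LBINT x. indicat_real {p<..<q} x)"
  proof (rule integral_dominated_convergence[where w = "indicat_real {p<..<q}"])
    show "AE x in lborel. norm (hump n p q x) \<le> indicat_real {p<..<q} x" for n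
    proof (rule AE_I2)
      fix x
      show "norm (hump n p q x) \<le> indicat_real {p<..<q} x"
      proof (cases "x \<in> {p<..<q}")
        case False
        then have "hump n p q x = 0"
          using test_function_hump[of p q n] unfolding test_function_def by auto
        with False show ?thesis by simp
      qed (use hump_bounds[of n p q x] in auto)
    qed
    show "hump n p q \<in> borel_measurable lborel" for n
      using test_function_integrable(1)[OF test_function_hump] by auto
    show "integrable lborel (indicat_real {p<..<q})"
      by (rule integrable_real_indicator) (use assms in auto)
  qed (use hump_tendsto in \<open>auto\<close>)
  then show ?thesis using assms by simp
qed

lemma abscont_primitive:
  fixes g :: "real \<Rightarrow> real"
  assumes "integrable lborel g"
  shows "abscont a b (\<lambda>t. LBINT s:{..t}. g s) g"
proof -
  have si: "set_integrable lborel A g" if "A \<in> sets borel" for A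
    unfolding set_integrable_def using that assms by (intro integrable_mult_indicator) auto
  have "(LBINT x:{..t}. g x) - (LBINT x:{..s}. g x) = (LBINT x:{s<..t}. g x)" if "s \<le> t" for s t
  proof -
    have eq: "{..t} = {..s} \<union> {s<..t}" using that by auto
    have "(LBINT x:{..s} \<union> {s<..t}. g x) = (LBINT x:{..s}. g x) + (LBINT x:{s<..t}. g x)"
      by (rule set_integral_Un) (use si in auto)
    then show ?thesis using eq by simp
  qed
  with si show ?thesis by (simp add: abscont_def)
qed

lemma test_function_deriv:
  fixes f :: "real \<Rightarrow> real"
  assumes f: "test_function {a<..<b} f"
  shows "test_function {a<..<b} (deriv f)"
proof -
  obtain a' b' where ab: "a < a'" "b' < b" "\<And>x. x \<notin> {a'..b'} \<Longrightarrow> f x = 0" and Ck: "\<And>k. Ck k f"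
    using f unfolding test_function_Ioo by blast
  have "deriv f x = 0" if "x \<notin> {a'..b'}" for x
  proof -
    have "open (- {a'..b'})" by (intro open_Compl) auto
    then have "((\<lambda>x. 0) has_real_derivative deriv f x) (at x)"
      by (intro has_field_derivative_transform_within_open[OF Ck_Suc_realD(1)[OF Ck, of x], where S = "- {a'..b'}"])
        (use that ab in auto)
    then show ?thesis using DERIV_unique DERIV_const by blast
  qed
  with ab Ck_Suc_realD(2)[OF Ck] show ?thesis unfolding test_function_Ioo by blast
qed

lemma test_function_bounded:
  fixes f :: "real \<Rightarrow> real"
  assumes f: "test_function {a<..<b} f"
  obtains B where "\<And>x. \<bar>f x\<bar> \<le> B" "B \<ge> 0"
proof -
  obtain a' b' where ab: "\<And>x. x \<notin> {a'..b'} \<Longrightarrow> f x = 0"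
    using f unfolding test_function_Ioo by blast
  have "compact (f ` {a'..b'})"
    using test_function_integrable(2)[OF f] by (intro compact_continuous_image) (auto intro: continuous_on_subset)
  then obtain B where "\<forall>y\<in>f ` {a'..b'}. \<bar>y\<bar> \<le> B"
    using compact_imp_bounded bounded_iff real_norm_def by metis
  then have B: "\<bar>f x\<bar> \<le> B" if "x \<in> {a'..b'}" for x using that by auto
  have "\<bar>f x\<bar> \<le> max B 0" for x
    using B[of x] ab[of x] by (cases "x \<in> {a'..b'}") auto
  then show ?thesis using that[of "max B 0"] by auto
qed

lemma integrable_mult_tensor:
  fixes u :: "real \<times> real \<Rightarrow> real"
  assumes u: "integrable lborel u" and f: "test_function {a<..<b} f" and g: "test_function {c<..<d} g"
  shows "integrable lborel (\<lambda>z. u z * (f (fst z) * g (snd z)))"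
proof -
  obtain A where A: "\<And>x. \<bar>f x\<bar> \<le> A" "A \<ge> 0" using test_function_bounded[OF f] by blast
  obtain B where B: "\<And>x. \<bar>g x\<bar> \<le> B" "B \<ge> 0" using test_function_bounded[OF g] by blast
  show ?thesis
  proof (rule Bochner_Integration.integrable_bound[where f = "\<lambda>z. (A * B) * u z"])
    have "(\<lambda>z::real \<times> real. f (fst z) * g (snd z)) \<in> borel_measurable borel"
      by (intro borel_measurable_continuous_onI continuous_intros continuous_on_compose2[OF test_function_integrable(2)[OF f]]
          continuous_on_compose2[OF test_function_integrable(2)[OF g]]) auto
    then show "(\<lambda>z. u z * (f (fst z) * g (snd z))) \<in> borel_measurable lborel" using u by auto
    show "AE z in lborel. norm (u z * (f (fst z) * g (snd z))) \<le> norm ((A * B) * u z)"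
    proof (rule AE_I2)
      fix z :: "real \<times> real"
      have "\<bar>f (fst z)\<bar> * \<bar>g (snd z)\<bar> \<le> A * B"
        using A B by (intro mult_mono) auto
      from mult_right_mono[OF this, of "\<bar>u z\<bar>"] show "norm (u z * (f (fst z) * g (snd z))) \<le> norm ((A * B) * u z)"
        using A(2) B(2) by (simp add: abs_mult mult.commute mult.left_commute)
    qed
  qed (use u in auto)
qed

text \<open>Integration by parts within the absolutely continuous class: both boundary terms carry
  \<open>\<beta>\<close>, which vanishes at \<open>c\<close> and at \<open>d\<close>.\<close>

lemma integral_primitive_times_deriv:
  fixes g :: "real \<Rightarrow> real"
  assumes g: "integrable lborel g" and \<beta>: "test_function {c<..<d} \<beta>" and "c < d"
  shows "(LBINT t. indicator {c<..<d} t * (LBINT s:{..t}. g s) * deriv \<beta> t) = - (LBINT t. g t * \<beta> t)"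
proof -
  let ?G = "\<lambda>t. LBINT s:{..t}. g s"
  obtain c' d' where cd: "c < c'" "d' < d" "\<And>x. x \<notin> {c'..d'} \<Longrightarrow> \<beta> x = 0" and Ck: "\<And>k. Ck k \<beta>"
    using \<beta> unfolding test_function_Ioo by blast
  note D = Ck_Suc_realD(1)[OF Ck] and C0 = Ck_Suc_realD(2)[OF Ck, of 0]
  have acG: "abscont c d ?G g" by (rule abscont_primitive[OF g])
  have acb: "abscont c d \<beta> (deriv \<beta>)"
    by (rule abscont_C1) (use D C0 in \<open>auto intro: DERIV_subset continuous_on_subset has_field_derivative_at_within\<close>)
  have b0: "\<beta> x = 0" if "x \<notin> {c<..<d}" for x using cd that by auto
  have db0: "deriv \<beta> x = 0" if "x \<notin> {c<..<d}" for x
    using test_function_deriv[OF \<beta>] that unfolding test_function_def by auto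
  note prod = abscont_mult[OF less_imp_le[OF \<open>c < d\<close>] acG acb]
  have i1: "set_integrable lborel {c<..d} (\<lambda>x. g x * \<beta> x)"
    by (rule set_integrable_mult_continuous[OF abscontD(1)[OF acG] abscont_continuous_on[OF acb]])
  have i2: "set_integrable lborel {c<..d} (\<lambda>x. ?G x * deriv \<beta> x)"
    using set_integrable_mult_continuous[OF abscontD(1)[OF acb] abscont_continuous_on[OF acG]] by (simp add: mult.commute)
  have "0 = ?G d * \<beta> d - ?G c * \<beta> c" using b0 by simp
  also have "\<dots> = (LBINT x:{c<..d}. g x * \<beta> x + ?G x * deriv \<beta> x)"
    by (rule abscontD(2)[OF prod]) (use \<open>c < d\<close> in auto)
  also have "\<dots> = (LBINT x:{c<..d}. g x * \<beta> x) + (LBINT x:{c<..d}. ?G x * deriv \<beta> x)"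
    by (rule set_integral_add(2)[OF i1 i2])
  also have "(LBINT x:{c<..d}. g x * \<beta> x) = (LBINT t. g t * \<beta> t)"
    unfolding set_lebesgue_integral_def
    
  proof (rule Bochner_Integration.integral_cong)
    show "indicat_real {c<..d} x *\<^sub>R (g x * \<beta> x) = g x * \<beta> x" for x
      using b0[of x] by (cases "x \<in> {c<..d}") auto
  qed simp
  also have "(LBINT x:{c<..d}. ?G x * deriv \<beta> x) = (LBINT t. indicator {c<..<d} t * ?G t * deriv \<beta> t)"
    unfolding set_lebesgue_integral_def
    by (rule Bochner_Integration.integral_cong) (use db0 in \<open>auto simp: indicator_def\<close>)
  finally show ?thesis by simp
qed

lemma test_function_mono:
  "test_function S f \<Longrightarrow> S \<subseteq> S' \<Longrightarrow> test_function S' f"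
  unfolding test_function_def by (meson order_trans)

lemma Ck_const_real: "Ck k (\<lambda>x::real. c)"
proof (induction k arbitrary: c)
  case (Suc k)
  show ?case by (rule Ck_Suc_realI[where f' = "\<lambda>_. 0"]) (auto intro: Suc)
qed auto

lemma test_function_lincomb:
  fixes f g :: "real \<Rightarrow> real"
  assumes "test_function {a<..<b} f" "test_function {a<..<b} g"
  shows "test_function {a<..<b} (\<lambda>x. A * f x + B * g x)"
proof -
  from assms(1) obtain K1 where 1: "\<And>k. Ck k f" "compact K1" "K1 \<subseteq> {a<..<b}" "\<And>x. x \<notin> K1 \<Longrightarrow> f x = 0"
    unfolding test_function_def by blast
  from assms(2) obtain K2 where 2: "\<And>k. Ck k g" "compact K2" "K2 \<subseteq> {a<..<b}" "\<And>x. x \<notin> K2 \<Longrightarrow> g x = 0"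
    unfolding test_function_def by blast
  show ?thesis
    unfolding test_function_def
  proof (intro conjI allI exI[of _ "K1 \<union> K2"])
    show "Ck k (\<lambda>x. A * f x + B * g x)" for k
      by (intro Ck_add_real Ck_mult_real Ck_const_real 1 2)
  qed (use 1 2 in auto)
qed

lemma lborel_AE_fst:
  assumes "AE x in lborel. P x"
  shows "AE z in lborel. P (fst (z :: real \<times> real))"
proof -
  obtain N :: "real set" where N: "{x. \<not> P x} \<subseteq> N" "N \<in> sets borel" "emeasure lborel N = 0"
    by (rule AE_E[OF assms]) simp
  have "N \<in> null_sets lborel" using N by (intro null_setsI) simp_all
  then have "AE x in lborel. x \<notin> N" by (rule AE_not_in)
  moreover have "{z::real \<times> real. fst z \<notin> N} \<in> sets borel"
  proof -
    have "(UNIV - N) \<times> UNIV \<in> sets borel" using N(2) by (intro borel_Times) auto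
    moreover have "{z::real \<times> real. fst z \<notin> N} = (UNIV - N) \<times> UNIV" by auto
    ultimately show ?thesis by simp
  qed
  moreover have "AE x in lborel. AE y in (lborel :: real measure). x \<notin> N"
    using \<open>AE x in lborel. x \<notin> N\<close> by eventually_elim simp
  ultimately have "AE z in lborel. fst (z :: real \<times> real) \<notin> N"
    using lborel_pair.AE_pair_measure[unfolded lborel_prod, of "\<lambda>z. fst z \<notin> N"] by simp
  then show ?thesis by eventually_elim (use N(1) in auto)
qed

lemma borel_measurable_tensor:
  fixes f g :: "real \<Rightarrow> real"
  assumes "f \<in> borel_measurable borel" "g \<in> borel_measurable borel"
  shows "(\<lambda>z::real \<times> real. f (fst z) * g (snd z)) \<in> borel_measurable borel"
proof -
  have "(\<lambda>z::real \<times> real. f (fst z)) \<in> borel_measurable borel"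
    by (rule measurable_compose[OF _ assms(1)]) (intro borel_measurable_continuous_onI continuous_intros)
  moreover have "(\<lambda>z::real \<times> real. g (snd z)) \<in> borel_measurable borel"
    by (rule measurable_compose[OF _ assms(2)]) (intro borel_measurable_continuous_onI continuous_intros)
  ultimately show ?thesis by (rule borel_measurable_times)
qed

lemma integrable_tensor:
  fixes f g :: "real \<Rightarrow> real"
  assumes f: "integrable lborel f" and g: "integrable lborel g"
  shows "integrable lborel (\<lambda>z. f (fst z) * g (snd z))"
proof (rule lborel_pair_Fubini_integrable)
  show "(\<lambda>z. f (fst z) * g (snd z)) \<in> borel_measurable lborel"
    using borel_measurable_tensor[of f g] f g by auto
  have "(LBINT y. norm (f (fst (x, y)) * g (snd (x, y)))) = \<bar>f x\<bar> * (LBINT y. \<bar>g y\<bar>)" for x :: real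
    by (simp add: abs_mult)
  then show "integrable lborel (\<lambda>x. \<integral>y. norm (f (fst (x, y)) * g (snd (x, y))) \<partial>lborel)"
    using f by simp
  show "AE x in lborel. integrable lborel (\<lambda>y. f (fst (x, y)) * g (snd (x, y)))"
    using g by simp
qed

lemma integral_tensor:
  fixes f g :: "real \<Rightarrow> real"
  assumes f: "integrable lborel f" and g: "integrable lborel g"
  shows "(LBINT z. f (fst z) * g (snd z)) = (LBINT x. f x) * (LBINT y. g y)"
  using lborel_pair_integral_x[OF integrable_tensor[OF f g], symmetric] by simp

text \<open>An integral with variable endpoint \<open>t\<close> is a parameter integral weighted by
  the indicator of the closed set \<open>s \<le> t\<close>, which is jointly Borel.\<close>

lemma borel_measurable_primitive [measurable]:
  fixes g :: "real \<times> real \<Rightarrow> real"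
  assumes "g \<in> borel_measurable borel"
  shows "(\<lambda>z::real \<times> real. LBINT s:{..snd z}. g (fst z, s)) \<in> borel_measurable borel"
proof -
  have "(\<lambda>(z::real \<times> real, s::real). indicator {..snd z} s *\<^sub>R g (fst z, s)) \<in> borel_measurable (borel \<Otimes>\<^sub>M lborel)"
  proof -
    have [measurable]: "g \<in> borel_measurable (borel \<Otimes>\<^sub>M borel)" using assms by (simp add: borel_prod)
    have "(\<lambda>p::(real \<times> real) \<times> real. g (fst (fst p), snd p)) \<in> borel_measurable borel"
      by (intro measurable_compose[OF _ assms] borel_measurable_continuous_onI continuous_intros)
    moreover have "(\<lambda>p::(real \<times> real) \<times> real. indicator {..snd (fst p)} (snd p) :: real) \<in> borel_measurable borel"
    proof -
      have "{p::(real \<times> real) \<times> real. snd p \<le> snd (fst p)} \<in> sets borel"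
        by (intro borel_closed closed_Collect_le continuous_intros)
      then have "(indicator {p::(real \<times> real) \<times> real. snd p \<le> snd (fst p)} :: _ \<Rightarrow> real) \<in> borel_measurable borel"
        by simp
      moreover have "indicator {p::(real \<times> real) \<times> real. snd p \<le> snd (fst p)} = (\<lambda>p. indicat_real {..snd (fst p)} (snd p))"
        by (auto simp: indicator_def)
      ultimately show ?thesis by simp
    qed
    ultimately have "(\<lambda>p::(real \<times> real) \<times> real. indicator {..snd (fst p)} (snd p) *\<^sub>R g (fst (fst p), snd p)) \<in> borel_measurable borel"
      by simp
    moreover have "sets (borel \<Otimes>\<^sub>M lborel) = sets (borel :: ((real \<times> real) \<times> real) measure)"
      unfolding borel_prod[symmetric] by (intro sets_pair_measure_cong) auto
    ultimately show ?thesis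
      unfolding split_beta' by (subst measurable_cong_sets[OF _ refl])
  qed
  then show ?thesis
    unfolding set_lebesgue_integral_def
    by (rule lborel.borel_measurable_lebesgue_integral)
qed

text \<open>The lemma of du Bois-Reymond: testing with primitives of differences of normalised bumps shows
  that the averages of \<open>w\<close> minus a primitive of \<open>g\<close> over \<open>J \<times> I\<close> do not depend on \<open>I\<close>.\<close>

lemma weak_deriv_on_rectangle:
  fixes w g :: "real \<times> real \<Rightarrow> real"
  assumes w: "integrable lborel w" and g: "integrable lborel g"
    and weak: "\<And>\<alpha> \<beta>. test_function {a<..<b} \<alpha> \<Longrightarrow> test_function {c<..<d} \<beta> \<Longrightarrow>
      (LBINT z. w z * (\<alpha> (fst z) * deriv \<beta> (snd z))) = - (LBINT z. g z * (\<alpha> (fst z) * \<beta> (snd z)))"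
  shows "AE x in lborel. x \<in> {a<..<b} \<longrightarrow>
    (\<exists>k. AE t in lborel. t \<in> {c<..<d} \<longrightarrow> w (x, t) = (LBINT s:{..t}. g (x, s)) + k)"
proof (cases "a < b \<and> c < d")
  case False
  then show ?thesis by (intro AE_I2) auto
next
  case True
  then have "a < b" "c < d" by auto
  define R where "R = {a<..<b} \<times> {c<..<d}"
  define G where "G = (\<lambda>z::real \<times> real. LBINT s:{..snd z}. g (fst z, s))"
  \<comment> \<open>Subtracting the primitive \<open>G\<close> of \<open>g\<close> removes the weak
    time derivative, so the remainder \<open>u\<close> has to be shown to depend on \<open>x\<close>
    only.\<close>
  define u where "u = (\<lambda>z. indicator R z * (w z - G z))"
  have Rb [measurable]: "R \<in> sets borel" unfolding R_def by (intro borel_Times) auto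
  have gm [measurable]: "g \<in> borel_measurable borel" and wm [measurable]: "w \<in> borel_measurable borel"
    using g w by auto
  have Gm [measurable]: "G \<in> borel_measurable borel"
    unfolding G_def by (rule borel_measurable_primitive[OF gm])
  have gx: "AE x in lborel. integrable lborel (\<lambda>s. g (x, s))"
    using lborel_pair_AE_integrable_x[OF g] .
  \<comment> \<open>\<open>G\<close> is dominated by the full time integral of the modulus of
    \<open>g\<close>, an integrable function of \<open>x\<close> alone; boundedness of the time
    window makes this bound integrable on the plane.\<close>
  have Gint: "integrable lborel (\<lambda>z. indicator R z * G z)"
  proof (rule Bochner_Integration.integrable_bound[where f = "\<lambda>z. indicator {a<..<b} (fst z) * (LBINT s. \<bar>g (fst z, s)\<bar>) * indicator {c<..<d} (snd z)"])
    have N: "integrable lborel (\<lambda>x. \<integral>s. \<bar>g (x, s)\<bar> \<partial>lborel)"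
      using lborel_pair_integrable_x[of "\<lambda>z. \<bar>g z\<bar>"] g by auto
    have Nm [measurable]: "(\<lambda>x. \<integral>s. \<bar>g (x, s)\<bar> \<partial>lborel) \<in> borel_measurable borel" using N by auto
    have "integrable lborel (\<lambda>x. indicat_real {a<..<b} x *\<^sub>R (LBINT s. \<bar>g (x, s)\<bar>))"
      using N by (intro integrable_mult_indicator) auto
    moreover have "integrable lborel (indicat_real {c<..<d})"
      by (rule integrable_real_indicator) (use \<open>c < d\<close> in auto)
    note integrable_tensor[OF calculation this]
    then
    show "integrable lborel (\<lambda>z. indicator {a<..<b} (fst z) * (LBINT s. \<bar>g (fst z, s)\<bar>) * indicator {c<..<d} (snd z))"
      by simp
    have "AE z in lborel. integrable lborel (\<lambda>s. g (fst (z :: real \<times> real), s))"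
      using lborel_AE_fst[OF gx] .
    then show "AE z in lborel. norm (indicator R z * G z)
        \<le> norm (indicator {a<..<b} (fst z) * (LBINT s. \<bar>g (fst z, s)\<bar>) * indicator {c<..<d} (snd z))"
    proof eventually_elim
      case (elim z)
      have "\<bar>G z\<bar> \<le> (LBINT s. \<bar>indicator {..snd z} s *\<^sub>R g (fst z, s)\<bar>)"
        unfolding G_def set_lebesgue_integral_def by (rule integral_abs_bound)
      also have "\<dots> \<le> (LBINT s. \<bar>g (fst z, s)\<bar>)"
        using elim integrable_mult_indicator[OF _ elim, of "{..snd z}"]
        by (intro integral_mono integrable_abs) (auto simp: indicator_def)
      finally show ?case
        by (cases z) (auto simp: R_def indicator_def integral_nonneg_AE)
    qed
  qed auto
  have uint: "integrable lborel u"
  proof -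
    have "integrable lborel (\<lambda>z. indicator R z *\<^sub>R w z)" using w by (intro integrable_mult_indicator) auto
    from Bochner_Integration.integrable_diff[OF this Gint] show ?thesis
      unfolding u_def by (simp add: algebra_simps)
  qed
  have step1: "(LBINT z. u z * (\<alpha> (fst z) * deriv \<beta> (snd z))) = 0"
    if \<alpha>: "test_function {a<..<b} \<alpha>" and \<beta>: "test_function {c<..<d} \<beta>" for \<alpha> \<beta>
  proof -
    have \<alpha>0: "\<alpha> x = 0" if "x \<notin> {a<..<b}" for x using \<alpha> that unfolding test_function_def by auto
    have \<beta>0: "deriv \<beta> x = 0" if "x \<notin> {c<..<d}" for x
      using test_function_deriv[OF \<beta>] that unfolding test_function_def by auto
    note d\<beta> = test_function_deriv[OF \<beta>]
    have i1: "integrable lborel (\<lambda>z. w z * (\<alpha> (fst z) * deriv \<beta> (snd z)))"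
      by (rule integrable_mult_tensor[OF w \<alpha> d\<beta>])
    have i2: "integrable lborel (\<lambda>z. indicator R z * G z * (\<alpha> (fst z) * deriv \<beta> (snd z)))"
      by (rule integrable_mult_tensor[OF Gint \<alpha> d\<beta>])
    have i3: "integrable lborel (\<lambda>z. g z * (\<alpha> (fst z) * \<beta> (snd z)))"
      by (rule integrable_mult_tensor[OF g \<alpha> \<beta>])
    have "u z * (\<alpha> (fst z) * deriv \<beta> (snd z)) =
        w z * (\<alpha> (fst z) * deriv \<beta> (snd z)) - indicator R z * G z * (\<alpha> (fst z) * deriv \<beta> (snd z))" for z
    proof (cases "z \<in> R")
      case False
      then have "\<alpha> (fst z) * deriv \<beta> (snd z) = 0"
        using \<alpha>0[of "fst z"] \<beta>0[of "snd z"] unfolding R_def mem_Times_iff by (metis mult_eq_0_iff)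
      then show ?thesis by (simp only: mult_zero_right diff_self)
    qed (simp add: u_def left_diff_distrib)
    then have "(LBINT z. u z * (\<alpha> (fst z) * deriv \<beta> (snd z)))
        = - (LBINT z. g z * (\<alpha> (fst z) * \<beta> (snd z))) - (LBINT z. indicator R z * G z * (\<alpha> (fst z) * deriv \<beta> (snd z)))"
      using i1 i2 weak[OF \<alpha> \<beta>] by simp
    also have "(LBINT z. indicator R z * G z * (\<alpha> (fst z) * deriv \<beta> (snd z)))
        = (LBINT x. (LBINT t. indicator R (x, t) * G (x, t) * (\<alpha> x * deriv \<beta> t)))"
      using lborel_pair_integral_x[OF i2] by simp
    also have "\<dots> = (LBINT x. - (LBINT t. g (x, t) * (\<alpha> x * \<beta> t)))"
    proof (rule integral_cong_AE)
      show "(\<lambda>x. \<integral>t. indicator R (x, t) * G (x, t) * (\<alpha> x * deriv \<beta> t) \<partial>lborel) \<in> borel_measurable lborel"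
        using lborel_pair_integrable_x[OF i2] by auto
      show "(\<lambda>x. - (LBINT t. g (x, t) * (\<alpha> x * \<beta> t))) \<in> borel_measurable lborel"
        using lborel_pair_integrable_x[OF i3] by auto
      show "AE x in lborel. (LBINT t. indicator R (x, t) * G (x, t) * (\<alpha> x * deriv \<beta> t)) = - (LBINT t. g (x, t) * (\<alpha> x * \<beta> t))"
        using gx
      proof eventually_elim
        case (elim x)
        have "(LBINT t. indicator R (x, t) * G (x, t) * (\<alpha> x * deriv \<beta> t))
            = (LBINT t. \<alpha> x * (indicator {c<..<d} t * (LBINT s:{..t}. g (x, s)) * deriv \<beta> t))"
          by (rule Bochner_Integration.integral_cong) (use \<alpha>0[of x] in \<open>auto simp: R_def G_def indicator_def\<close>)
        also have "\<dots> = \<alpha> x * - (LBINT t. g (x, t) * \<beta> t)"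
          using integral_primitive_times_deriv[OF elim \<beta> \<open>c < d\<close>] by simp
        also have "\<dots> = - (LBINT t. \<alpha> x * (g (x, t) * \<beta> t))" by simp
        finally show ?case by (simp add: mult.left_commute)
      qed
    qed
    also have "\<dots> = - (LBINT z. g z * (\<alpha> (fst z) * \<beta> (snd z)))"
      using lborel_pair_integral_x[OF i3] by simp
    finally show ?thesis by simp
  qed
  \<comment> \<open>Equality of the mean values of \<open>u\<close> over two time windows,
    cross-multiplied. The two bumps, each multiplied by the integral of the other, have a difference
    of mean zero; its primitive is a test function, and \<open>step1\<close> applies to it.\<close>
  have step2: "(q' - p') * (LBINT z:{r<..<s} \<times> {p<..<q}. u z) = (q - p) * (LBINT z:{r<..<s} \<times> {p'<..<q'}. u z)"
    if J: "{r<..<s} \<subseteq> {a<..<b}" and I: "{p<..<q} \<subseteq> {c<..<d}" "p \<le> q" and I': "{p'<..<q'} \<subseteq> {c<..<d}" "p' \<le> q'"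
    for r s p q p' q'
  proof -
    let ?m = "\<lambda>p q n. LBINT x. hump n p q x"
    let ?i = "\<lambda>p q n. LBINT z. u z * (hump n r s (fst z) * hump n p q (snd z))"
    have eq: "?m p' q' n * ?i p q n = ?m p q n * ?i p' q' n" for n
    proof -
      let ?f = "\<lambda>x. ?m p' q' n * hump n p q x + (- ?m p q n) * hump n p' q' x"
      have h: "test_function {a<..<b} (hump n r s)" "test_function {c<..<d} (hump n p q)" "test_function {c<..<d} (hump n p' q')"
        using test_function_hump J I I' by (auto intro: test_function_mono)
      have f: "test_function {c<..<d} ?f" by (rule test_function_lincomb[OF h(2,3)])
      have "(LBINT x. ?f x) = ?m p' q' n * ?m p q n + (- ?m p q n) * ?m p' q' n"
        using test_function_integrable(1)[OF h(2)] test_function_integrable(1)[OF h(3)]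
        by (subst Bochner_Integration.integral_add) auto
      then obtain F where F: "test_function {c<..<d} F" "\<And>x. (F has_real_derivative ?f x) (at x)"
        using test_function_antiderivative[OF f] by auto
      have "deriv F = ?f" using DERIV_imp_deriv[OF F(2)] by auto
      then have "0 = (LBINT z. u z * (hump n r s (fst z) * ?f (snd z)))"
        using step1[OF h(1) F(1)] by simp
      also have "\<dots> = (LBINT z. ?m p' q' n * (u z * (hump n r s (fst z) * hump n p q (snd z)))
          - ?m p q n * (u z * (hump n r s (fst z) * hump n p' q' (snd z))))"
        by (rule Bochner_Integration.integral_cong) (auto simp: algebra_simps)
      also have "\<dots> = ?m p' q' n * ?i p q n - ?m p q n * ?i p' q' n"
        using integrable_mult_tensor[OF uint h(1,2)] integrable_mult_tensor[OF uint h(1,3)]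
        by (subst Bochner_Integration.integral_diff) auto
      finally show ?thesis by simp
    qed
    have "(\<lambda>n. ?m p' q' n * ?i p q n) \<longlonglongrightarrow> (q' - p') * (LBINT z:{r<..<s} \<times> {p<..<q}. u z)"
      by (intro tendsto_mult integral_hump_1d_tendsto integral_hump_tendsto uint I' I)
    moreover have "(\<lambda>n. ?m p q n * ?i p' q' n) \<longlonglongrightarrow> (q - p) * (LBINT z:{r<..<s} \<times> {p'<..<q'}. u z)"
      by (intro tendsto_mult integral_hump_1d_tendsto integral_hump_tendsto uint I' I)
    ultimately show ?thesis unfolding eq by (rule LIMSEQ_unique)
  qed
  \<comment> \<open>A function of \<open>x\<close> alone equals its mean over the time window; since
    \<open>u\<close> vanishes off \<open>R\<close>, the integral may run over all times.\<close>
  define K where "K = (\<lambda>x. (LBINT t. u (x, t)) / (d - c))"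
  have Kint: "integrable lborel K"
    unfolding K_def using lborel_pair_integrable_x[OF uint] by simp
  have cdint: "integrable lborel (indicat_real {c<..<d})"
    by (rule integrable_real_indicator) (use \<open>c < d\<close> in auto)
  have KR: "integrable lborel (\<lambda>z. K (fst z) * indicator {c<..<d} (snd z))"
    by (rule integrable_tensor[OF Kint cdint])
  have "AE z in lborel. u z - K (fst z) * indicator {c<..<d} (snd z) = 0"
  proof (rule AE_zero_if_integral_rectangles_zero)
    show "integrable lborel (\<lambda>z. u z - K (fst z) * indicator {c<..<d} (snd z))"
      using uint KR by simp
    fix r s p q
    \<comment> \<open>Both functions vanish outside \<open>R\<close>, so an arbitrary rectangle may
      be cut down to its part in \<open>R\<close>, where \<open>step2\<close> is available.\<close>
    define r' s' p' q' where "r' = max a r" "s' = min b s" "p' = max c p" "q' = min d q"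
    note defs = this
    have cut: "u z = 0 \<and> K (fst z) * indicator {c<..<d} (snd z) = 0" if "z \<notin> R" for z
    proof -
      have "u (x, t) = 0" if "x \<notin> {a<..<b}" for x t using that by (auto simp: u_def R_def)
      then have "K x = 0" if "x \<notin> {a<..<b}" for x using that by (simp add: K_def)
      with that show ?thesis by (auto simp: u_def R_def mem_Times_iff indicator_def)
    qed
    have "(LBINT z:{r<..<s} \<times> {p<..<q}. u z - K (fst z) * indicator {c<..<d} (snd z))
        = (LBINT z:{r'<..<s'} \<times> {p'<..<q'}. u z - K (fst z) * indicator {c<..<d} (snd z))"
      unfolding set_lebesgue_integral_def
    proof (rule Bochner_Integration.integral_cong)
      fix z :: "real \<times> real"
      show "indicat_real ({r<..<s} \<times> {p<..<q}) z *\<^sub>R (u z - K (fst z) * indicator {c<..<d} (snd z))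
        = indicat_real ({r'<..<s'} \<times> {p'<..<q'}) z *\<^sub>R (u z - K (fst z) * indicator {c<..<d} (snd z))"
      proof (cases "z \<in> R")
        case True
        then have "z \<in> {r<..<s} \<times> {p<..<q} \<longleftrightarrow> z \<in> {r'<..<s'} \<times> {p'<..<q'}"
          by (auto simp: R_def defs)
        then show ?thesis by (simp add: indicator_def)
      qed (use cut in simp)
    qed simp
    also have "\<dots> = 0"
    proof (cases "p' < q'")
      case False
      then have "{p'<..<q'} = {}" by auto
      then show ?thesis by (simp add: set_lebesgue_integral_def)
    next
      case True
      let ?S = "{r'<..<s'} \<times> {p'<..<q'}" and ?S' = "{r'<..<s'} \<times> {c<..<d}"
      have si: "set_integrable lborel A h" if "A \<in> sets borel" "integrable lborel h" for A and h :: "real \<times> real \<Rightarrow> real"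
        unfolding set_integrable_def using that by (intro integrable_mult_indicator) auto
      have Sb: "?S \<in> sets borel" "?S' \<in> sets borel" by (auto intro: borel_Times)
      have J: "{r'<..<s'} \<subseteq> {a<..<b}" and I: "{p'<..<q'} \<subseteq> {c<..<d}" by (auto simp: defs)
      have Ji: "integrable lborel (\<lambda>x. indicat_real {r'<..<s'} x * K x)"
        using integrable_mult_indicator[OF _ Kint, of "{r'<..<s'}"] by simp
      have Ii: "integrable lborel (indicat_real {p'<..<q'})"
        by (rule integrable_real_indicator) (use True in auto)
      \<comment> \<open>The window \<open>(p', q')\<close> is compared with the full window
        \<open>(c, d)\<close>, over which the time integral of \<open>u\<close> is
        \<open>(d - c) * K\<close> by the choice of \<open>K\<close>.\<close>
      have "(d - c) * (LBINT z:?S. u z) = (q' - p') * (LBINT z:?S'. u z)"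
        by (rule step2[OF J I]) (use True \<open>c < d\<close> in auto)
      also have "(LBINT z:?S'. u z) = (LBINT z. indicat_real {r'<..<s'} (fst z) * u z)"
        unfolding set_lebesgue_integral_def
        by (rule Bochner_Integration.integral_cong) (auto simp: u_def R_def indicator_def)
      also have "\<dots> = (LBINT x. (LBINT t. indicat_real {r'<..<s'} x * u (x, t)))"
      proof -
        have "integrable lborel (\<lambda>z. indicat_real ({r'<..<s'} \<times> UNIV) z *\<^sub>R u z)"
          by (rule integrable_mult_indicator[OF _ uint]) (auto intro: borel_Times)
        moreover have "indicat_real ({r'<..<s'} \<times> UNIV) z = indicat_real {r'<..<s'} (fst z)" for z :: "real \<times> real"
          by (auto simp: indicator_def mem_Times_iff)
        ultimately have "integrable lborel (\<lambda>z. indicat_real {r'<..<s'} (fst z) * u z)" by simp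
        from lborel_pair_integral_x[OF this] show ?thesis by simp
      qed
      also have "\<dots> = (LBINT x. (d - c) * (indicat_real {r'<..<s'} x * K x))"
        using \<open>c < d\<close> by (simp add: K_def)
      also have "\<dots> = (d - c) * (LBINT x. indicat_real {r'<..<s'} x * K x)" by simp
      finally have "(d - c) * (LBINT z:?S. u z) = (d - c) * ((LBINT x. indicat_real {r'<..<s'} x * K x) * (q' - p'))"
        by (simp only: mult.left_commute mult.commute)
      then have "(LBINT z:?S. u z) = (LBINT x. indicat_real {r'<..<s'} x * K x) * (q' - p')"
        using \<open>c < d\<close> by (subst (asm) mult_left_cancel) auto
      also have "\<dots> = (LBINT x. indicat_real {r'<..<s'} x * K x) * (LBINT t. indicat_real {p'<..<q'} t)"
        using True by simp
      also have "\<dots> = (LBINT z. (indicat_real {r'<..<s'} (fst z) * K (fst z)) * indicat_real {p'<..<q'} (snd z))"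
        by (rule integral_tensor[OF Ji Ii, symmetric])
      also have "\<dots> = (LBINT z:?S. K (fst z) * indicator {c<..<d} (snd z))"
        unfolding set_lebesgue_integral_def
        by (rule Bochner_Integration.integral_cong) (use I in \<open>auto simp: indicator_def\<close>)
      finally show ?thesis
        using si[OF Sb(1) uint] si[OF Sb(1) KR] by (subst set_integral_diff) auto
    qed
    finally show "(LBINT z:{r<..<s} \<times> {p<..<q}. u z - K (fst z) * indicator {c<..<d} (snd z)) = 0" .
  qed
  from lborel_pair_AE[OF this] show ?thesis
  proof eventually_elim
    case (elim x)
    show ?case
    proof (intro impI exI)
      assume x: "x \<in> {a<..<b}"
      show "AE t in lborel. t \<in> {c<..<d} \<longrightarrow> w (x, t) = (LBINT s:{..t}. g (x, s)) + K x"
        using elim by eventually_elim (use x in \<open>auto simp: u_def R_def G_def\<close>)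
    qed
  qed
qed

section \<open>From rectangles to lines in an open set\<close>

lemma not_AE_not_in_Ioo:
  assumes "(a::real) < b"
  shows "\<not> (AE t in lborel. t \<notin> {a<..<b})"
proof
  assume "AE t in lborel. t \<notin> {a<..<b}"
  then have "{a<..<b} \<in> null_sets lborel"
    by (subst AE_iff_null_sets) auto
  then show False using assms by auto
qed

lemma AE_Ioo_witness:
  assumes "AE t in lborel. t \<in> {a<..<b} \<longrightarrow> P t" "(a::real) < b"
  obtains t where "t \<in> {a<..<b}" "P t"
proof -
  have "\<exists>t\<in>{a<..<b}. P t"
  proof (rule ccontr)
    assume "\<not> ?thesis"
    with assms(1) have "AE t in lborel. t \<notin> {a<..<b}" by auto
    with not_AE_not_in_Ioo[OF assms(2)] show False by simp
  qed
  then show ?thesis using that by blast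
qed

lemma open_slice:
  fixes Q :: "(real \<times> real) set"
  assumes "open Q"
  shows "open {t. (x, t) \<in> Q}" and "open {x. (x, t) \<in> Q}"
proof -
  have "open (Pair x -` Q)" "open ((\<lambda>x. (x, t)) -` Q)"
    by (intro open_vimage assms continuous_intros)+
  then show "open {t. (x, t) \<in> Q}" "open {x. (x, t) \<in> Q}" by (simp_all add: vimage_def)
qed

text \<open>Rational corners leave only countably many rectangles, so that the exceptional null sets
  of all of them can be discarded together.\<close>

lemma rational_rectangle_around_segment:
  fixes Q :: "(real \<times> real) set"
  assumes Q: "open Q" and "s \<le> t" and seg: "{x} \<times> {s..t} \<subseteq> Q"
  obtains a b c d where "a \<in> \<rat>" "b \<in> \<rat>" "c \<in> \<rat>" "d \<in> \<rat>" "a < x" "x < b" "c < s" "t < d"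
    "{a<..<b} \<times> {c<..<d} \<subseteq> Q"
proof -
  have cpt: "compact ({x} \<times> {s..t})" by (intro compact_Times) auto
  obtain e where e: "e > 0" "\<And>z. z \<in> {x} \<times> {s..t} \<Longrightarrow> ball z e \<subseteq> Q"
    using Heine_Borel_lemma[OF cpt, of "{Q}"] Q seg by auto
  have h: "e / 2 > 0" using e by simp
  obtain a where a: "a \<in> \<rat>" "x - e/2 < a" "a < x" using Rats_dense_in_real[of "x - e/2" x] h by auto
  obtain b where b: "b \<in> \<rat>" "x < b" "b < x + e/2" using Rats_dense_in_real[of x "x + e/2"] h by auto
  obtain c where c: "c \<in> \<rat>" "s - e/2 < c" "c < s" using Rats_dense_in_real[of "s - e/2" s] h by auto
  obtain d where d: "d \<in> \<rat>" "t < d" "d < t + e/2" using Rats_dense_in_real[of t "t + e/2"] h by auto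
  have "(y, \<tau>) \<in> Q" if y: "a < y" "y < b" and \<tau>: "c < \<tau>" "\<tau> < d" for y \<tau>
  proof -
    \<comment> \<open>The point of \<open>[s, t]\<close> nearest to \<open>\<tau>\<close>. The
      margin \<open>e / 2\<close> in each coordinate then places \<open>(y, \<tau>)\<close> in the
      ball of radius \<open>e\<close> around \<open>(x, \<sigma>)\<close>.\<close>
    define \<sigma> where "\<sigma> = max s (min t \<tau>)"
    have \<sigma>: "\<sigma> \<in> {s..t}" "\<bar>\<tau> - \<sigma>\<bar> < e/2"
      using \<open>s \<le> t\<close> \<tau> c d h unfolding \<sigma>_def max_def min_def by (auto split: if_splits)
    have "dist (x, \<sigma>) (y, \<tau>) \<le> \<bar>x - y\<bar> + \<bar>\<sigma> - \<tau>\<bar>"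
      unfolding dist_Pair_Pair dist_real_def using sqrt_sum_squares_le_sum_abs by (metis abs_idempotent)
    also have "\<dots> < e/2 + e/2"
    proof (rule add_strict_mono)
      show "\<bar>x - y\<bar> < e/2" using y a b by linarith
      show "\<bar>\<sigma> - \<tau>\<bar> < e/2" using \<sigma> by linarith
    qed
    finally have "(y, \<tau>) \<in> ball (x, \<sigma>) e" by simp
    then show ?thesis using e(2)[of "(x, \<sigma>)"] \<sigma> by auto
  qed
  then have "{a<..<b} \<times> {c<..<d} \<subseteq> Q" by auto
  with a b c d show ?thesis by (intro that[of a b c d])
qed

text \<open>A slice of an open set may have many components, so the constant of integration becomes
  a function \<open>K\<close> that is constant along segments inside \<open>Q\<close>. The rectangle
  lemma supplies constants on rational windows, and overlapping windows carry the same one.\<close>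

lemma weak_deriv_slices:
  fixes w g :: "real \<times> real \<Rightarrow> real"
  assumes Q: "open Q" and w: "integrable lborel w" and g: "integrable lborel g"
    and weak: "\<And>a b c d \<alpha> \<beta>. {a<..<b} \<times> {c<..<d} \<subseteq> Q \<Longrightarrow>
      test_function {a<..<b} \<alpha> \<Longrightarrow> test_function {c<..<d} \<beta> \<Longrightarrow>
      (LBINT z. w z * (\<alpha> (fst z) * deriv \<beta> (snd z))) = - (LBINT z. g z * (\<alpha> (fst z) * \<beta> (snd z)))"
  shows "AE x in lborel. \<exists>K. (\<forall>s t. s \<le> t \<longrightarrow> {x} \<times> {s..t} \<subseteq> Q \<longrightarrow> K s = K t) \<and>
    (AE t in lborel. (x, t) \<in> Q \<longrightarrow> w (x, t) = (LBINT s:{..t}. g (x, s)) + K t)"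
proof -
  have "AE x in lborel. \<forall>a\<in>\<rat>. \<forall>b\<in>\<rat>. \<forall>c\<in>\<rat>. \<forall>d\<in>\<rat>. {a<..<b} \<times> {c<..<d} \<subseteq> Q \<longrightarrow> x \<in> {a<..<b} \<longrightarrow>
    (\<exists>k. AE t in lborel. t \<in> {c<..<d} \<longrightarrow> w (x, t) = (LBINT s:{..t}. g (x, s)) + k)"
    by (intro AE_ball_countable[THEN iffD2] ballI countable_rat)
      (use weak_deriv_on_rectangle[OF w g weak] in \<open>auto intro: AE_impI\<close>)
  then show ?thesis
  proof eventually_elim
    case (elim x)
    define u where "u = (\<lambda>t. w (x, t) - (LBINT s:{..t}. g (x, s)))"
    define P where "P c d k \<longleftrightarrow> {x} \<times> {c<..<d} \<subseteq> Q \<and> (AE t in lborel. t \<in> {c<..<d} \<longrightarrow> u t = k)" for c d k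
    have seg: "\<exists>c\<in>\<rat>. \<exists>d\<in>\<rat>. \<exists>k. c < s \<and> t < d \<and> P c d k" if st: "s \<le> t" "{x} \<times> {s..t} \<subseteq> Q" for s t
    proof -
      obtain a b c d where abcd: "a \<in> \<rat>" "b \<in> \<rat>" "c \<in> \<rat>" "d \<in> \<rat>" "a < x" "x < b" "c < s" "t < d"
        "{a<..<b} \<times> {c<..<d} \<subseteq> Q"
        by (rule rational_rectangle_around_segment[OF Q st])
      with elim obtain k where k: "AE t in lborel. t \<in> {c<..<d} \<longrightarrow> w (x, t) = (LBINT s:{..t}. g (x, s)) + k"
        using bspec[OF bspec[OF bspec[OF bspec[OF elim abcd(1)] abcd(2)] abcd(3)] abcd(4)] abcd(5,6,9)
        unfolding greaterThanLessThan_iff by blast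
      have "AE t in lborel. t \<in> {c<..<d} \<longrightarrow> u t = k"
        using k by eventually_elim (auto simp: u_def)
      moreover have "{x} \<times> {c<..<d} \<subseteq> Q" using abcd by auto
      ultimately show ?thesis using abcd unfolding P_def by blast
    qed
    have uniq: "k = k'" if "P c d k" "P c' d' k'" "t \<in> {c<..<d}" "t \<in> {c'<..<d'}" for c d k c' d' k' t
    proof -
      have "AE t in lborel. t \<in> {max c c'<..<min d d'} \<longrightarrow> k = k'"
      proof -
        have "AE t in lborel. t \<in> {c<..<d} \<longrightarrow> u t = k" "AE t in lborel. t \<in> {c'<..<d'} \<longrightarrow> u t = k'"
          using that(1,2) by (auto simp only: P_def)
        then show ?thesis by eventually_elim auto
      qed
      then show ?thesis
        by (rule AE_Ioo_witness) (use that in auto)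
    qed
    \<comment> \<open>The choice does not depend on the window, by \<open>uniq\<close>: two open
      windows containing \<open>t\<close> overlap in an interval of positive length.\<close>
    define K where "K t = (SOME k. \<exists>c d. t \<in> {c<..<d} \<and> P c d k)" for t
    have K: "K t = k" if "P c d k" "t \<in> {c<..<d}" for c d k t
    proof -
      have "\<exists>c d. t \<in> {c<..<d} \<and> P c d (K t)"
        unfolding K_def by (rule someI_ex) (use that in blast)
      then show ?thesis using uniq that by blast
    qed
    show ?case
    proof (intro exI[of _ K] conjI allI impI)
      fix s t assume "s \<le> t" "{x} \<times> {s..t} \<subseteq> Q"
      then obtain c d k where "c < s" "t < d" "P c d k" using seg by blast
      then show "K s = K t" using K[of c d k s] K[of c d k t] \<open>s \<le> t\<close> by simp
    next
      have "AE t in lborel. \<forall>c\<in>\<rat>. \<forall>d\<in>\<rat>. (\<exists>k. P c d k) \<longrightarrow> t \<in> {c<..<d} \<longrightarrow> u t = K t"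
      proof (intro AE_ball_countable[THEN iffD2] ballI countable_rat)
        fix c d :: real
        show "AE t in lborel. (\<exists>k. P c d k) \<longrightarrow> t \<in> {c<..<d} \<longrightarrow> u t = K t"
        proof (cases "\<exists>k. P c d k")
          case True
          then obtain k where k: "P c d k" by blast
          then have "AE t in lborel. t \<in> {c<..<d} \<longrightarrow> u t = k" by (simp add: P_def)
          then show ?thesis by eventually_elim (use K[OF k] in auto)
        qed simp
      qed
      then show "AE t in lborel. (x, t) \<in> Q \<longrightarrow> w (x, t) = (LBINT s:{..t}. g (x, s)) + K t"
      proof eventually_elim
        case (elim t)
        show ?case
        proof
          assume "(x, t) \<in> Q"
          then obtain c d k where "c \<in> \<rat>" "d \<in> \<rat>" "c < t" "t < d" "P c d k" using seg[of t t] by auto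
          then have "u t = K t" using elim by auto
          then show "w (x, t) = (LBINT s:{..t}. g (x, s)) + K t" by (simp add: u_def)
        qed
      qed
    qed
  qed
qed

section \<open>The right phase\<close>

lemma abscont_add_const:
  assumes "abscont a b f f'"
  shows "abscont a b (\<lambda>x. f x + c) f'"
  using assms unfolding abscont_def by simp

lemma abscont_zero: "abscont a b (\<lambda>x. 0) (\<lambda>x. 0)"
  unfolding abscont_def by (auto simp: set_integrable_def)

lemma isCont_primitive:
  fixes g :: "real \<Rightarrow> real"
  assumes "integrable lborel g"
  shows "isCont (\<lambda>t. LBINT s:{..t}. g s) t"
  by (rule continuous_on_interior[OF abscont_continuous_on[OF abscont_primitive[OF assms, of "t - 1" "t + 1"]]]) simp

text \<open>Continued by zero outside \<open>S\<close>, the product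
  \<open>H (V t) * \<psi> t\<close> is absolutely continuous on compact subintervals of
  \<open>(0, T)\<close>: around points of \<open>S\<close> by the chain and product rules, around
  the others because \<open>far\<close> makes the weight vanish nearby. So the components of
  \<open>S\<close>, however many, leave no boundary terms, and only the one-sided limits at 0 and
  \<open>T\<close> survive.\<close>

lemma slice_integration:
  fixes S :: "real set" and g f K \<psi> \<psi>' H H' :: "real \<Rightarrow> real" and T A B :: real
  defines "V \<equiv> \<lambda>t. (LBINT s:{..t}. g s) + K t"
  defines "q \<equiv> \<lambda>t. indicator S t * (H' (f t) * g t * \<psi> t + H (f t) * \<psi>' t)"
  assumes "0 < T" and S: "open S" "S \<subseteq> {0<..<T}"
    and g: "integrable lborel g"
    and K: "\<And>s t. s \<le> t \<Longrightarrow> {s..t} \<subseteq> S \<Longrightarrow> K s = K t"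
    and f: "AE t in lborel. t \<in> S \<longrightarrow> f t = V t"
    and H: "\<And>y. (H has_real_derivative H' y) (at y)" and cH': "continuous_on UNIV H'"
    and \<psi>: "abscont 0 T \<psi> \<psi>'"
    and far: "\<And>\<tau>. \<tau> \<in> {0<..<T} \<Longrightarrow> \<tau> \<notin> S \<Longrightarrow> eventually (\<lambda>t. \<psi> t = 0 \<and> \<psi>' t = 0) (nhds \<tau>)"
    and A: "((\<lambda>t. if t \<in> S then H (V t) * \<psi> t else 0) \<longlongrightarrow> A) (at_right 0)"
    and B: "((\<lambda>t. if t \<in> S then H (V t) * \<psi> t else 0) \<longlongrightarrow> B) (at_left T)"
    and q: "integrable lborel q"
  shows "(LBINT t. q t) = B - A"
proof -
  define p where "p = (\<lambda>t. if t \<in> S then H (V t) * \<psi> t else 0)"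
  have qm: "set_borel_measurable lborel {s<..t} q" for s t
    using q unfolding set_borel_measurable_def by (intro borel_measurable_scaleR) auto
  have ac: "abscont s t p q" if st: "0 < s" "s \<le> t" "t < T" for s t
  proof (rule abscont_local[OF \<open>s \<le> t\<close>])
    fix x assume x: "s \<le> x" "x \<le> t"
    show "\<exists>d>0. \<forall>s' t'. s \<le> s' \<longrightarrow> s' \<le> x \<longrightarrow> x \<le> t' \<longrightarrow> t' \<le> t \<longrightarrow> t' - s' < d \<longrightarrow> abscont s' t' p q"
    proof (cases "x \<in> S")
      case True
      then obtain d where d: "d > 0" "ball x d \<subseteq> S" using S(1) open_contains_ball by blast
      show ?thesis
      proof (intro exI[of _ d] conjI allI impI)
        fix s' t' assume s't': "s \<le> s'" "s' \<le> x" "x \<le> t'" "t' \<le> t" "t' - s' < d"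
        have sub: "{s'..t'} \<subseteq> S"
        proof
          fix y assume "y \<in> {s'..t'}"
          then have "y \<in> ball x d" using s't' by (auto simp: dist_real_def)
          then show "y \<in> S" using d by auto
        qed
        have Kx: "K y = K x" if "y \<in> {s'..t'}" for y
        proof (cases "y \<le> x")
          case True
          have "{y..x} \<subseteq> S" using sub that s't' by auto
          then show ?thesis using K[OF True] by simp
        next
          case False
          have "{x..y} \<subseteq> S" using sub that s't' by auto
          then show ?thesis using K[of x y] False by simp
        qed
        have "s' \<le> t'" using s't' by simp
        have a1: "abscont s' t' (\<lambda>t. (LBINT s:{..t}. g s) + K x) g"
          by (intro abscont_add_const abscont_primitive g)
        have a2: "abscont s' t' \<psi> \<psi>'"
          by (rule abscont_subinterval[OF \<psi>]) (use s't' st in auto)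
        have a3: "abscont s' t' (\<lambda>t. H ((LBINT s:{..t}. g s) + K x) * \<psi> t)
          (\<lambda>t. H' ((LBINT s:{..t}. g s) + K x) * g t * \<psi> t + H ((LBINT s:{..t}. g s) + K x) * \<psi>' t)"
          by (rule abscont_mult[OF \<open>s' \<le> t'\<close> abscont_compose[OF \<open>s' \<le> t'\<close> a1 H cH'] a2])
        have a4: "abscont s' t' p
          (\<lambda>t. H' ((LBINT s:{..t}. g s) + K x) * g t * \<psi> t + H ((LBINT s:{..t}. g s) + K x) * \<psi>' t)"
          by (rule abscont_cong[OF a3]) (use sub Kx in \<open>auto simp: p_def V_def\<close>)
        show "abscont s' t' p q"
        proof (rule abscont_cong_AE[OF a4 _ qm])
          show "AE t in lborel. t \<in> {s'<..t'} \<longrightarrow> H' ((LBINT s:{..t}. g s) + K x) * g t * \<psi> t +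
              H ((LBINT s:{..t}. g s) + K x) * \<psi>' t = q t"
            using f
          proof eventually_elim
            case (elim y)
            show ?case
            proof
              assume y: "y \<in> {s'<..t'}"
              then have "y \<in> {s'..t'}" by auto
              then have "y \<in> S" "K y = K x" using sub Kx by auto
              then show "H' ((LBINT s:{..y}. g s) + K x) * g y * \<psi> y +
                H ((LBINT s:{..y}. g s) + K x) * \<psi>' y = q y"
                using elim by (simp add: q_def V_def)
            qed
          qed
        qed
      qed (rule d)
    next
      case False
      then obtain d where d: "d > 0" "\<And>y. dist y x < d \<Longrightarrow> \<psi> y = 0 \<and> \<psi>' y = 0"
        using far[of x] x st unfolding eventually_nhds_metric by auto
      show ?thesis
      proof (intro exI[of _ d] conjI allI impI)
        fix s' t' assume s't': "s \<le> s'" "s' \<le> x" "x \<le> t'" "t' \<le> t" "t' - s' < d"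
        have "\<psi> y = 0 \<and> \<psi>' y = 0" if "y \<in> {s'..t'}" for y
          using d(2)[of y] that s't' by (auto simp: dist_real_def)
        then show "abscont s' t' p q"
          by (intro abscont_cong[OF abscont_zero]) (auto simp: p_def q_def)
      qed (rule d)
    qed
  qed
  \<comment> \<open>The shift by 3 ensures \<open>s n \<le> t n\<close> already for
    \<open>n = 0\<close>.\<close>
  define s where "s n = T / (real n + 3)" for n
  define t where "t n = T - T / (real n + 3)" for n
  have st: "0 < s n" "s n \<le> t n" "t n < T" for n
    using \<open>0 < T\<close> by (auto simp: s_def t_def field_simps)
  have s_lim: "s \<longlonglongrightarrow> 0" and t_lim: "t \<longlonglongrightarrow> T"
    unfolding s_def t_def using \<open>0 < T\<close> by real_asymp+
  have "filterlim s (at_right 0) sequentially"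
    unfolding filterlim_at using s_lim st(1) by (auto intro: always_eventually simp: less_imp_neq[symmetric])
  from filterlim_compose[OF A this] have lim_s: "(\<lambda>n. p (s n)) \<longlonglongrightarrow> A" by (simp add: p_def)
  have "filterlim t (at_left T) sequentially"
    unfolding filterlim_at using t_lim st(3) by (auto intro: always_eventually simp: less_imp_neq)
  from filterlim_compose[OF B this] have lim_t: "(\<lambda>n. p (t n)) \<longlonglongrightarrow> B" by (simp add: p_def)
  have "(\<lambda>n. LBINT x:{s n<..t n}. q x) \<longlonglongrightarrow> (LBINT x. q x)"
    unfolding set_lebesgue_integral_def
  proof (rule integral_dominated_convergence[where w = "\<lambda>x. \<bar>q x\<bar>"])
    show "AE x in lborel. (\<lambda>n. indicat_real {s n<..t n} x *\<^sub>R q x) \<longlonglongrightarrow> q x"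
    proof (rule AE_I2)
      fix x
      show "(\<lambda>n. indicat_real {s n<..t n} x *\<^sub>R q x) \<longlonglongrightarrow> q x"
      proof (cases "x \<in> {0<..<T}")
        case True
        then have "eventually (\<lambda>n. s n < x) sequentially" "eventually (\<lambda>n. x < t n) sequentially"
          using order_tendstoD[OF s_lim] order_tendstoD[OF t_lim] by auto
        then have "eventually (\<lambda>n. indicat_real {s n<..t n} x *\<^sub>R q x = q x) sequentially"
          by eventually_elim auto
        then show ?thesis by (rule tendsto_eventually)
      next
        case False
        then have "x \<notin> S" using S by auto
        then show ?thesis by (simp add: q_def)
      qed
    qed
  qed (use q in \<open>auto simp: indicator_def\<close>)
  moreover have "(LBINT x:{s n<..t n}. q x) = p (t n) - p (s n)" for n
    using abscontD(2)[OF ac[OF st[of n]], of "s n" "t n"] st[of n] by simp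
  ultimately have "(\<lambda>n. p (t n) - p (s n)) \<longlonglongrightarrow> (LBINT x. q x)" by simp
  moreover have "(\<lambda>n. p (t n) - p (s n)) \<longlonglongrightarrow> B - A" by (intro tendsto_diff lim_s lim_t)
  ultimately show ?thesis by (rule LIMSEQ_unique)
qed

text \<open>An essential limit speaks about some representative off a null set. By
  \<open>near\<close> there are intervals of positive length inside \<open>S\<close> arbitrarily
  close to \<open>p\<close>, and each contains a point where that representative agrees with
  \<open>W\<close>, which ties the two limits together.\<close>

lemma ess_tendsto_unique:
  assumes tr: "ess_tendsto S f p c"
    and f: "AE s in lborel. s \<in> S \<longrightarrow> f s = W s" and W: "(W \<longlongrightarrow> w) (at p within S)"
    and near: "\<And>e. e > 0 \<Longrightarrow> \<exists>a b. a < b \<and> {a<..<b} \<subseteq> S \<and> {a<..<b} \<subseteq> {p - e<..<p + e} - {p}"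
  shows "c = w"
proof (rule ccontr)
  assume "c \<noteq> w"
  define \<epsilon> where "\<epsilon> = \<bar>c - w\<bar> / 2"
  have \<epsilon>: "\<epsilon> > 0" using \<open>c \<noteq> w\<close> by (simp add: \<epsilon>_def)
  obtain F where F: "AE s\<in>S in lborel. F s = f s" "(F \<longlongrightarrow> c) (at p within S)"
    using tr unfolding ess_tendsto_def AE_completion_iff by (elim exE conjE)
  have "eventually (\<lambda>s. dist (F s) c < \<epsilon> \<and> dist (W s) w < \<epsilon>) (at p within S)"
    using tendstoD[OF F(2) \<epsilon>] tendstoD[OF W \<epsilon>] by (rule eventually_conj)
  then obtain e where e: "e > 0" "\<And>s. s \<in> S \<Longrightarrow> s \<noteq> p \<Longrightarrow> dist s p < e \<Longrightarrow> dist (F s) c < \<epsilon> \<and> dist (W s) w < \<epsilon>"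
    unfolding eventually_at by auto
  obtain a b where ab: "a < b" "{a<..<b} \<subseteq> S" "{a<..<b} \<subseteq> {p - e<..<p + e} - {p}"
    using near[OF e(1)] by blast
  have "AE s in lborel. s \<in> {a<..<b} \<longrightarrow> F s = W s"
    using F(1) f by eventually_elim (use ab in auto)
  then obtain s where s: "s \<in> {a<..<b}" "F s = W s" by (rule AE_Ioo_witness[OF _ ab(1)])
  have "dist (F s) c < \<epsilon> \<and> dist (W s) w < \<epsilon>"
  proof (rule e(2))
    show "s \<in> S" using ab(2) s(1) by blast
    have "s \<in> {p - e<..<p + e} - {p}" using ab(3) s(1) by blast
    then show "s \<noteq> p" "dist s p < e" by (auto simp: dist_real_def)
  qed
  then have "\<bar>F s - c\<bar> + \<bar>F s - w\<bar> < \<bar>c - w\<bar>" using s(2) unfolding \<epsilon>_def dist_real_def by simp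
  then show False by linarith
qed

text \<open>Exchanging the coordinates, which preserves the plane measure, reduces this to the
  statement for time slices.\<close>

lemma weak_deriv_slices_x:
  fixes w g :: "real \<times> real \<Rightarrow> real"
  assumes Q: "open Q" and w: "integrable lborel w" and g: "integrable lborel g"
    and weak: "\<And>a b c d \<alpha> \<beta>. {a<..<b} \<times> {c<..<d} \<subseteq> Q \<Longrightarrow>
      test_function {a<..<b} \<alpha> \<Longrightarrow> test_function {c<..<d} \<beta> \<Longrightarrow>
      (LBINT z. w z * (deriv \<alpha> (fst z) * \<beta> (snd z))) = - (LBINT z. g z * (\<alpha> (fst z) * \<beta> (snd z)))"
  shows "AE t in lborel. \<exists>K. (\<forall>r s. r \<le> s \<longrightarrow> {r..s} \<times> {t} \<subseteq> Q \<longrightarrow> K r = K s) \<and>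
    (AE x in lborel. (x, t) \<in> Q \<longrightarrow> w (x, t) = (LBINT s:{..x}. g (s, t)) + K x)"
proof -
  have swap: "(LBINT z. h (snd z, fst z)) = (LBINT z. h z)"
    if "h \<in> borel_measurable borel" for h :: "real \<times> real \<Rightarrow> real"
    using lborel_pair.integral_product_swap[unfolded lborel_prod, of h] that by (simp add: split_beta')
  have swapi: "integrable lborel (\<lambda>z. h (snd z, fst z))" if "integrable lborel h" for h :: "real \<times> real \<Rightarrow> real"
    using lborel_pair.integrable_product_swap[unfolded lborel_prod, of h] that by (simp add: split_beta')
  let ?sw = "\<lambda>z::real \<times> real. (snd z, fst z)"
  have "open (?sw -` Q)" by (intro open_vimage Q continuous_intros)
  have weak': "(LBINT z. w (snd z, fst z) * (\<alpha> (fst z) * deriv \<beta> (snd z)))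
        = - (LBINT z. g (snd z, fst z) * (\<alpha> (fst z) * \<beta> (snd z)))"
    if sub: "{a<..<b} \<times> {c<..<d} \<subseteq> ?sw -` Q" and \<alpha>: "test_function {a<..<b} \<alpha>" and \<beta>: "test_function {c<..<d} \<beta>"
    for a b c d :: real and \<alpha> \<beta> :: "real \<Rightarrow> real"
  proof -
    have sub': "{c<..<d} \<times> {a<..<b} \<subseteq> Q" using sub by auto
    have m: "(\<lambda>z::real \<times> real. f (fst z) * h (snd z)) \<in> borel_measurable borel"
      if "continuous_on UNIV f" "continuous_on UNIV h" for f h :: "real \<Rightarrow> real"
      using that by (intro borel_measurable_tensor borel_measurable_continuous_onI)
    have "(LBINT z. w (snd z, fst z) * (\<alpha> (fst z) * deriv \<beta> (snd z)))
        = (LBINT z. w z * (deriv \<beta> (fst z) * \<alpha> (snd z)))"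
      using swap[of "\<lambda>z. w z * (deriv \<beta> (fst z) * \<alpha> (snd z))"] w
        m[OF test_function_integrable(2)[OF test_function_deriv[OF \<beta>]] test_function_integrable(2)[OF \<alpha>]]
      by (simp add: mult.commute)
    also have "\<dots> = - (LBINT z. g z * (\<beta> (fst z) * \<alpha> (snd z)))"
      by (rule weak[OF sub' \<beta> \<alpha>])
    also have "(LBINT z. g z * (\<beta> (fst z) * \<alpha> (snd z))) = (LBINT z. g (snd z, fst z) * (\<alpha> (fst z) * \<beta> (snd z)))"
      using swap[of "\<lambda>z. g z * (\<beta> (fst z) * \<alpha> (snd z))"] g
        m[OF test_function_integrable(2)[OF \<beta>] test_function_integrable(2)[OF \<alpha>]]
      by (simp add: mult.commute)
    finally show ?thesis .
  qed
  have "open (?sw -` Q)" by (intro open_vimage Q continuous_intros)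
  from weak_deriv_slices[OF this swapi[OF w] swapi[OF g], OF weak']
  have "AE t in lborel. \<exists>K. (\<forall>r s. r \<le> s \<longrightarrow> {t} \<times> {r..s} \<subseteq> ?sw -` Q \<longrightarrow> K r = K s) \<and>
    (AE x in lborel. (t, x) \<in> ?sw -` Q \<longrightarrow> w (snd (t, x), fst (t, x)) = (LBINT s:{..x}. g (snd (t, s), fst (t, s))) + K x)"
    by simp
  then show ?thesis
  proof eventually_elim
    case (elim t)
    then obtain K where K: "\<And>r s. r \<le> s \<Longrightarrow> {t} \<times> {r..s} \<subseteq> ?sw -` Q \<Longrightarrow> K r = K s"
      "AE x in lborel. (x, t) \<in> Q \<longrightarrow> w (x, t) = (LBINT s:{..x}. g (s, t)) + K x"
      by auto
    show ?case
    proof (intro exI[of _ K] conjI allI impI)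
      show "K r = K s" if "r \<le> s" "{r..s} \<times> {t} \<subseteq> Q" for r s
        using that by (intro K(1)) auto
    qed (rule K(2))
  qed
qed

text \<open>Stated in the form that the rectangle lemma consumes: product test functions, whose
  support lies in a rectangle inside \<open>Q\<close>, and integrals over the whole plane with
  respect to \<open>lborel\<close>, to which Fubini applies directly.\<close>

definition weak_deriv_t :: "(real \<times> real) set \<Rightarrow> (real \<times> real \<Rightarrow> real) \<Rightarrow> (real \<times> real \<Rightarrow> real) \<Rightarrow> bool" where
  "weak_deriv_t Q w g \<longleftrightarrow> (\<forall>a b c d \<alpha> \<beta>. {a<..<b} \<times> {c<..<d} \<subseteq> Q \<longrightarrow>
      test_function {a<..<b} \<alpha> \<longrightarrow> test_function {c<..<d} \<beta> \<longrightarrow>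
      (LBINT z. w z * (\<alpha> (fst z) * deriv \<beta> (snd z))) = - (LBINT z. g z * (\<alpha> (fst z) * \<beta> (snd z))))"

definition weak_deriv_x :: "(real \<times> real) set \<Rightarrow> (real \<times> real \<Rightarrow> real) \<Rightarrow> (real \<times> real \<Rightarrow> real) \<Rightarrow> bool" where
  "weak_deriv_x Q w g \<longleftrightarrow> (\<forall>a b c d \<alpha> \<beta>. {a<..<b} \<times> {c<..<d} \<subseteq> Q \<longrightarrow>
      test_function {a<..<b} \<alpha> \<longrightarrow> test_function {c<..<d} \<beta> \<longrightarrow>
      (LBINT z. w z * (deriv \<alpha> (fst z) * \<beta> (snd z))) = - (LBINT z. g z * (\<alpha> (fst z) * \<beta> (snd z))))"

text \<open>All data are Borel functions on the whole plane that vanish off \<open>Q\<close>, and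
  \<open>l\<close> is continuous on the whole line with values in \<open>(0, L)\<close>. Integrals
  then carry no domain, slices of the data are measurable, and continuity of \<open>l\<close> can be
  used on both sides of 0 and \<open>T\<close>. The given solution is replaced by such
  representatives at the end.\<close>

locale right_phase =
  fixes L T d :: real and l l' v0 :: "real \<Rightarrow> real" and v vx vt vxx :: "real \<times> real \<Rightarrow> real"
    and Q :: "(real \<times> real) set"
  defines "Q \<equiv> Q_right T L l"
  assumes T_pos: "0 < T" and d_pos: "0 < d"
    and l_cont: "continuous_on UNIV l" and l_pos: "\<And>t. 0 < l t" and l_less: "\<And>t. l t < L"
    and l_abscont: "abscont 0 T l l'" and l'_meas [measurable]: "l' \<in> borel_measurable borel"
    and l'_sq: "integrable lborel (\<lambda>t. (l' t)\<^sup>2)"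
    and meas [measurable]: "v \<in> borel_measurable borel" "vx \<in> borel_measurable borel"
      "vt \<in> borel_measurable borel" "vxx \<in> borel_measurable borel"
    and off: "\<And>z. z \<notin> Q \<Longrightarrow> v z = 0" "\<And>z. z \<notin> Q \<Longrightarrow> vx z = 0"
      "\<And>z. z \<notin> Q \<Longrightarrow> vt z = 0" "\<And>z. z \<notin> Q \<Longrightarrow> vxx z = 0"
    and sq: "integrable lborel (\<lambda>z. (v z)\<^sup>2)" "integrable lborel (\<lambda>z. (vx z)\<^sup>2)"
      "integrable lborel (\<lambda>z. (vt z)\<^sup>2)" "integrable lborel (\<lambda>z. (vxx z)\<^sup>2)"
    and weak: "weak_deriv_t Q v vt" "weak_deriv_x Q v vx" "weak_deriv_x Q vx vxx"
    and heat: "AE z in lborel. vt z = d * vxx z"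
    and trace_L: "AE t in lborel. t \<in> {0<..<T} \<longrightarrow> ess_tendsto {x. (x, t) \<in> Q} (\<lambda>x. v (x, t)) L 0"
    and trace_l: "AE t in lborel. t \<in> {0<..<T} \<longrightarrow> ess_tendsto {x. (x, t) \<in> Q} (\<lambda>x. v (x, t)) (l t) 0"
    and initial: "AE x in lborel. x \<in> {l 0<..<L} \<longrightarrow> ess_tendsto {t. (x, t) \<in> Q} (\<lambda>t. v (x, t)) 0 (v0 x)"
    and v0_nonpos: "AE x in lborel. x \<in> {l 0<..<L} \<longrightarrow> v0 x \<le> 0"
begin

lemma Q_iff: "(x, t) \<in> Q \<longleftrightarrow> 0 < t \<and> t < T \<and> l t < x \<and> x < L"
  by (simp add: Q_def Q_right_def)

lemma open_Q: "open Q"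
proof -
  have "Q = {z. 0 < snd z} \<inter> {z. snd z < T} \<inter> {z. l (snd z) < fst z} \<inter> {z. fst z < L}"
    using Q_iff by auto
  moreover have "continuous_on UNIV (\<lambda>z::real \<times> real. l (snd z))"
    by (intro continuous_on_compose2[OF l_cont] continuous_intros) auto
  ultimately show ?thesis
    by (auto intro!: open_Int open_Collect_less continuous_intros)
qed

lemma Q_borel [measurable]: "Q \<in> sets borel"
  using open_Q by simp

lemma Q_subset: "Q \<subseteq> {0..L} \<times> {0..T}"
proof
  fix z assume "z \<in> Q"
  then show "z \<in> {0..L} \<times> {0..T}" using Q_iff[of "fst z" "snd z"] l_pos[of "snd z"] by (auto simp: mem_Times_iff)
qed

lemma integrable_indicator_Q: "integrable lborel (\<lambda>z. indicator Q z :: real)"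
proof (rule integrable_real_indicator)
  have "emeasure lborel Q \<le> emeasure lborel ({0..L} \<times> {0..T})"
    by (intro emeasure_mono Q_subset) (auto intro: borel_Times)
  also have "{0..L} \<times> {0..T} = cbox (0, 0) (L, T)" by (simp add: cbox_Pair_eq)
  also have "emeasure lborel \<dots> < \<infinity>" by (rule emeasure_lborel_cbox_finite)
  finally show "emeasure lborel Q < \<infinity>" .
qed simp

lemma integrable_if_square_integrable:
  fixes f :: "real \<times> real \<Rightarrow> real"
  assumes [measurable]: "f \<in> borel_measurable borel" and "\<And>z. z \<notin> Q \<Longrightarrow> f z = 0" "integrable lborel (\<lambda>z. (f z)\<^sup>2)"
  shows "integrable lborel f"
proof (rule Bochner_Integration.integrable_bound[where f = "\<lambda>z. indicator Q z + (f z)\<^sup>2"])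
  show "integrable lborel (\<lambda>z. indicator Q z + (f z)\<^sup>2 :: real)"
    using integrable_indicator_Q assms(3) by simp
  have "\<bar>y\<bar> \<le> 1 + y\<^sup>2" for y :: real
  proof -
    have "0 \<le> (\<bar>y\<bar> - 1)\<^sup>2" "0 \<le> \<bar>y\<bar>" by auto
    then show ?thesis by (simp add: power2_eq_square algebra_simps)
  qed
  then show "AE z in lborel. norm (f z) \<le> norm (indicator Q z + (f z)\<^sup>2 :: real)"
    using assms(2) by (intro AE_I2) (auto simp: indicator_def)
qed simp

lemma ints: "integrable lborel v" "integrable lborel vx" "integrable lborel vt" "integrable lborel vxx"
  using integrable_if_square_integrable meas off sq by blast+

lemma t_slices:
  "AE x in lborel. integrable lborel (\<lambda>t. vt (x, t)) \<and>
    (\<exists>K. (\<forall>s t. s \<le> t \<longrightarrow> {x} \<times> {s..t} \<subseteq> Q \<longrightarrow> K s = K t) \<and>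
    (AE t in lborel. (x, t) \<in> Q \<longrightarrow> v (x, t) = (LBINT s:{..t}. vt (x, s)) + K t))"
proof -
  have "AE x in lborel. \<exists>K. (\<forall>s t. s \<le> t \<longrightarrow> {x} \<times> {s..t} \<subseteq> Q \<longrightarrow> K s = K t) \<and>
    (AE t in lborel. (x, t) \<in> Q \<longrightarrow> v (x, t) = (LBINT s:{..t}. vt (x, s)) + K t)"
    by (rule weak_deriv_slices[OF open_Q ints(1,3)]) (use weak(1) in \<open>auto simp: weak_deriv_t_def\<close>)
  then show ?thesis using lborel_pair_AE_integrable_x[OF ints(3)] by eventually_elim blast
qed

text \<open>At fixed \<open>t\<close> the slice is one interval, so the constant of integration is a
  single number. \<open>W\<close> is the primitive of \<open>vx\<close>, which is zero at the
  interface because \<open>vx\<close> vanishes to its left; the interface trace makes the constant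
  zero, and then the trace at \<open>L\<close> gives \<open>W L = 0\<close>. \<open>Z\<close> is the
  continuous representative of \<open>vx\<close> needed for integration by parts.\<close>

lemma x_slices:
  "AE t in lborel. t \<in> {0<..<T} \<longrightarrow> integrable lborel (\<lambda>x. v (x, t)) \<and> integrable lborel (\<lambda>x. vx (x, t)) \<and> integrable lborel (\<lambda>x. vxx (x, t)) \<and>
    (\<exists>W Z. W (l t) = 0 \<and> W L = 0 \<and> (AE x in lborel. x \<in> {l t<..<L} \<longrightarrow> v (x, t) = W x \<and> vx (x, t) = Z x) \<and>
      abscont (l t) L W Z \<and> abscont (l t) L Z (\<lambda>x. vxx (x, t)) \<and>
      (\<forall>x. W x = (LBINT s:{..x}. vx (s, t))))"
proof -
  have intt: "AE t in lborel. integrable lborel (\<lambda>x. f (x, t))" if "integrable lborel f" for f :: "real \<times> real \<Rightarrow> real"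
    using lborel_pair_AE_integrable_t[of "\<lambda>x t. f (x, t)"] that by simp
  have s1: "AE t in lborel. \<exists>K. (\<forall>r s. r \<le> s \<longrightarrow> {r..s} \<times> {t} \<subseteq> Q \<longrightarrow> K r = K s) \<and>
    (AE x in lborel. (x, t) \<in> Q \<longrightarrow> v (x, t) = (LBINT s:{..x}. vx (s, t)) + K x)"
    by (rule weak_deriv_slices_x[OF open_Q ints(1,2)]) (use weak(2) in \<open>auto simp: weak_deriv_x_def\<close>)
  have s2: "AE t in lborel. \<exists>K. (\<forall>r s. r \<le> s \<longrightarrow> {r..s} \<times> {t} \<subseteq> Q \<longrightarrow> K r = K s) \<and>
    (AE x in lborel. (x, t) \<in> Q \<longrightarrow> vx (x, t) = (LBINT s:{..x}. vxx (s, t)) + K x)"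
    by (rule weak_deriv_slices_x[OF open_Q ints(2,4)]) (use weak(3) in \<open>auto simp: weak_deriv_x_def\<close>)
  from s1 s2 intt[OF ints(1)] intt[OF ints(2)] intt[OF ints(4)] trace_L trace_l show ?thesis
  proof eventually_elim
    case (elim t)
    show ?case
    proof (intro impI conjI elim(3,4,5))
      assume t: "t \<in> {0<..<T}"
      define m where "m = (l t + L) / 2"
      have m: "l t < m" "m < L" using l_less[of t] by (auto simp: m_def)
      have slice: "{x. (x, t) \<in> Q} = {l t<..<L}" using t Q_iff by auto
      have const: "\<exists>k. AE x in lborel. x \<in> {l t<..<L} \<longrightarrow> w (x, t) = G x + k"
        if "\<exists>K. (\<forall>r s. r \<le> s \<longrightarrow> {r..s} \<times> {t} \<subseteq> Q \<longrightarrow> K r = K s) \<and>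
          (AE x in lborel. (x, t) \<in> Q \<longrightarrow> w (x, t) = G x + K x)" for w and G :: "real \<Rightarrow> real"
      proof -
        from that obtain K where K: "\<And>r s. r \<le> s \<Longrightarrow> {r..s} \<times> {t} \<subseteq> Q \<Longrightarrow> K r = K s"
          "AE x in lborel. (x, t) \<in> Q \<longrightarrow> w (x, t) = G x + K x" by blast
        have Km: "K x = K m" if "x \<in> {l t<..<L}" for x
        proof (cases "x \<le> m")
          case True
          then show ?thesis using that m t by (intro K(1)) (auto simp: Q_iff)
        next
          case False
          then show ?thesis using that m t by (intro K(1)[symmetric]) (auto simp: Q_iff)
        qed
        have "AE x in lborel. x \<in> {l t<..<L} \<longrightarrow> w (x, t) = G x + K m"
          using K(2)
        proof eventually_elim
          case (elim x)
          then show ?case using Km[of x] t by (auto simp: Q_iff)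
        qed
        then show ?thesis by blast
      qed
      define W where "W = (\<lambda>x. LBINT s:{..x}. vx (s, t))"
      obtain k where k: "AE x in lborel. x \<in> {l t<..<L} \<longrightarrow> v (x, t) = W x + k"
        using const[OF elim(1)] unfolding W_def by blast
      obtain k' where k': "AE x in lborel. x \<in> {l t<..<L} \<longrightarrow> vx (x, t) = (LBINT s:{..x}. vxx (s, t)) + k'"
        using const[OF elim(2)] by blast
      define Z where "Z = (\<lambda>x. (LBINT s:{..x}. vxx (s, t)) + k')"
      have Wlim: "((\<lambda>x. W x + k) \<longlongrightarrow> W p + k) (at p within S)" for p S
      proof -
        have "isCont W p" unfolding W_def by (rule isCont_primitive[OF elim(4)])
        then have "(W \<longlongrightarrow> W p) (at p within S)"
          unfolding isCont_def by (rule tendsto_within_subset) simp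
        then show ?thesis by (intro tendsto_intros)
      qed
      have Wl: "W (l t) = 0"
      proof -
        have "indicat_real {..l t} s *\<^sub>R vx (s, t) = 0" for s
          using off(2)[of "(s, t)"] by (auto simp: Q_iff indicator_def)
        then show ?thesis by (simp only: W_def set_lebesgue_integral_def Bochner_Integration.integral_zero)
      qed
      have "0 = W (l t) + k"
      proof (rule ess_tendsto_unique[OF _ k[folded slice] Wlim])
        show "ess_tendsto {x. (x, t) \<in> Q} (\<lambda>x. v (x, t)) (l t) 0" using elim(7) t by blast
        fix e :: real assume "e > 0"
        then show "\<exists>a b. a < b \<and> {a<..<b} \<subseteq> {x. (x, t) \<in> Q} \<and> {a<..<b} \<subseteq> {l t - e<..<l t + e} - {l t}"
          unfolding slice by (intro exI[of _ "l t"] exI[of _ "min m (l t + e)"]) (use m in auto)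
      qed
      with Wl have k0: "k = 0" by simp
      have "0 = W L + k"
      proof (rule ess_tendsto_unique[OF _ k[folded slice] Wlim])
        show "ess_tendsto {x. (x, t) \<in> Q} (\<lambda>x. v (x, t)) L 0" using elim(6) t by blast
        fix e :: real assume "e > 0"
        then show "\<exists>a b. a < b \<and> {a<..<b} \<subseteq> {x. (x, t) \<in> Q} \<and> {a<..<b} \<subseteq> {L - e<..<L + e} - {L}"
          unfolding slice by (intro exI[of _ "max m (L - e)"] exI[of _ L]) (use m in auto)
      qed
      with k0 have WL: "W L = 0" by simp
      have ae: "AE x in lborel. x \<in> {l t<..<L} \<longrightarrow> v (x, t) = W x \<and> vx (x, t) = Z x"
        using k k' by eventually_elim (auto simp: k0 Z_def)
      have acZ: "abscont (l t) L Z (\<lambda>x. vxx (x, t))"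
        unfolding Z_def by (intro abscont_add_const abscont_primitive elim(5))
      have acW: "abscont (l t) L W Z"
      proof (rule abscont_cong_AE)
        show "abscont (l t) L W (\<lambda>x. vx (x, t))" unfolding W_def by (rule abscont_primitive[OF elim(4)])
        have "AE x in lborel. x \<noteq> L" by (rule AE_lborel_singleton)
        then show "AE x in lborel. x \<in> {l t<..L} \<longrightarrow> vx (x, t) = Z x"
          using ae by eventually_elim auto
        have "continuous_on {l t<..L} Z"
          by (rule continuous_on_subset[OF abscont_continuous_on[OF acZ]]) auto
        then show "set_borel_measurable lborel {l t<..L} Z"
          using borel_measurable_continuous_on_indicator[of "{l t<..L}" Z] by (simp add: set_borel_measurable_def)
      qed
      show "\<exists>W Z. W (l t) = 0 \<and> W L = 0 \<and> (AE x in lborel. x \<in> {l t<..<L} \<longrightarrow> v (x, t) = W x \<and> vx (x, t) = Z x) \<and>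
        abscont (l t) L W Z \<and> abscont (l t) L Z (\<lambda>x. vxx (x, t)) \<and>
        (\<forall>x. W x = (LBINT s:{..x}. vx (s, t)))"
        by (intro exI[of _ W] exI[of _ Z] conjI Wl WL ae acW acZ) (simp add: W_def)
    qed
  qed
qed

end

section \<open>Cut-off energy\<close>

text \<open>On the left the composition is the constant \<open>q 0\<close>; the condition
  \<open>q' 0 = 0\<close> makes the two pieces meet tangentially.\<close>

lemma has_derivative_compose_max0:
  assumes q: "\<And>y. (q has_real_derivative q' y) (at y)" and "q' 0 = 0"
  shows "((\<lambda>s. q (max 0 s)) has_real_derivative q' (max 0 s)) (at s)"
proof -
  consider "s > 0" | "s < 0" | "s = 0" by linarith
  then show ?thesis
  proof cases
    case 1
    then have "(q has_real_derivative q' (max 0 s)) (at s)" using q[of s] by simp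
    then show ?thesis
      by (rule has_field_derivative_transform_within_open[where S = "{0<..}"]) (use 1 in auto)
  next
    case 2
    then have "((\<lambda>_. q 0) has_real_derivative q' (max 0 s)) (at s)" using assms(2) by simp
    then show ?thesis
      by (rule has_field_derivative_transform_within_open[where S = "{..<0}"]) (use 2 in auto)
  next
    case 3
    have "((\<lambda>y. (q y - q 0) / (y - 0)) \<longlongrightarrow> 0) (at 0)"
      using q[of 0] assms(2) by (simp add: has_field_derivative_iff)
    then have "((\<lambda>y. (q y - q 0) / (y - 0)) \<longlongrightarrow> 0) (at_right 0)"
      by (rule tendsto_within_subset) simp
    then have "((\<lambda>y. (q (max 0 y) - q (max 0 0)) / (y - 0)) \<longlongrightarrow> 0) (at_right 0)"
      by (rule Lim_transform_eventually) (auto simp: eventually_at_filter)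
    moreover have "((\<lambda>y. (q (max 0 y) - q (max 0 0)) / (y - 0)) \<longlongrightarrow> 0) (at_left 0)"
      by (rule Lim_transform_eventually[OF tendsto_const]) (auto simp: eventually_at_filter)
    ultimately have "((\<lambda>y. (q (max 0 y) - q (max 0 0)) / (y - 0)) \<longlongrightarrow> 0) (at 0)"
      by (simp add: filterlim_split_at)
    then show ?thesis using 3 assms(2) by (simp add: has_field_derivative_iff)
  qed
qed

lemma at_within_Ioo_at_right: "(a::real) < b \<Longrightarrow> at a within {a<..<b} = at_right a"
  by (rule at_within_nhd[where S = "{..<b}"]) auto

lemma at_within_Ioo_at_left: "(a::real) < b \<Longrightarrow> at b within {a<..<b} = at_left b"
  by (rule at_within_nhd[where S = "{a<..}"]) auto

text \<open>The linear growth of \<open>pos_energy\<close> matters: \<open>l' v\<close> is integrable, but \<open>l' v\<^sup>2\<close> need not be.\<close>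

definition pos_energy :: "real \<Rightarrow> real" where
  "pos_energy s = max 0 s - arctan (max 0 s)"

definition pos_energy' :: "real \<Rightarrow> real" where
  "pos_energy' s = (max 0 s)\<^sup>2 / (1 + (max 0 s)\<^sup>2)"

definition pos_energy'' :: "real \<Rightarrow> real" where
  "pos_energy'' s = 2 * max 0 s / (1 + (max 0 s)\<^sup>2)\<^sup>2"

lemma one_plus_square_pos: "0 < 1 + (y::real)\<^sup>2"
  by (simp add: add_pos_nonneg)

lemma pos_energy_deriv: "(pos_energy has_real_derivative pos_energy' s) (at s)"
proof -
  have "((\<lambda>y. y - arctan y) has_real_derivative y\<^sup>2 / (1 + y\<^sup>2)) (at y)" for y :: real
    using one_plus_square_pos[of y]
    by (auto intro!: derivative_eq_intros simp: field_simps)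
  from has_derivative_compose_max0[OF this, of s] show ?thesis
    unfolding pos_energy_def pos_energy'_def by simp
qed

lemma pos_energy'_deriv: "(pos_energy' has_real_derivative pos_energy'' s) (at s)"
proof -
  have "((\<lambda>y. y\<^sup>2 / (1 + y\<^sup>2)) has_real_derivative 2 * y / (1 + y\<^sup>2)\<^sup>2) (at y)" for y :: real
  proof -
    have "1 + y\<^sup>2 \<noteq> 0" using one_plus_square_pos[of y] by simp
    then have "((\<lambda>y. y\<^sup>2 / (1 + y\<^sup>2)) has_real_derivative (2 * y * (1 + y\<^sup>2) - y\<^sup>2 * (2 * y)) / ((1 + y\<^sup>2) * (1 + y\<^sup>2))) (at y)"
      by (auto intro!: derivative_eq_intros)
    also have "(2 * y * (1 + y\<^sup>2) - y\<^sup>2 * (2 * y)) / ((1 + y\<^sup>2) * (1 + y\<^sup>2)) = 2 * y / (1 + y\<^sup>2)\<^sup>2"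
      by (simp add: algebra_simps power2_eq_square)
    finally show ?thesis .
  qed
  from has_derivative_compose_max0[OF this, of s] show ?thesis
    unfolding pos_energy'_def pos_energy''_def by simp
qed

lemma continuous_pos_energy: "continuous_on UNIV pos_energy" "continuous_on UNIV pos_energy'" "continuous_on UNIV pos_energy''"
proof -
  show "continuous_on UNIV pos_energy" "continuous_on UNIV pos_energy'"
    using pos_energy_deriv pos_energy'_deriv by (metis DERIV_isCont continuous_at_imp_continuous_on)+
  have "1 + (max 0 s)\<^sup>2 \<noteq> 0" for s :: real using one_plus_square_pos[of "max 0 s"] by simp
  then show "continuous_on UNIV pos_energy''"
    unfolding pos_energy''_def by (intro continuous_intros) auto
qed

lemma pos_energy_bounds:
  "0 \<le> pos_energy s" "pos_energy s \<le> \<bar>s\<bar>" "0 \<le> pos_energy' s" "pos_energy' s \<le> 1" "0 \<le> pos_energy'' s"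
  "pos_energy' 0 = 0" "s \<le> 0 \<Longrightarrow> pos_energy s = 0"
proof -
  have arc: "arctan y \<le> y" if "0 \<le> y" for y
    using arctan_le_self[OF that] .
  show "0 \<le> pos_energy s" using arc[of "max 0 s"] by (simp add: pos_energy_def)
  have "0 \<le> arctan (max 0 s)" by simp
  then show "pos_energy s \<le> \<bar>s\<bar>" unfolding pos_energy_def by linarith
  show "0 \<le> pos_energy' s" "pos_energy' s \<le> 1" "0 \<le> pos_energy'' s"
    using one_plus_square_pos[of "max 0 s"] by (auto simp: pos_energy'_def pos_energy''_def divide_simps)
  show "pos_energy' 0 = 0" by (simp add: pos_energy'_def)
  show "s \<le> 0 \<Longrightarrow> pos_energy s = 0" by (simp add: pos_energy_def max_absorb1)
qed

text \<open>The derivative is positive on the positive axis, so the mean value theorem excludes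
  zeros there. This is how vanishing energy is turned back into the sign of
  \<open>v\<close>.\<close>

lemma pos_energy_eq_0: "pos_energy s = 0 \<Longrightarrow> s \<le> 0"
proof (rule ccontr)
  assume "pos_energy s = 0" "\<not> s \<le> 0"
  then have "s > 0" "pos_energy s = s - arctan s" by (auto simp: pos_energy_def)
  moreover have "arctan s < s"
  proof -
    have "\<exists>z. 0 < z \<and> z < s \<and> pos_energy s - pos_energy 0 = (s - 0) * pos_energy' z"
      by (rule MVT2) (use \<open>s > 0\<close> pos_energy_deriv in auto)
    then obtain z where z: "0 < z" "pos_energy s = s * pos_energy' z" by (auto simp: pos_energy_def)
    have "pos_energy' z > 0" using z(1) one_plus_square_pos[of z] by (auto simp: pos_energy'_def)
    then have "0 < s * pos_energy' z" using \<open>s > 0\<close> by simp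
    then show ?thesis using z(2) \<open>pos_energy s = s - arctan s\<close> by linarith
  qed
  ultimately show False using \<open>pos_energy s = 0\<close> by simp
qed

text \<open>A \<open>C\<^sup>1\<close> step from 0 to 1 on \<open>[0, 1]\<close>, as a quadratic spline.\<close>

definition smooth_step :: "real \<Rightarrow> real" where
  "smooth_step z = 2 * (max 0 z)\<^sup>2 - 4 * (max 0 (z - 1/2))\<^sup>2 + 2 * (max 0 (z - 1))\<^sup>2"

definition smooth_step' :: "real \<Rightarrow> real" where
  "smooth_step' z = 4 * max 0 z - 8 * max 0 (z - 1/2) + 4 * max 0 (z - 1)"

lemma smooth_step_deriv: "(smooth_step has_real_derivative smooth_step' z) (at z)"
proof -
  have "((\<lambda>s. (max 0 s)\<^sup>2) has_real_derivative 2 * max 0 s) (at s)" for s :: real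
    by (rule has_derivative_compose_max0[where q = "\<lambda>y. y\<^sup>2" and q' = "\<lambda>y. 2 * y"]) (auto intro!: derivative_eq_intros)
  then have D: "((\<lambda>s. (max 0 (s - a))\<^sup>2) has_real_derivative 2 * max 0 (s - a)) (at s)" for s a :: real
  proof -
    have "((\<lambda>s. s - a) has_real_derivative 1) (at s)" by (auto intro!: derivative_eq_intros)
    from DERIV_chain'[OF this \<open>\<And>s. ((\<lambda>s. (max 0 s)\<^sup>2) has_real_derivative 2 * max 0 s) (at s)\<close>] show ?thesis by simp
  qed
  show ?thesis
    unfolding smooth_step_def smooth_step'_def
    using DERIV_add[OF DERIV_diff[OF DERIV_cmult[OF D[of 0 z], of 2] DERIV_cmult[OF D[of "1/2" z], of 4]]
        DERIV_cmult[OF D[of 1 z], of 2]] by simp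
qed

lemma smooth_step_bounds:
  "z \<le> 0 \<Longrightarrow> smooth_step z = 0" "z \<ge> 1 \<Longrightarrow> smooth_step z = 1" "0 \<le> smooth_step z" "smooth_step z \<le> 1"
  "z \<le> 0 \<Longrightarrow> smooth_step' z = 0" "z \<ge> 1 \<Longrightarrow> smooth_step' z = 0" "\<bar>smooth_step' z\<bar> \<le> 2"
proof -
  show 0: "z \<le> 0 \<Longrightarrow> smooth_step z = 0" for z by (simp add: smooth_step_def max_absorb1)
  show 1: "z \<ge> 1 \<Longrightarrow> smooth_step z = 1" for z
    by (simp add: smooth_step_def max_absorb2) (simp add: power2_eq_square algebra_simps)
  have mid: "smooth_step z = 2 * z\<^sup>2" if "0 \<le> z" "z \<le> 1/2"
    using that by (simp add: smooth_step_def max_absorb1 max_absorb2)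
  have mid': "smooth_step z = 1 - 2 * (1 - z)\<^sup>2" if "1/2 \<le> z" "z \<le> 1"
    using that by (simp add: smooth_step_def max_absorb1 max_absorb2) (simp add: power2_eq_square algebra_simps)
  have "0 \<le> smooth_step z \<and> smooth_step z \<le> 1"
  proof -
    consider "z \<le> 0" | "z \<ge> 1" | "0 \<le> z" "z \<le> 1/2" | "1/2 \<le> z" "z \<le> 1" by linarith
    then show ?thesis
    proof cases
      case 3
      have "z\<^sup>2 \<le> (1/2)\<^sup>2" by (rule power_mono) (use 3 in auto)
      then show ?thesis using mid[OF 3] by (auto simp: power2_eq_square)
    next
      case 4
      have "(1 - z)\<^sup>2 \<le> (1/2)\<^sup>2" by (rule power_mono) (use 4 in auto)
      then show ?thesis using mid'[OF 4] by (auto simp: power2_eq_square)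
    qed (use 0 1 in auto)
  qed
  then show "0 \<le> smooth_step z" "smooth_step z \<le> 1" by auto
  show "z \<le> 0 \<Longrightarrow> smooth_step' z = 0" "z \<ge> 1 \<Longrightarrow> smooth_step' z = 0" "\<bar>smooth_step' z\<bar> \<le> 2"
    by (auto simp: smooth_step'_def max_def)
qed

lemma continuous_smooth_step: "continuous_on UNIV smooth_step" "continuous_on UNIV smooth_step'"
  unfolding smooth_step_def smooth_step'_def by (intro continuous_intros)+

context right_phase begin

text \<open>\<open>l'\<close> depends on \<open>t\<close> alone and \<open>Q\<close> is bounded in
  \<open>x\<close>, so \<open>l'\<close> is square integrable over \<open>Q\<close>; the product is
  then bounded by the sum of the squares. Here the \<open>H\<^sup>1\<close> regularity of the
  interface enters.\<close>

lemma integrable_times_l':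
  fixes f :: "real \<times> real \<Rightarrow> real"
  assumes [measurable]: "f \<in> borel_measurable borel" and off: "\<And>z. z \<notin> Q \<Longrightarrow> f z = 0"
    and sq: "integrable lborel (\<lambda>z. (f z)\<^sup>2)"
  shows "integrable lborel (\<lambda>z. \<bar>f z\<bar> * \<bar>l' (snd z)\<bar>)"
proof (rule Bochner_Integration.integrable_bound[where f = "\<lambda>z. (f z)\<^sup>2 + indicat_real {0..L} (fst z) * (l' (snd z))\<^sup>2"])
  have "0 \<le> L" using l_pos[of 0] l_less[of 0] by linarith
  then have "integrable lborel (indicat_real {0..L})" by (intro integrable_real_indicator) auto
  then show "integrable lborel (\<lambda>z. (f z)\<^sup>2 + indicat_real {0..L} (fst z) * (l' (snd z))\<^sup>2)"
    using integrable_tensor[OF _ l'_sq] sq by simp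
  have l'2: "(\<lambda>z::real \<times> real. l' (snd z)) \<in> borel_measurable borel"
    using borel_measurable_tensor[of "\<lambda>_. 1" l'] by simp
  then show "(\<lambda>z. \<bar>f z\<bar> * \<bar>l' (snd z)\<bar>) \<in> borel_measurable lborel" by simp
  show "AE z in lborel. norm (\<bar>f z\<bar> * \<bar>l' (snd z)\<bar>) \<le> norm ((f z)\<^sup>2 + indicat_real {0..L} (fst z) * (l' (snd z))\<^sup>2)"
  proof (rule AE_I2)
    fix z
    show "norm (\<bar>f z\<bar> * \<bar>l' (snd z)\<bar>) \<le> norm ((f z)\<^sup>2 + indicat_real {0..L} (fst z) * (l' (snd z))\<^sup>2)"
    proof (cases "z \<in> Q")
      case True
      then have "fst z \<in> {0..L}" using Q_subset by auto
      moreover have "\<bar>y\<bar> * \<bar>w\<bar> \<le> y\<^sup>2 + w\<^sup>2" for y w :: real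
      proof -
        have "0 \<le> (\<bar>y\<bar> - \<bar>w\<bar>)\<^sup>2" "0 \<le> \<bar>y\<bar> * \<bar>w\<bar>" by auto
        then show ?thesis unfolding power2_diff power2_abs by linarith
      qed
      ultimately show ?thesis by simp
    qed (use off in simp)
  qed
qed

text \<open>Because \<open>x\<close> lies beyond the interface at the end time \<open>p\<close>,
  continuity of \<open>l\<close> puts a whole one-sided neighbourhood of \<open>p\<close> into the
  slice. There the constant of integration is fixed, so the primitive has a limit \<open>k\<close>;
  every essential trace must equal \<open>k\<close>, which lets prescribed initial or final values
  be inserted.\<close>

lemma slice_limit:
  assumes p: "p = 0 \<or> p = T" and x: "x \<in> {l p<..<L}" and g: "integrable lborel (\<lambda>t. vt (x, t))"
    and K: "\<And>s t. s \<le> t \<Longrightarrow> {x} \<times> {s..t} \<subseteq> Q \<Longrightarrow> K s = K t"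
    and ae: "AE t in lborel. (x, t) \<in> Q \<longrightarrow> v (x, t) = (LBINT s:{..t}. vt (x, s)) + K t"
  obtains k where "((\<lambda>t. (LBINT s:{..t}. vt (x, s)) + K t) \<longlongrightarrow> k) (at p within {0<..<T})"
    "eventually (\<lambda>t. (x, t) \<in> Q) (at p within {0<..<T})"
    "ess_tendsto {t. (x, t) \<in> Q} (\<lambda>t. v (x, t)) p k"
    "\<And>c. ess_tendsto {t. (x, t) \<in> Q} (\<lambda>t. v (x, t)) p c \<Longrightarrow> c = k"
proof -
  let ?V = "\<lambda>t. (LBINT s:{..t}. vt (x, s)) + K t"
  have "eventually (\<lambda>t. l t < x) (nhds p)"
  proof -
    have "isCont l p" using l_cont by (simp add: continuous_on_eq_continuous_at)
    then have "(l \<longlongrightarrow> l p) (nhds p)" unfolding isCont_def tendsto_at_iff_tendsto_nhds .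
    from order_tendstoD(2)[OF this, of x] show ?thesis using x by simp
  qed
  then obtain \<delta> where \<delta>: "\<delta> > 0" "\<And>t. dist t p < \<delta> \<Longrightarrow> l t < x"
    unfolding eventually_nhds_metric by blast
  define N where "N = {0<..<T} \<inter> {p - \<delta><..<p + \<delta>}"
  have NQ: "(x, t) \<in> Q" if "t \<in> N" for t
    using that \<delta>(2)[of t] x by (auto simp: N_def Q_iff dist_real_def)
  have "\<exists>t0. t0 \<in> N"
    using p
  proof
    assume "p = 0"
    then have "min (\<delta>/2) (T/2) \<in> N" using \<delta> T_pos by (auto simp: N_def)
    then show ?thesis ..
  next
    assume "p = T"
    then have "T - min (\<delta>/2) (T/2) \<in> N" using \<delta> T_pos by (auto simp: N_def)
    then show ?thesis ..
  qed
  then obtain t0 where t0: "t0 \<in> N" ..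
  have Kc: "K t = K t0" if "t \<in> N" for t
  proof (cases "t \<le> t0")
    case True
    have "{t..t0} \<subseteq> N" using that t0 by (auto simp: N_def)
    then show ?thesis using True NQ by (intro K) auto
  next
    case False
    have "{t0..t} \<subseteq> N" using that t0 by (auto simp: N_def)
    then show ?thesis using False NQ by (intro K[symmetric]) auto
  qed
  have evN: "eventually (\<lambda>t. t \<in> N) (at p within {0<..<T})"
    unfolding eventually_at by (intro exI[of _ \<delta>]) (use \<delta> in \<open>auto simp: N_def dist_real_def\<close>)
  have "((\<lambda>t. LBINT s:{..t}. vt (x, s)) \<longlongrightarrow> (LBINT s:{..p}. vt (x, s))) (at p within {0<..<T})"
    using isCont_primitive[OF g, of p] unfolding isCont_def by (rule tendsto_within_subset) simp
  then have "((\<lambda>t. (LBINT s:{..t}. vt (x, s)) + K t0) \<longlongrightarrow> (LBINT s:{..p}. vt (x, s)) + K t0) (at p within {0<..<T})"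
    by (intro tendsto_intros)
  then have lim: "(?V \<longlongrightarrow> (LBINT s:{..p}. vt (x, s)) + K t0) (at p within {0<..<T})"
    by (rule Lim_transform_eventually) (use evN in eventually_elim, use Kc in auto)
  have sub: "{t. (x, t) \<in> Q} \<subseteq> {0<..<T}" using Q_iff by auto
  have lim': "(?V \<longlongrightarrow> (LBINT s:{..p}. vt (x, s)) + K t0) (at p within {t. (x, t) \<in> Q})"
    by (rule tendsto_within_subset[OF lim sub])
  show thesis
  proof (rule that[OF lim])
    show "eventually (\<lambda>t. (x, t) \<in> Q) (at p within {0<..<T})"
      using evN by eventually_elim (rule NQ)
    show "ess_tendsto {t. (x, t) \<in> Q} (\<lambda>t. v (x, t)) p ((LBINT s:{..p}. vt (x, s)) + K t0)"
      unfolding ess_tendsto_def AE_completion_iff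
      by (intro exI[of _ ?V] conjI lim') (use ae in eventually_elim, auto)
    show "c = (LBINT s:{..p}. vt (x, s)) + K t0" if "ess_tendsto {t. (x, t) \<in> Q} (\<lambda>t. v (x, t)) p c" for c
    proof (rule ess_tendsto_unique[OF that _ lim'])
      show "AE s in lborel. s \<in> {t. (x, t) \<in> Q} \<longrightarrow> v (x, s) = ?V s" using ae by simp
      fix e :: real assume "e > 0"
      define m where "m = min (min \<delta> e) T"
      have m: "m > 0" "m \<le> \<delta>" "m \<le> e" "m \<le> T" using \<open>e > 0\<close> \<delta>(1) T_pos by (auto simp: m_def)
      show "\<exists>a b. a < b \<and> {a<..<b} \<subseteq> {t. (x, t) \<in> Q} \<and> {a<..<b} \<subseteq> {p - e<..<p + e} - {p}"
        using p
      proof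
        assume "p = 0"
        then show ?thesis
          by (intro exI[of _ 0] exI[of _ m] conjI subsetI CollectI NQ) (use m in \<open>auto simp: N_def\<close>)
      next
        assume "p = T"
        then show ?thesis
          by (intro exI[of _ "T - m"] exI[of _ T] conjI subsetI CollectI NQ) (use m in \<open>auto simp: N_def\<close>)
      qed
    qed
  qed
qed

section \<open>Cut-off near the moving interface\<close>

lemma AE_neq: "AE x in lborel. x \<noteq> (c::real)"
  by (rule AE_lborel_singleton)

lemma l_interior_bounds:
  obtains m where "m < L" "\<And>t. t \<in> {0..T} \<Longrightarrow> l t \<le> m"
proof -
  have "\<exists>s\<in>{0..T}. \<forall>t\<in>{0..T}. l t \<le> l s"
    by (rule continuous_attains_sup) (use T_pos l_cont in \<open>auto intro: continuous_on_subset\<close>)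
  then show ?thesis using that l_less by blast
qed

text \<open>It vanishes up to distance \<open>\<epsilon>\<close> from the interface, not merely on
  it, so that for fixed \<open>x\<close> it is zero in a neighbourhood of every time at which
  \<open>x\<close> has not passed the interface. From distance \<open>2 * \<epsilon>\<close> on it
  is 1.\<close>

definition cutoff :: "real \<Rightarrow> real \<times> real \<Rightarrow> real" where
  "cutoff \<epsilon> z = smooth_step ((fst z - l (snd z) - \<epsilon>) / \<epsilon>)"

text \<open>The derivative in \<open>x\<close>; since the layer moves with the interface, the time
  derivative is \<open>- cutoff' \<epsilon> z * l' (snd z)\<close>.\<close>

definition cutoff' :: "real \<Rightarrow> real \<times> real \<Rightarrow> real" where
  "cutoff' \<epsilon> z = smooth_step' ((fst z - l (snd z) - \<epsilon>) / \<epsilon>) / \<epsilon>"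

lemma cutoff_measurable [measurable]: "cutoff \<epsilon> \<in> borel_measurable borel" "cutoff' \<epsilon> \<in> borel_measurable borel"
proof -
  have c: "continuous_on UNIV (\<lambda>z::real \<times> real. (fst z - l (snd z) - \<epsilon>) * inverse \<epsilon>)"
    by (intro continuous_intros continuous_on_compose2[OF l_cont]) auto
  have "continuous_on UNIV (cutoff \<epsilon>)"
    unfolding cutoff_def divide_inverse by (rule continuous_on_compose2[OF continuous_smooth_step(1) c]) simp
  moreover have "continuous_on UNIV (cutoff' \<epsilon>)"
    unfolding cutoff'_def divide_inverse
    by (intro continuous_on_mult continuous_on_const continuous_on_compose2[OF continuous_smooth_step(2) c]) simp
  ultimately show "cutoff \<epsilon> \<in> borel_measurable borel" "cutoff' \<epsilon> \<in> borel_measurable borel"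
    by (auto intro: borel_measurable_continuous_onI)
qed

lemma cutoff_bounds:
  assumes "\<epsilon> > 0"
  shows "0 \<le> cutoff \<epsilon> z" "cutoff \<epsilon> z \<le> 1" "\<bar>cutoff' \<epsilon> z\<bar> \<le> 2 / \<epsilon>"
    "fst z \<le> l (snd z) + \<epsilon> \<Longrightarrow> cutoff \<epsilon> z = 0 \<and> cutoff' \<epsilon> z = 0"
    "fst z \<ge> l (snd z) + 2 * \<epsilon> \<Longrightarrow> cutoff \<epsilon> z = 1 \<and> cutoff' \<epsilon> z = 0"
proof -
  show "0 \<le> cutoff \<epsilon> z" "cutoff \<epsilon> z \<le> 1" unfolding cutoff_def by (rule smooth_step_bounds)+
  show "\<bar>cutoff' \<epsilon> z\<bar> \<le> 2 / \<epsilon>"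
    unfolding cutoff'_def using smooth_step_bounds(7) assms by (simp add: divide_right_mono)
  show "fst z \<le> l (snd z) + \<epsilon> \<Longrightarrow> cutoff \<epsilon> z = 0 \<and> cutoff' \<epsilon> z = 0"
    using smooth_step_bounds(1,5)[of "(fst z - l (snd z) - \<epsilon>) / \<epsilon>"] assms by (simp add: cutoff_def cutoff'_def divide_simps)
  show "fst z \<ge> l (snd z) + 2 * \<epsilon> \<Longrightarrow> cutoff \<epsilon> z = 1 \<and> cutoff' \<epsilon> z = 0"
    using smooth_step_bounds(2,6)[of "(fst z - l (snd z) - \<epsilon>) / \<epsilon>"] assms by (simp add: cutoff_def cutoff'_def divide_simps)
qed

lemma l'_snd_measurable [measurable]: "(\<lambda>z::real \<times> real. l' (snd z)) \<in> borel_measurable borel"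
  using borel_measurable_tensor[of "\<lambda>_. 1" l'] by simp

lemma energy_measurable [measurable]:
  "pos_energy \<in> borel_measurable borel" "pos_energy' \<in> borel_measurable borel" "pos_energy'' \<in> borel_measurable borel"
  using continuous_pos_energy by (auto intro: borel_measurable_continuous_onI)

lemma snd_measurable [measurable]: "(\<lambda>z::real \<times> real. snd z) \<in> borel_measurable borel"
  by (intro borel_measurable_continuous_onI continuous_intros)

text \<open>\<open>q\<close> is the time derivative of energy times cut-off times
  \<open>T - t\<close>, and nothing remains at the ends of a slice: the energy of a nonpositive
  initial value is zero, the weight vanishes at \<open>T\<close>, and the cut-off vanishes near the
  interface. The term with \<open>l'\<close> is the price of letting the cut-off move.\<close>

lemma cutoff_energy_identity:
  assumes \<epsilon>: "\<epsilon> > 0"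
  defines "q \<equiv> \<lambda>z. indicator Q z * (pos_energy' (v z) * vt z * (cutoff \<epsilon> z * (T - snd z))
    + pos_energy (v z) * (- cutoff' \<epsilon> z * l' (snd z) * (T - snd z) - cutoff \<epsilon> z))"
  shows "integrable lborel q" "(LBINT z. q z) = 0"
proof -
  show qi: "integrable lborel q"
  proof (rule Bochner_Integration.integrable_bound[where f = "\<lambda>z. T * \<bar>vt z\<bar> + (2 / \<epsilon> * T * (\<bar>v z\<bar> * \<bar>l' (snd z)\<bar>) + \<bar>v z\<bar>)"])
    show "integrable lborel (\<lambda>z. T * \<bar>vt z\<bar> + (2 / \<epsilon> * T * (\<bar>v z\<bar> * \<bar>l' (snd z)\<bar>) + \<bar>v z\<bar>))"
      using ints integrable_times_l'[OF meas(1) off(1) sq(1)] by simp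
    show "q \<in> borel_measurable lborel" unfolding q_def by simp
    show "AE z in lborel. norm (q z) \<le> norm (T * \<bar>vt z\<bar> + (2 / \<epsilon> * T * (\<bar>v z\<bar> * \<bar>l' (snd z)\<bar>) + \<bar>v z\<bar>))"
    proof (rule AE_I2)
      fix z
      show "norm (q z) \<le> norm (T * \<bar>vt z\<bar> + (2 / \<epsilon> * T * (\<bar>v z\<bar> * \<bar>l' (snd z)\<bar>) + \<bar>v z\<bar>))"
      proof (cases "z \<in> Q")
        case True
        then have t: "0 \<le> T - snd z" "T - snd z \<le> T" using Q_iff[of "fst z" "snd z"] by auto
        note c = cutoff_bounds[OF \<epsilon>, of z] and e = pos_energy_bounds(1-5)[of "v z"]
        have "\<bar>pos_energy' (v z) * vt z * (cutoff \<epsilon> z * (T - snd z))\<bar> = (pos_energy' (v z) * cutoff \<epsilon> z) * (T - snd z) * \<bar>vt z\<bar>"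
          using c e t by (simp add: abs_mult)
        also have "\<dots> \<le> 1 * T * \<bar>vt z\<bar>"
          using c e t T_pos by (intro mult_mono mult_le_one) auto
        finally have 1: "\<bar>pos_energy' (v z) * vt z * (cutoff \<epsilon> z * (T - snd z))\<bar> \<le> T * \<bar>vt z\<bar>" by simp
        have "\<bar>pos_energy (v z) * (cutoff' \<epsilon> z * l' (snd z) * (T - snd z))\<bar> = (pos_energy (v z) * \<bar>l' (snd z)\<bar>) * (\<bar>cutoff' \<epsilon> z\<bar> * (T - snd z))"
          using c e t by (simp add: abs_mult)
        also have "\<dots> \<le> (\<bar>v z\<bar> * \<bar>l' (snd z)\<bar>) * (2 / \<epsilon> * T)"
          using c e t T_pos \<epsilon> by (intro mult_mono) auto
        finally have 2: "\<bar>pos_energy (v z) * (cutoff' \<epsilon> z * l' (snd z) * (T - snd z))\<bar> \<le> 2 / \<epsilon> * T * (\<bar>v z\<bar> * \<bar>l' (snd z)\<bar>)" by (simp add: mult_ac)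
        have "\<bar>pos_energy (v z) * cutoff \<epsilon> z\<bar> = pos_energy (v z) * cutoff \<epsilon> z" using c e by simp
        also have "\<dots> \<le> \<bar>v z\<bar> * 1" using c e by (intro mult_mono) auto
        finally have 3: "\<bar>pos_energy (v z) * cutoff \<epsilon> z\<bar> \<le> \<bar>v z\<bar>" by simp
        have triangle: "norm y \<le> norm (a' + (b' + c'))" if "y = a - b - c" "\<bar>a\<bar> \<le> a'" "\<bar>b\<bar> \<le> b'" "\<bar>c\<bar> \<le> c'" for y a b c a' b' c' :: real
          using that unfolding real_norm_def by linarith
        have "q z = pos_energy' (v z) * vt z * (cutoff \<epsilon> z * (T - snd z))
            - pos_energy (v z) * (cutoff' \<epsilon> z * l' (snd z) * (T - snd z)) - pos_energy (v z) * cutoff \<epsilon> z"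
          using True by (simp add: q_def algebra_simps)
        from triangle[OF this 1 2 3] show ?thesis .
      qed (simp add: q_def)
    qed
  qed
  have "AE x in lborel. integrable lborel (\<lambda>t. q (x, t))" by (rule lborel_pair_AE_integrable_x[OF qi])
  then have "AE x in lborel. (LBINT t. q (x, t)) = 0"
    \<comment> \<open>The two positions \<open>l 0\<close> and \<open>l T\<close> are discarded: for
      every other \<open>x < L\<close> the slice near the end time is either empty or reaches up to
      it.\<close>
    using t_slices initial v0_nonpos AE_neq[of "l 0"] AE_neq[of "l T"]
  proof eventually_elim
    case (elim x)
    show ?case
    proof (cases "x < L")
      case False
      then have "q (x, t) = 0" for t by (simp add: q_def Q_iff)
      then show ?thesis by simp
    next
      case True
      from elim(2) obtain K where g: "integrable lborel (\<lambda>t. vt (x, t))"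
        and K: "\<And>s t. s \<le> t \<Longrightarrow> {x} \<times> {s..t} \<subseteq> Q \<Longrightarrow> K s = K t"
        and ae: "AE t in lborel. (x, t) \<in> Q \<longrightarrow> v (x, t) = (LBINT s:{..t}. vt (x, s)) + K t"
        by blast
      let ?V = "\<lambda>t. (LBINT s:{..t}. vt (x, s)) + K t"
      define \<psi> where "\<psi> = (\<lambda>t. cutoff \<epsilon> (x, t) * (T - t))"
      define \<psi>' where "\<psi>' = (\<lambda>t. - cutoff' \<epsilon> (x, t) * l' t * (T - t) - cutoff \<epsilon> (x, t))"
      define p where "p = (\<lambda>t. if t \<in> {t. (x, t) \<in> Q} then pos_energy (?V t) * \<psi> t else 0)"
      have c\<psi>: "isCont \<psi> t" for t
      proof -
        have "continuous_on UNIV \<psi>"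
          unfolding \<psi>_def cutoff_def using \<epsilon>
          by (intro continuous_intros continuous_on_compose2[OF continuous_smooth_step(1)] continuous_on_compose2[OF l_cont]) auto
        then show ?thesis by (simp add: continuous_on_eq_continuous_at)
      qed
      have lim_nonsupport: "(p \<longlongrightarrow> 0) (at s within {0<..<T})" if "x < l s" for s
      proof (rule tendsto_eventually)
        have "isCont l s" using l_cont by (simp add: continuous_on_eq_continuous_at)
        then have "eventually (\<lambda>t. x < l t) (at s)"
          unfolding isCont_def using order_tendstoD(1)[of l "l s" "at s" x] that by blast
        then have "eventually (\<lambda>t. x < l t) (at s within {0<..<T})"
          by (rule filter_leD[OF at_le, rotated]) simp
        then show "eventually (\<lambda>t. p t = 0) (at s within {0<..<T})"
          by eventually_elim (auto simp: p_def Q_iff)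
      qed
      have lim_support: "(p \<longlongrightarrow> pos_energy k * \<psi> s) (at s within {0<..<T})"
        if "(?V \<longlongrightarrow> k) (at s within {0<..<T})" "eventually (\<lambda>t. (x, t) \<in> Q) (at s within {0<..<T})" for s k
      proof -
        have "(\<psi> \<longlongrightarrow> \<psi> s) (at s within {0<..<T})"
          using c\<psi>[of s] unfolding isCont_def by (rule tendsto_within_subset) simp
        moreover have "((\<lambda>t. pos_energy (?V t)) \<longlongrightarrow> pos_energy k) (at s within {0<..<T})"
          using that(1) by (intro isCont_tendsto_compose[OF DERIV_isCont[OF pos_energy_deriv]])
        ultimately have "((\<lambda>t. pos_energy (?V t) * \<psi> t) \<longlongrightarrow> pos_energy k * \<psi> s) (at s within {0<..<T})"
          by (intro tendsto_mult)
        then show ?thesis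
          by (rule Lim_transform_eventually) (use that(2) in eventually_elim, auto simp: p_def)
      qed
      have A: "(p \<longlongrightarrow> 0) (at_right 0)"
      proof (cases "x < l 0")
        case True
        then show ?thesis using lim_nonsupport[of 0] T_pos by (simp add: at_within_Ioo_at_right)
      next
        case False
        then have x: "x \<in> {l 0<..<L}" using elim(5) \<open>x < L\<close> by auto
        obtain k where k: "(?V \<longlongrightarrow> k) (at 0 within {0<..<T})" "eventually (\<lambda>t. (x, t) \<in> Q) (at 0 within {0<..<T})"
          "\<And>c. ess_tendsto {t. (x, t) \<in> Q} (\<lambda>t. v (x, t)) 0 c \<Longrightarrow> c = k"
          using slice_limit[OF disjI1[OF refl] x g K ae] by blast
        have "v0 x = k" using k(3) elim(3) x by blast
        then have "k \<le> 0" using elim(4) x by auto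
        then have "pos_energy k = 0" by (rule pos_energy_bounds(7))
        then show ?thesis using lim_support[OF k(1,2)] T_pos by (simp add: at_within_Ioo_at_right)
      qed
      have B: "(p \<longlongrightarrow> 0) (at_left T)"
      proof (cases "x < l T")
        case True
        then show ?thesis using lim_nonsupport[of T] T_pos by (simp add: at_within_Ioo_at_left)
      next
        case False
        then have x: "x \<in> {l T<..<L}" using elim(6) \<open>x < L\<close> by auto
        obtain k where k: "(?V \<longlongrightarrow> k) (at T within {0<..<T})" "eventually (\<lambda>t. (x, t) \<in> Q) (at T within {0<..<T})"
          using slice_limit[OF disjI2[OF refl] x g K ae] by blast
        have "\<psi> T = 0" by (simp add: \<psi>_def)
        then show ?thesis using lim_support[OF k(1,2)] T_pos by (simp add: at_within_Ioo_at_left)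
      qed
      have ac: "abscont 0 T \<psi> \<psi>'"
      proof -
        have H: "((\<lambda>y. smooth_step ((x - y - \<epsilon>) / \<epsilon>)) has_real_derivative - smooth_step' ((x - y - \<epsilon>) / \<epsilon>) / \<epsilon>) (at y)" for y
          by (rule DERIV_chain'[OF _ smooth_step_deriv, THEN DERIV_cong]) (use \<epsilon> in \<open>auto intro!: derivative_eq_intros\<close>)
        have cH: "continuous_on UNIV (\<lambda>y. - smooth_step' ((x - y - \<epsilon>) / \<epsilon>) / \<epsilon>)"
          using \<epsilon> by (intro continuous_intros continuous_on_compose2[OF continuous_smooth_step(2)]) auto
        have a1: "abscont 0 T (\<lambda>t. smooth_step ((x - l t - \<epsilon>) / \<epsilon>)) (\<lambda>t. - smooth_step' ((x - l t - \<epsilon>) / \<epsilon>) / \<epsilon> * l' t)"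
          by (rule abscont_compose[OF less_imp_le[OF T_pos] l_abscont H cH])
        have a2: "abscont 0 T (\<lambda>t. T - t) (\<lambda>_. - 1)"
          by (rule abscont_C1) (auto intro!: derivative_eq_intros)
        show ?thesis
          by (rule abscont_cong[OF abscont_mult[OF less_imp_le[OF T_pos] a1 a2]])
            (auto simp: \<psi>_def \<psi>'_def cutoff_def cutoff'_def)
      qed
      have "(LBINT t. indicator {t. (x, t) \<in> Q} t * (pos_energy' (v (x, t)) * vt (x, t) * \<psi> t + pos_energy (v (x, t)) * \<psi>' t)) = 0 - 0"
      proof (rule slice_integration[OF T_pos _ _ g _ _ pos_energy_deriv continuous_pos_energy(2) ac _ A[unfolded p_def] B[unfolded p_def]])
        show "open {t. (x, t) \<in> Q}" by (rule open_slice(1)[OF open_Q])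
        show "{t. (x, t) \<in> Q} \<subseteq> {0<..<T}" using Q_iff by auto
        show "K s = K t" if "s \<le> t" "{s..t} \<subseteq> {t. (x, t) \<in> Q}" for s t
          using that by (intro K) auto
        show "AE t in lborel. t \<in> {t. (x, t) \<in> Q} \<longrightarrow> v (x, t) = ?V t" using ae by simp
        have "(\<lambda>t. indicator {t. (x, t) \<in> Q} t * (pos_energy' (v (x, t)) * vt (x, t) * \<psi> t + pos_energy (v (x, t)) * \<psi>' t)) = (\<lambda>t. q (x, t))"
          by (auto simp: q_def \<psi>_def \<psi>'_def indicator_def)
        then show "integrable lborel (\<lambda>t. indicator {t. (x, t) \<in> Q} t * (pos_energy' (v (x, t)) * vt (x, t) * \<psi> t + pos_energy (v (x, t)) * \<psi>' t))"
          using elim(1) by simp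
        fix \<tau> assume "\<tau> \<in> {0<..<T}" "\<tau> \<notin> {t. (x, t) \<in> Q}"
        then have "x < l \<tau> + \<epsilon>" using \<open>x < L\<close> \<epsilon> by (auto simp: Q_iff)
        moreover have "((\<lambda>t. l t + \<epsilon>) \<longlongrightarrow> l \<tau> + \<epsilon>) (nhds \<tau>)"
        proof -
          have "isCont l \<tau>" using l_cont by (simp add: continuous_on_eq_continuous_at)
          then have "(l \<longlongrightarrow> l \<tau>) (nhds \<tau>)" unfolding isCont_def tendsto_at_iff_tendsto_nhds .
          then show ?thesis by (intro tendsto_intros)
        qed
        ultimately have "eventually (\<lambda>t. x < l t + \<epsilon>) (nhds \<tau>)" using order_tendstoD(1) by blast
        then show "eventually (\<lambda>t. \<psi> t = 0 \<and> \<psi>' t = 0) (nhds \<tau>)"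
        proof eventually_elim
          case (elim t)
          then have "cutoff \<epsilon> (x, t) = 0 \<and> cutoff' \<epsilon> (x, t) = 0" using cutoff_bounds(4)[OF \<epsilon>, of "(x, t)"] by simp
          then show ?case by (simp add: \<psi>_def \<psi>'_def)
        qed
      qed
      moreover have "(\<lambda>t. indicator {t. (x, t) \<in> Q} t * (pos_energy' (v (x, t)) * vt (x, t) * \<psi> t + pos_energy (v (x, t)) * \<psi>' t)) = (\<lambda>t. q (x, t))"
        by (auto simp: q_def \<psi>_def \<psi>'_def indicator_def)
      ultimately show ?thesis by simp
    qed
  qed
  then have "(LBINT x. (LBINT t. q (x, t))) = (\<integral>x. 0 \<partial>(lborel :: real measure))"
    by (intro integral_cong_AE) (use lborel_pair_integrable_x[OF qi] in auto)
  then show "(LBINT z. q z) = 0" using lborel_pair_integral_x[OF qi] by simp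
qed

end

section \<open>The maximum principle\<close>

context right_phase begin

text \<open>In the layer where \<open>cutoff'\<close> lives, the zero trace at the interface bounds
  the modulus of \<open>v\<close> by the integral \<open>M\<close> of the modulus of
  \<open>vx\<close> up to distance \<open>2 * \<epsilon>\<close>. The layer has width
  \<open>\<epsilon>\<close> and \<open>cutoff'\<close> is at most \<open>2 / \<epsilon>\<close>, so
  the singular factors cancel and \<open>2 * T\<close> is left in front of an integral over a
  shrinking set.\<close>

lemma energy_le_gradient_near_boundary:
  assumes \<epsilon>: "\<epsilon> > 0"
  defines "e \<equiv> \<lambda>z. indicator Q z * (pos_energy (v z) * (cutoff' \<epsilon> z * l' (snd z) * (T - snd z)))"
  shows "integrable lborel e"
    "\<bar>\<integral>z. e z \<partial>lborel\<bar> \<le> (LBINT z. 2 * T * (indicator {z. fst z < l (snd z) + 2 * \<epsilon>} z * (\<bar>vx z\<bar> * \<bar>l' (snd z)\<bar>)))"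
proof -
  let ?A = "{z::real \<times> real. fst z < l (snd z) + 2 * \<epsilon>}"
  have cl: "continuous_on UNIV (\<lambda>z::real \<times> real. l (snd z) + 2 * \<epsilon>)"
    by (intro continuous_intros continuous_on_compose2[OF l_cont]) auto
  have A [measurable]: "?A \<in> sets borel"
    by (intro borel_open open_Collect_less cl continuous_intros)
  show ei: "integrable lborel e"
  proof (rule Bochner_Integration.integrable_bound[where f = "\<lambda>z. 2 / \<epsilon> * T * (\<bar>v z\<bar> * \<bar>l' (snd z)\<bar>)"])
    show "integrable lborel (\<lambda>z. 2 / \<epsilon> * T * (\<bar>v z\<bar> * \<bar>l' (snd z)\<bar>))"
      using integrable_times_l'[OF meas(1) off(1) sq(1)] by simp
    show "e \<in> borel_measurable lborel" unfolding e_def by simp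
    show "AE z in lborel. norm (e z) \<le> norm (2 / \<epsilon> * T * (\<bar>v z\<bar> * \<bar>l' (snd z)\<bar>))"
    proof (rule AE_I2)
      fix z
      show "norm (e z) \<le> norm (2 / \<epsilon> * T * (\<bar>v z\<bar> * \<bar>l' (snd z)\<bar>))"
      proof (cases "z \<in> Q")
        case True
        then have t: "0 \<le> T - snd z" "T - snd z \<le> T" using Q_iff[of "fst z" "snd z"] by auto
        have "norm (e z) = (pos_energy (v z) * \<bar>l' (snd z)\<bar>) * (\<bar>cutoff' \<epsilon> z\<bar> * (T - snd z))"
          using True t pos_energy_bounds(1) by (simp add: e_def abs_mult)
        also have "\<dots> \<le> (\<bar>v z\<bar> * \<bar>l' (snd z)\<bar>) * (2 / \<epsilon> * T)"
          using cutoff_bounds[OF \<epsilon>, of z] pos_energy_bounds(1,2)[of "v z"] t T_pos \<epsilon> by (intro mult_mono) auto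
        also have "\<dots> = norm (2 / \<epsilon> * T * (\<bar>v z\<bar> * \<bar>l' (snd z)\<bar>))"
          using \<epsilon> T_pos by (simp add: abs_mult)
        finally show ?thesis .
      qed (simp add: e_def)
    qed
  qed
  let ?B = "\<lambda>z. 2 * T * (indicator ?A z * (\<bar>vx z\<bar> * \<bar>l' (snd z)\<bar>))"
  have Bi: "integrable lborel ?B"
    using integrable_mult_indicator[OF _ integrable_times_l'[OF meas(2) off(2) sq(2)], of ?A] by simp
  have abs_i: "integrable lborel (\<lambda>z. \<bar>e z\<bar>)" using ei by simp
  have "\<bar>\<integral>z. e z \<partial>lborel\<bar> \<le> (LBINT z. \<bar>e z\<bar>)" by (rule integral_abs_bound)
  also have "\<dots> = (LBINT t. (LBINT x. \<bar>e (x, t)\<bar>))"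
    using lborel_pair_iterated_t(1)[OF abs_i] by simp
  also have "\<dots> \<le> (LBINT t. (LBINT x. ?B (x, t)))"
  proof (rule integral_mono_AE)
    show "integrable lborel (\<lambda>t. \<integral>x. \<bar>e (x, t)\<bar> \<partial>lborel)"
      using lborel_pair_iterated_t(2)[OF abs_i] by simp
    show "integrable lborel (\<lambda>t. \<integral>x. ?B (x, t) \<partial>lborel)"
      using lborel_pair_iterated_t(2)[OF Bi] by simp
    have ex: "AE t in lborel. integrable lborel (\<lambda>x. \<bar>e (x, t)\<bar>)"
      using lborel_pair_iterated_t(3)[OF abs_i] by simp
    show "AE t in lborel. (LBINT x. \<bar>e (x, t)\<bar>) \<le> (LBINT x. ?B (x, t))"
      using x_slices ex
    proof eventually_elim
      case (elim t)
      define M where "M = (LBINT x. indicat_real {..<l t + 2 * \<epsilon>} x * \<bar>vx (x, t)\<bar>)"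
      have Beq: "(LBINT x. ?B (x, t)) = 2 * T * \<bar>l' t\<bar> * M"
      proof -
        have "(\<lambda>x. ?B (x, t)) = (\<lambda>x. 2 * T * \<bar>l' t\<bar> * (indicat_real {..<l t + 2 * \<epsilon>} x * \<bar>vx (x, t)\<bar>))"
          by (auto simp: indicator_def)
        then show ?thesis by (simp only: M_def integral_mult_right_zero)
      qed
      have M0: "0 \<le> M" unfolding M_def by (intro integral_nonneg_AE AE_I2) simp
      show ?case
      proof (cases "t \<in> {0<..<T}")
        case False
        then have "(x, t) \<notin> Q" for x by (auto simp: Q_iff)
        then have "e (x, t) = 0" for x by (simp add: e_def)
        then show ?thesis using Beq M0 T_pos by simp
      next
        case True
        with elim(1) obtain W Z where vxi: "integrable lborel (\<lambda>x. vx (x, t))"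
          and ae': "AE x in lborel. x \<in> {l t<..<L} \<longrightarrow> v (x, t) = W x \<and> vx (x, t) = Z x"
          and W: "\<And>x. W x = (LBINT s:{..x}. vx (s, t))"
          by blast
        have ae: "AE x in lborel. x \<in> {l t<..<L} \<longrightarrow> v (x, t) = W x"
          using ae' by eventually_elim simp
        have Wb: "\<bar>W x\<bar> \<le> M" if "x < l t + 2 * \<epsilon>" for x
        proof -
          have "\<bar>W x\<bar> \<le> (LBINT s. \<bar>indicator {..x} s *\<^sub>R vx (s, t)\<bar>)"
            unfolding W set_lebesgue_integral_def by (rule integral_abs_bound)
          also have "\<dots> \<le> M"
            unfolding M_def
          proof (rule integral_mono)
            show "integrable lborel (\<lambda>s. \<bar>indicator {..x} s *\<^sub>R vx (s, t)\<bar>)"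
              by (intro integrable_abs integrable_mult_indicator vxi) simp
            show "integrable lborel (\<lambda>x. indicat_real {..<l t + 2 * \<epsilon>} x * \<bar>vx (x, t)\<bar>)"
              using integrable_mult_indicator[OF _ integrable_abs[OF vxi], of "{..<l t + 2 * \<epsilon>}"] by simp
          qed (use that in \<open>auto simp: indicator_def\<close>)
          finally show ?thesis .
        qed
        define c where "c = M * (2 / \<epsilon> * \<bar>l' t\<bar> * T)"
        have "(LBINT x. \<bar>e (x, t)\<bar>) \<le> (LBINT x. c * indicat_real {l t + \<epsilon><..<l t + 2 * \<epsilon>} x)"
        proof (rule integral_mono_AE[OF elim(2)])
          show "integrable lborel (\<lambda>x. c * indicat_real {l t + \<epsilon><..<l t + 2 * \<epsilon>} x)"
            using \<epsilon> by (intro integrable_mult_right integrable_real_indicator) auto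
          show "AE x in lborel. \<bar>e (x, t)\<bar> \<le> c * indicat_real {l t + \<epsilon><..<l t + 2 * \<epsilon>} x"
            using ae
          proof eventually_elim
            case (elim x)
            have c0: "0 \<le> c" unfolding c_def using M0 \<epsilon> T_pos by simp
            note cb = cutoff_bounds[OF \<epsilon>, of "(x, t)"]
            show ?case
            proof (cases "(x, t) \<in> Q \<and> x \<in> {l t + \<epsilon><..<l t + 2 * \<epsilon>}")
              case False
              then have "e (x, t) = 0" using cb(4,5) by (auto simp: e_def)
              then show ?thesis using c0 by simp
            next
              case True
              then have vM: "\<bar>v (x, t)\<bar> \<le> M" using elim Wb[of x] by (auto simp: Q_iff)
              have "\<bar>e (x, t)\<bar> = pos_energy (v (x, t)) * (\<bar>cutoff' \<epsilon> (x, t)\<bar> * \<bar>l' t\<bar> * (T - t))"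
                using True pos_energy_bounds(1) \<open>t \<in> {0<..<T}\<close> by (simp add: e_def abs_mult)
              also have "\<dots> \<le> M * (2 / \<epsilon> * \<bar>l' t\<bar> * T)"
                using vM pos_energy_bounds(1,2)[of "v (x, t)"] cb(3) \<open>t \<in> {0<..<T}\<close> \<epsilon> M0 by (intro mult_mono) auto
              finally show ?thesis using True by (simp add: c_def)
            qed
          qed
        qed
        also have "\<dots> = 2 * T * \<bar>l' t\<bar> * M"
          using \<epsilon> by (simp add: c_def field_simps)
        finally show ?thesis unfolding Beq .
      qed
    qed
  qed
  also have "\<dots> = (LBINT z. ?B z)"
    using lborel_pair_iterated_t(1)[OF Bi] by simp
  finally show "\<bar>\<integral>z. e z \<partial>lborel\<bar> \<le> (LBINT z. ?B z)" .
qed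

text \<open>The cut-off tends to 1 pointwise on \<open>Q\<close>, while the interface error is
  bounded by an integral over layers that eventually miss each point of \<open>Q\<close>; dominated
  convergence handles both.\<close>

lemma energy_identity:
  shows "integrable lborel (\<lambda>z. indicator Q z * (pos_energy' (v z) * vt z * (T - snd z)))"
    and "integrable lborel (\<lambda>z. indicator Q z * pos_energy (v z))"
    and "(LBINT z. indicator Q z * pos_energy (v z)) = (LBINT z. indicator Q z * (pos_energy' (v z) * vt z * (T - snd z)))"
proof -
  define \<epsilon> where "\<epsilon> n = 1 / (real n + 1)" for n
  have \<epsilon>: "\<epsilon> n > 0" for n by (simp add: \<epsilon>_def)
  have \<epsilon>_lim: "\<epsilon> \<longlonglongrightarrow> 0" unfolding \<epsilon>_def by real_asymp
  let ?a = "\<lambda>z. indicator Q z * (pos_energy' (v z) * vt z * (T - snd z))"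
  let ?b = "\<lambda>z. indicator Q z * pos_energy (v z)"
  let ?e = "\<lambda>\<epsilon> z. indicator Q z * (pos_energy (v z) * (cutoff' \<epsilon> z * l' (snd z) * (T - snd z)))"
  let ?B = "\<lambda>\<epsilon> z. 2 * T * (indicator {z. fst z < l (snd z) + 2 * \<epsilon>} z * (\<bar>vx z\<bar> * \<bar>l' (snd z)\<bar>))"
  have ab: "norm (?a z) \<le> norm (T * vt z)" for z
  proof (cases "z \<in> Q")
    case True
    then have t: "0 \<le> T - snd z" "T - snd z \<le> T" using Q_iff[of "fst z" "snd z"] by auto
    have "pos_energy' (v z) * (T - snd z) * \<bar>vt z\<bar> \<le> 1 * T * \<bar>vt z\<bar>"
      using pos_energy_bounds(3,4)[of "v z"] t T_pos by (intro mult_mono) auto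
    then show ?thesis using True t pos_energy_bounds(3)[of "v z"] T_pos by (simp add: abs_mult mult_ac)
  qed simp
  have bb: "norm (?b z) \<le> norm (v z)" for z
    using pos_energy_bounds(1,2)[of "v z"] by (auto simp: indicator_def)
  show ai: "integrable lborel ?a"
    by (rule Bochner_Integration.integrable_bound[where f = "\<lambda>z. T * vt z"]) (use ints ab in auto)
  show bi: "integrable lborel ?b"
    by (rule Bochner_Integration.integrable_bound[where f = v]) (use ints bb in auto)
  let ?f = "\<lambda>n z. cutoff (\<epsilon> n) z * (?a z - ?b z)"
  have fint: "integrable lborel (?f n)" for n
  proof (rule Bochner_Integration.integrable_bound[where f = "\<lambda>z. ?a z - ?b z"])
    show "integrable lborel (\<lambda>z. ?a z - ?b z)" using ai bi by simp
    show "AE z in lborel. norm (?f n z) \<le> norm (?a z - ?b z)"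
    proof (rule AE_I2)
      fix z
      have "\<bar>cutoff (\<epsilon> n) z\<bar> * \<bar>?a z - ?b z\<bar> \<le> 1 * \<bar>?a z - ?b z\<bar>"
        by (rule mult_right_mono) (use cutoff_bounds[OF \<epsilon>[of n], of z] in auto)
      then show "norm (?f n z) \<le> norm (?a z - ?b z)" by (simp add: abs_mult)
    qed
  qed simp
  have fe: "(LBINT z. ?f n z) = (LBINT z. ?e (\<epsilon> n) z)" for n
  proof -
    have "0 = (LBINT z. ?f n z - ?e (\<epsilon> n) z)"
      by (subst cutoff_energy_identity(2)[OF \<epsilon>[of n], symmetric])
        (rule Bochner_Integration.integral_cong, auto simp: algebra_simps)
    also have "\<dots> = (LBINT z. ?f n z) - (LBINT z. ?e (\<epsilon> n) z)"
      by (rule Bochner_Integration.integral_diff[OF fint energy_le_gradient_near_boundary(1)[OF \<epsilon>]])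
    finally show ?thesis by simp
  qed
  have lim1: "(\<lambda>n. \<integral>z. ?f n z \<partial>lborel) \<longlonglongrightarrow> (LBINT z. ?a z - ?b z)"
  proof (rule integral_dominated_convergence[where w = "\<lambda>z. \<bar>?a z - ?b z\<bar>"])
    show "AE z in lborel. (\<lambda>n. ?f n z) \<longlonglongrightarrow> ?a z - ?b z"
    proof (rule AE_I2)
      fix z
      show "(\<lambda>n. ?f n z) \<longlonglongrightarrow> ?a z - ?b z"
      proof (cases "z \<in> Q")
        case True
        then have "0 < fst z - l (snd z)" using Q_iff[of "fst z" "snd z"] by auto
        then have "eventually (\<lambda>n. \<epsilon> n < (fst z - l (snd z)) / 2) sequentially"
          using order_tendstoD(2)[OF \<epsilon>_lim, of "(fst z - l (snd z)) / 2"] by simp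
        then have "eventually (\<lambda>n. ?f n z = ?a z - ?b z) sequentially"
        proof eventually_elim
          case (elim n)
          then have "cutoff (\<epsilon> n) z = 1" using cutoff_bounds(5)[OF \<epsilon>[of n], of z] by simp
          then show ?case by simp
        qed
        then show ?thesis by (rule tendsto_eventually)
      qed simp
    qed
    show "AE z in lborel. norm (?f n z) \<le> \<bar>?a z - ?b z\<bar>" for n
    proof (rule AE_I2)
      fix z
      have "\<bar>cutoff (\<epsilon> n) z\<bar> * \<bar>?a z - ?b z\<bar> \<le> 1 * \<bar>?a z - ?b z\<bar>"
        by (rule mult_right_mono) (use cutoff_bounds[OF \<epsilon>[of n], of z] in auto)
      then show "norm (?f n z) \<le> \<bar>?a z - ?b z\<bar>" by (simp add: abs_mult)
    qed
    show "integrable lborel (\<lambda>z. \<bar>?a z - ?b z\<bar>)" using ai bi by simp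
  qed simp_all
  have lim2: "(\<lambda>n. \<integral>z. ?B (\<epsilon> n) z \<partial>lborel) \<longlonglongrightarrow> (\<integral>z. 0 \<partial>(lborel :: (real \<times> real) measure))"
  proof (rule integral_dominated_convergence[where w = "\<lambda>z. 2 * T * (\<bar>vx z\<bar> * \<bar>l' (snd z)\<bar>)"])
    show "AE z in lborel. (\<lambda>n. ?B (\<epsilon> n) z) \<longlonglongrightarrow> 0"
    proof (rule AE_I2)
      fix z
      show "(\<lambda>n. ?B (\<epsilon> n) z) \<longlonglongrightarrow> 0"
      proof (cases "z \<in> Q")
        case True
        then have "0 < fst z - l (snd z)" using Q_iff[of "fst z" "snd z"] by auto
        then have "eventually (\<lambda>n. \<epsilon> n < (fst z - l (snd z)) / 2) sequentially"
          using order_tendstoD(2)[OF \<epsilon>_lim, of "(fst z - l (snd z)) / 2"] by simp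
        then have "eventually (\<lambda>n. ?B (\<epsilon> n) z = 0) sequentially"
          by eventually_elim (auto simp: indicator_def)
        then show ?thesis by (rule tendsto_eventually)
      qed (simp add: off)
    qed
    show "integrable lborel (\<lambda>z. 2 * T * (\<bar>vx z\<bar> * \<bar>l' (snd z)\<bar>))"
      using integrable_times_l'[OF meas(2) off(2) sq(2)] by simp
    show "AE z in lborel. norm (?B (\<epsilon> n) z) \<le> 2 * T * (\<bar>vx z\<bar> * \<bar>l' (snd z)\<bar>)" for n
      using T_pos by (intro AE_I2) (auto simp: indicator_def)
    have "continuous_on UNIV (\<lambda>z::real \<times> real. l (snd z) + 2 * \<epsilon> n)" for n
      by (intro continuous_intros continuous_on_compose2[OF l_cont]) auto
    from borel_open[OF open_Collect_less[OF continuous_on_fst[OF continuous_on_id] this]]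
    have [measurable]: "{z::real \<times> real. fst z < l (snd z) + 2 * \<epsilon> n} \<in> sets borel" for n .
    show "?B (\<epsilon> n) \<in> borel_measurable lborel" for n by measurable
  qed simp
  have "(\<lambda>n. \<integral>z. ?f n z \<partial>lborel) \<longlonglongrightarrow> 0"
  proof (rule Lim_null_comparison)
    show "eventually (\<lambda>n. norm (LBINT z. ?f n z) \<le> (LBINT z. ?B (\<epsilon> n) z)) sequentially"
      unfolding fe real_norm_def by (intro always_eventually allI energy_le_gradient_near_boundary(2)[OF \<epsilon>])
    show "(\<lambda>n. \<integral>z. ?B (\<epsilon> n) z \<partial>lborel) \<longlonglongrightarrow> 0" using lim2 by simp
  qed
  with lim1 have "(LBINT z. ?a z - ?b z) = 0" by (rule LIMSEQ_unique)
  then show "(LBINT z. ?b z) = (LBINT z. ?a z)"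
    using ai bi by (subst (asm) Bochner_Integration.integral_diff) auto
qed

text \<open>Inserting the heat equation and integrating by parts in \<open>x\<close> turns the
  right-hand side of the energy identity into an integral of
  \<open>- pos_energy'' (v) * vx\<^sup>2\<close> with nonnegative weight \<open>d * (T - t)\<close>.
  A nonnegative energy with nonpositive integral is zero almost everywhere.\<close>

theorem v_nonpos: "AE z in lborel. v z \<le> 0"
proof -
  let ?a = "\<lambda>z. indicator Q z * (pos_energy' (v z) * vt z * (T - snd z))"
  let ?b = "\<lambda>z. indicator Q z * pos_energy (v z)"
  have "(LBINT z. ?b z) = (LBINT t. (LBINT x. ?a (x, t)))"
    using lborel_pair_iterated_t(1)[OF energy_identity(1)] energy_identity(3) by simp
  also have "\<dots> \<le> (\<integral>t. 0 \<partial>(lborel :: real measure))"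
  proof (rule integral_mono_AE)
    show "integrable lborel (\<lambda>t. \<integral>x. ?a (x, t) \<partial>lborel)"
      using lborel_pair_iterated_t(2)[OF energy_identity(1)] by simp
    have heat': "AE t in lborel. AE x in lborel. vt (x, t) = d * vxx (x, t)"
      by (rule lborel_pair_AE_t[OF heat])
    show "AE t in lborel. (LBINT x. ?a (x, t)) \<le> 0"
      using x_slices heat'
    proof eventually_elim
      case (elim t)
      show ?case
      proof (cases "t \<in> {0<..<T}")
        case False
        then have "(x, t) \<notin> Q" for x by (auto simp: Q_iff)
        then show ?thesis by simp
      next
        case True
        with elim(1) obtain W Z where W: "W (l t) = 0" "W L = 0"
          and ae: "AE x in lborel. x \<in> {l t<..<L} \<longrightarrow> v (x, t) = W x \<and> vx (x, t) = Z x"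
          and acW: "abscont (l t) L W Z" and acZ: "abscont (l t) L Z (\<lambda>x. vxx (x, t))"
          by blast
        have le: "l t \<le> L" using l_less[of t] by simp
        note acE = abscont_compose[OF le acW pos_energy'_deriv continuous_pos_energy(3)]
        note prod = abscont_mult[OF le acE acZ]
        have i2: "set_integrable lborel {l t<..L} (\<lambda>x. pos_energy' (W x) * vxx (x, t))"
          using set_integrable_mult_continuous[OF abscontD(1)[OF acZ] abscont_continuous_on[OF acE]] by (simp add: mult.commute)
        have i1: "set_integrable lborel {l t<..L} (\<lambda>x. pos_energy'' (W x) * Z x * Z x)"
          using set_integrable_mult_continuous[OF abscontD(1)[OF acE] abscont_continuous_on[OF acZ]] by simp
        \<comment> \<open>The boundary terms contain the values of \<open>Z\<close>, for which no
          sign is available; they vanish because \<open>W\<close> is zero at both ends and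
          \<open>pos_energy' 0 = 0\<close>.\<close>
        have "0 = pos_energy' (W L) * Z L - pos_energy' (W (l t)) * Z (l t)"
          using W by (simp add: pos_energy_bounds(6))
        also have "\<dots> = (LBINT x:{l t<..L}. pos_energy'' (W x) * Z x * Z x + pos_energy' (W x) * vxx (x, t))"
          by (rule abscontD(2)[OF prod]) (use le in auto)
        also have "\<dots> = (LBINT x:{l t<..L}. pos_energy'' (W x) * Z x * Z x) + (LBINT x:{l t<..L}. pos_energy' (W x) * vxx (x, t))"
          by (rule set_integral_add(2)[OF i1 i2])
        finally have "(LBINT x:{l t<..L}. pos_energy' (W x) * vxx (x, t)) = - (LBINT x:{l t<..L}. pos_energy'' (W x) * Z x * Z x)"
          by simp
        moreover have "0 \<le> (LBINT x:{l t<..L}. pos_energy'' (W x) * Z x * Z x)"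
          unfolding set_lebesgue_integral_def
          by (intro integral_nonneg_AE AE_I2) (simp add: pos_energy_bounds(5) mult.assoc)
        ultimately have neg: "(LBINT x:{l t<..L}. pos_energy' (W x) * vxx (x, t)) \<le> 0" by simp
        have "(LBINT x. ?a (x, t)) = (LBINT x. (d * (T - t)) * (indicator {l t<..L} x *\<^sub>R (pos_energy' (W x) * vxx (x, t))))"
        proof (rule integral_cong_AE)
          show "(\<lambda>x. d * (T - t) * (indicat_real {l t<..L} x *\<^sub>R (pos_energy' (W x) * vxx (x, t)))) \<in> borel_measurable lborel"
            using i2 unfolding set_integrable_def by auto
          show "(\<lambda>x. ?a (x, t)) \<in> borel_measurable lborel" by measurable
          show "AE x in lborel. ?a (x, t) = d * (T - t) * (indicat_real {l t<..L} x *\<^sub>R (pos_energy' (W x) * vxx (x, t)))"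
            using ae elim(2) AE_neq[of L]
            by eventually_elim (use True in \<open>auto simp: Q_iff indicator_def\<close>)
        qed
        also have "\<dots> = d * (T - t) * (LBINT x:{l t<..L}. pos_energy' (W x) * vxx (x, t))"
          by (simp add: set_lebesgue_integral_def)
        also have "\<dots> \<le> 0" using neg d_pos True by (simp add: mult_nonneg_nonpos)
        finally show ?thesis .
      qed
    qed
  qed simp
  finally have le0: "(LBINT z. ?b z) \<le> 0" by simp
  have b0: "AE z in lborel. 0 \<le> ?b z" using pos_energy_bounds(1) by simp
  then have "(LBINT z. ?b z) = 0" using le0 integral_nonneg_AE[OF b0] by linarith
  then have "AE z in lborel. ?b z = 0"
    using integral_nonneg_eq_0_iff_AE[OF energy_identity(2) b0] by simp
  then show ?thesis
  proof eventually_elim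
    case (elim z)
    show ?case
    proof (cases "z \<in> Q")
      case True
      with elim have "pos_energy (v z) = 0" by simp
      then show ?thesis by (rule pos_energy_eq_0)
    qed (simp add: off)
  qed
qed

end

section \<open>The duality argument\<close>

text \<open>The exponent is at least 2, so the derivative of the power vanishes at the kink of
  \<open>max 0\<close>. The cubic bump uses \<open>n = 1\<close>, the square in its first space
  derivative uses \<open>n = 0\<close>.\<close>

lemma bump_power_deriv:
  assumes "(g has_real_derivative g') (at x)"
  shows "((\<lambda>x. (max 0 (g x)) ^ Suc (Suc n)) has_real_derivative real (Suc (Suc n)) * (max 0 (g x)) ^ Suc n * g') (at x)"
proof -
  have "((\<lambda>s. (max 0 s) ^ Suc (Suc n)) has_real_derivative real (Suc (Suc n)) * (max 0 s) ^ Suc n) (at s)" for s :: real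
  proof (rule has_derivative_compose_max0[where q = "\<lambda>y. y ^ Suc (Suc n)" and q' = "\<lambda>y. real (Suc (Suc n)) * y ^ Suc n"])
    show "((\<lambda>y. y ^ Suc (Suc n)) has_real_derivative real (Suc (Suc n)) * y ^ Suc n) (at y)" for y :: real
      using DERIV_pow[of "Suc (Suc n)" y] by simp
  qed simp
  from DERIV_chain'[OF assms this] show ?thesis by simp
qed

context right_phase begin

text \<open>The curve is \<open>M - (M - x\<^sub>0) exp (- k t)\<close>: for large \<open>k\<close> it leaves the starting point \<open>x\<^sub>0\<close> fast
  enough to stay to the right of the interface.\<close>

lemma tube_in_Q:
  assumes x0: "x0 \<in> {l 0<..<L}"
  obtains r :: real and c c' :: "real \<Rightarrow> real" and C :: real where "r > 0" "c 0 = x0"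
    "\<And>t. (c has_real_derivative c' t) (at t)" "continuous_on UNIV c'"
    "\<And>t. t \<in> {0..T} \<Longrightarrow> l t < c t - r" "\<And>t. t \<in> {0..T} \<Longrightarrow> c t + r < L" "\<And>t. t \<in> {0..T} \<Longrightarrow> \<bar>c' t\<bar> \<le> C"
proof -
  obtain m where m: "m < L" "\<And>t. t \<in> {0..T} \<Longrightarrow> l t \<le> m" using l_interior_bounds by blast
  \<comment> \<open>Half of the initial gap: by continuity the interface stays below
    \<open>x0 - h\<close> up to some time \<open>\<delta>\<close>, whereas the curve never falls
    below \<open>x0\<close>.\<close>
  define h where "h = (x0 - l 0) / 2"
  have h: "h > 0" "l 0 < x0 - h" using x0 by (auto simp: h_def field_simps)
  have "isCont l 0" using l_cont by (simp add: continuous_on_eq_continuous_at)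
  then have "(l \<longlongrightarrow> l 0) (nhds 0)" unfolding isCont_def tendsto_at_iff_tendsto_nhds .
  then have "eventually (\<lambda>t. l t < x0 - h) (nhds 0)" using h(2) by (rule order_tendstoD(2))
  then obtain \<delta> where \<delta>: "\<delta> > 0" "\<And>t. \<bar>t\<bar> < \<delta> \<Longrightarrow> l t < x0 - h"
    unfolding eventually_nhds_metric by (auto simp: dist_real_def)
  \<comment> \<open>The limit position of the curve: above the bound \<open>m\<close> for the
    interface, below \<open>L\<close>, and not to the left of \<open>x0\<close>, which makes the
    curve nondecreasing.\<close>
  define M where "M = max x0 ((m + L) / 2)"
  have M: "x0 \<le> M" "m < M" "M < L" using x0 m(1) by (auto simp: M_def less_max_iff_disj)
  \<comment> \<open>By \<open>exp y \<ge> y\<close>, this rate brings the distance from the curve to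
    \<open>M\<close> down to \<open>(M - m) / 4\<close> at time \<open>\<delta>\<close>; the
    \<open>+ 1\<close> keeps \<open>k\<close> positive when \<open>M = x0\<close>.\<close>
  define k where "k = 4 * (M - x0 + 1) / ((M - m) * \<delta>)"
  have k: "k > 0" using M \<delta> by (auto simp: k_def)
  \<comment> \<open>The three bounds serve the times before \<open>\<delta>\<close>, the times from
    \<open>\<delta>\<close> on, and the distance to the outer boundary \<open>L\<close>.\<close>
  define r where "r = min (h / 2) (min ((M - m) / 4) ((L - M) / 2))"
  have r: "r > 0" "r < h" "r \<le> (M - m) / 4" "r < L - M" using h M by (auto simp: r_def min_def field_simps)
  define c where "c = (\<lambda>t. M - (M - x0) * exp (- k * t))"
  define c' where "c' = (\<lambda>t. (M - x0) * k * exp (- k * t))"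
  show thesis
  proof (rule that[of r c c' "(M - x0) * k"])
    show "r > 0" by (rule r)
    show "c 0 = x0" by (simp add: c_def)
    show "(c has_real_derivative c' t) (at t)" for t
      unfolding c_def c'_def by (auto intro!: derivative_eq_intros)
    show "continuous_on UNIV c'" unfolding c'_def by (intro continuous_intros)
    fix t assume t: "t \<in> {0..T}"
    have e1: "exp (- k * t) \<le> 1" using k t by simp
    have e2: "(M - x0) * exp (- k * t) \<le> M - x0" using e1 M by (simp add: mult_left_le)
    have "0 \<le> (M - x0) * exp (- k * t)" using M by simp
    then show "c t + r < L" using r by (simp add: c_def)
    have "\<bar>c' t\<bar> = (M - x0) * k * exp (- k * t)" using M k by (simp add: c'_def abs_mult)
    also have "\<dots> \<le> (M - x0) * k" using e1 M k by (simp add: mult_left_le)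
    finally show "\<bar>c' t\<bar> \<le> (M - x0) * k" .
    show "l t < c t - r"
    proof (cases "t < \<delta>")
      case True
      then have "l t < x0 - h" using \<delta>(2)[of t] t by simp
      moreover have "x0 \<le> c t" using e2 by (simp add: c_def)
      ultimately show ?thesis using r by simp
    next
      case False
      have "k * \<delta> \<le> k * t" using False k by simp
      also have "\<dots> \<le> exp (k * t)" using exp_ge_add_one_self[of "k * t"] by linarith
      finally have "k * \<delta> \<le> exp (k * t)" .
      then have "exp (- k * t) \<le> 1 / (k * \<delta>)"
        using k \<delta> by (simp add: exp_minus divide_simps)
      then have "(M - x0) * exp (- k * t) \<le> (M - x0) * (1 / (k * \<delta>))"
        using M by (intro mult_left_mono) auto
      also have "\<dots> = (M - m) / 4 * ((M - x0) / (M - x0 + 1))"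
      proof -
        have kd: "k * \<delta> = 4 * (M - x0 + 1) / (M - m)" using M \<delta> by (simp add: k_def)
        show ?thesis unfolding kd by simp
      qed
      also have "\<dots> \<le> (M - m) / 4" using M by (intro mult_left_le) auto
      finally have "M - (M - m) / 4 \<le> c t" by (simp add: c_def)
      then have "3 * M + m \<le> 4 * c t" by (simp add: field_simps)
      moreover have "4 * r \<le> M - m" using r(3) by (simp add: field_simps)
      ultimately show ?thesis using m(2)[OF t] M(2) by linarith
    qed
  qed
qed

section \<open>The backward subsolution and the duality identity\<close>

lemma continuous_bounded_on_Q:
  fixes f :: "real \<times> real \<Rightarrow> real"
  assumes "continuous_on UNIV f"
  obtains B where "\<And>z. z \<in> Q \<Longrightarrow> \<bar>f z\<bar> \<le> B"
proof -
  have "compact (f ` ({0..L} \<times> {0..T}))"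
    using assms by (intro compact_continuous_image compact_Times) (auto intro: continuous_on_subset)
  then obtain B where "\<forall>y\<in>f ` ({0..L} \<times> {0..T}). \<bar>y\<bar> \<le> B"
    using compact_imp_bounded bounded_iff real_norm_def by metis
  then show ?thesis using that Q_subset by blast
qed

lemma integrable_mult_continuous_on_Q:
  fixes f w :: "real \<times> real \<Rightarrow> real"
  assumes f: "continuous_on UNIV f" and w: "integrable lborel w"
  shows "integrable lborel (\<lambda>z. indicator Q z * (w z * f z))"
proof -
  obtain B where B: "\<And>z. z \<in> Q \<Longrightarrow> \<bar>f z\<bar> \<le> B" using continuous_bounded_on_Q[OF f] by blast
  have [measurable]: "f \<in> borel_measurable borel" using f by (rule borel_measurable_continuous_onI)
  have [measurable]: "w \<in> borel_measurable borel" using w by auto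
  show ?thesis
  proof (rule Bochner_Integration.integrable_bound[where f = "\<lambda>z. B * w z"])
    show "AE z in lborel. norm (indicator Q z * (w z * f z)) \<le> norm (B * w z)"
    proof (rule AE_I2)
      fix z
      show "norm (indicator Q z * (w z * f z)) \<le> norm (B * w z)"
      proof (cases "z \<in> Q")
        case True
        then have "\<bar>f z\<bar> \<le> \<bar>B\<bar>" using B[of z] by linarith
        from mult_right_mono[OF this, of "\<bar>w z\<bar>"] show ?thesis
          using True by (simp add: abs_mult mult.commute)
      qed simp
    qed
  qed (use w in auto)
qed

text \<open>Up to the factor \<open>exp (\<mu> * t)\<close> this is
  \<open>\<phi>t + d * \<phi>xx\<close> for the moving bump. Divided by \<open>m\<close>, and with
  \<open>y\<^sup>2 = r\<^sup>2 - m\<close>, it is at least the quadratic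
  \<open>\<mu> m\<^sup>2 - b m + 24 d r\<^sup>2\<close>, where \<open>b = 6 r C + 30 d\<close>; the
  value of \<open>\<mu>\<close> makes its discriminant zero. The positive constant term comes from
  the convexity of the cube at the edge of its support.\<close>

lemma bump_subsolution:
  fixes y m r C c1 \<mu> :: real
  assumes m: "m = max 0 (r\<^sup>2 - y\<^sup>2)" and r: "r > 0" and c1: "\<bar>c1\<bar> \<le> C"
    and \<mu>: "\<mu> = (6 * r * C + 30 * d)\<^sup>2 / (96 * d * r\<^sup>2)"
  shows "0 \<le> \<mu> * m ^ 3 + 6 * m\<^sup>2 * y * c1 + d * (24 * m * y\<^sup>2 - 6 * m\<^sup>2)"
proof (cases "m = 0")
  case False
  then have m0: "m > 0" "y\<^sup>2 = r\<^sup>2 - m" using m by (auto simp: max_def split: if_splits)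
  then have "y\<^sup>2 \<le> r\<^sup>2" by simp
  then have y: "\<bar>y\<bar> \<le> r" using r abs_le_square_iff[of y r] by simp
  define b where "b = 6 * r * C + 30 * d"
  have "\<bar>y * c1\<bar> \<le> r * C" unfolding abs_mult using y c1 r by (intro mult_mono) auto
  then have yc: "- (r * C) \<le> y * c1" by linarith
  have "0 \<le> (b * m - 48 * d * r\<^sup>2)\<^sup>2 / (96 * d * r\<^sup>2)" using d_pos r by simp
  also have "\<dots> = \<mu> * m\<^sup>2 - b * m + 24 * d * r\<^sup>2"
    unfolding \<mu> b_def[symmetric] using d_pos r by (simp add: field_simps power2_eq_square)
  also have "\<dots> = \<mu> * m\<^sup>2 - 6 * (r * C) * m + d * (24 * (r\<^sup>2 - m) - 6 * m)"
    by (simp add: b_def algebra_simps)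
  also have "\<dots> \<le> \<mu> * m\<^sup>2 + 6 * (y * c1) * m + d * (24 * y\<^sup>2 - 6 * m)"
    using mult_right_mono[OF yc, of "6 * m"] m0(1) unfolding m0(2) by (simp add: algebra_simps)
  finally have "0 \<le> m * (\<mu> * m\<^sup>2 + 6 * (y * c1) * m + d * (24 * y\<^sup>2 - 6 * m))"
    using m0 by simp
  then show ?thesis by (simp add: algebra_simps power2_eq_square power3_eq_cube)
qed simp

text \<open>The integral of \<open>vt * \<phi> + v * \<phi>t\<close> over \<open>Q\<close> is
  evaluated twice. Along time slices it is minus the integral of \<open>v0 * \<phi>\<close> at time
  0, hence nonnegative; through the heat equation and two integrations by parts it is the integral
  of \<open>v * (\<phi>t + d * \<phi>xx)\<close>, hence nonpositive. So it is zero, and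
  \<open>v0\<close> vanishes where the bump is positive.\<close>

lemma initial_zero_near:
  assumes final: "AE x in lborel. x \<in> {l T<..<L} \<longrightarrow> ess_tendsto {t. (x, t) \<in> Q} (\<lambda>t. v (x, t)) T 0"
    and x0: "x0 \<in> {l 0<..<L}"
  shows "\<exists>r>0. AE x in lborel. x \<in> {x0 - r<..<x0 + r} \<longrightarrow> x \<in> {l 0<..<L} \<longrightarrow> v0 x = 0"
proof (rule tube_in_Q[OF x0])
  fix r :: real and c c' :: "real \<Rightarrow> real" and C :: real
  assume tube: "r > 0" "c 0 = x0"
    "\<And>t. (c has_real_derivative c' t) (at t)" "continuous_on UNIV c'"
    "\<And>t. t \<in> {0..T} \<Longrightarrow> l t < c t - r" "\<And>t. t \<in> {0..T} \<Longrightarrow> c t + r < L" "\<And>t. t \<in> {0..T} \<Longrightarrow> \<bar>c' t\<bar> \<le> C"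
  have c_cont: "continuous_on UNIV c" using tube(3) by (metis DERIV_isCont continuous_at_imp_continuous_on)
  define \<mu> where "\<mu> = (6 * r * C + 30 * d)\<^sup>2 / (96 * d * r\<^sup>2)"
  define m where "m z = max 0 (r\<^sup>2 - (fst z - c (snd z))\<^sup>2)" for z :: "real \<times> real"
  define \<phi> where "\<phi> z = exp (\<mu> * snd z) * m z ^ 3" for z
  define \<phi>t where "\<phi>t z = exp (\<mu> * snd z) * (\<mu> * m z ^ 3 + 6 * (m z)\<^sup>2 * (fst z - c (snd z)) * c' (snd z))" for z
  define \<phi>x where "\<phi>x z = exp (\<mu> * snd z) * (- 6 * (m z)\<^sup>2 * (fst z - c (snd z)))" for z
  define \<phi>xx where "\<phi>xx z = exp (\<mu> * snd z) * (24 * m z * (fst z - c (snd z))\<^sup>2 - 6 * (m z)\<^sup>2)" for z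
  have snd_cont: "continuous_on UNIV (\<lambda>z::real \<times> real. c (snd z))" "continuous_on UNIV (\<lambda>z::real \<times> real. c' (snd z))"
    by (rule continuous_on_compose2[OF c_cont continuous_on_snd[OF continuous_on_id]], simp)
      (rule continuous_on_compose2[OF tube(4) continuous_on_snd[OF continuous_on_id]], simp)
  have m_cont: "continuous_on UNIV m"
    unfolding m_def by (intro continuous_intros snd_cont)
  have \<phi>_cont: "continuous_on UNIV \<phi>" "continuous_on UNIV \<phi>t" "continuous_on UNIV \<phi>x" "continuous_on UNIV \<phi>xx"
    unfolding \<phi>_def \<phi>t_def \<phi>x_def \<phi>xx_def by (intro continuous_intros m_cont snd_cont)+
  note [measurable] = \<phi>_cont[THEN borel_measurable_continuous_onI]
  have slice_cont: "continuous_on UNIV (\<lambda>t. f (x, t))" "continuous_on UNIV (\<lambda>x. f (x, t))"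
    if "continuous_on UNIV f" for f :: "real \<times> real \<Rightarrow> real" and x t
    by (intro continuous_on_compose2[OF that] continuous_intros; simp)+
  have \<phi>_t: "((\<lambda>t. \<phi> (x, t)) has_real_derivative \<phi>t (x, t)) (at t)" for x t
  proof -
    have g: "((\<lambda>t. r\<^sup>2 - (x - c t)\<^sup>2) has_real_derivative 2 * (x - c t) * c' t) (at t)"
      using tube(3)[of t] by (auto intro!: derivative_eq_intros)
    have e: "((\<lambda>t. exp (\<mu> * t)) has_real_derivative \<mu> * exp (\<mu> * t)) (at t)"
      by (auto intro!: derivative_eq_intros)
    from DERIV_mult[OF e bump_power_deriv[OF g, of 1]] show ?thesis
      unfolding \<phi>_def \<phi>t_def m_def by (rule DERIV_cong_ev[THEN iffD1, rotated 3]) (auto simp: algebra_simps power3_eq_cube power2_eq_square)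
  qed
  have \<phi>_x: "((\<lambda>x. \<phi> (x, t)) has_real_derivative \<phi>x (x, t)) (at x)" for x t
  proof -
    have g: "((\<lambda>x. r\<^sup>2 - (x - c t)\<^sup>2) has_real_derivative - 2 * (x - c t)) (at x)"
      by (auto intro!: derivative_eq_intros)
    from DERIV_cmult[OF bump_power_deriv[OF g, of 1], of "exp (\<mu> * t)"] show ?thesis
      unfolding \<phi>_def \<phi>x_def m_def by (rule DERIV_cong_ev[THEN iffD1, rotated 3]) (auto simp: algebra_simps power3_eq_cube power2_eq_square)
  qed
  have \<phi>x_x: "((\<lambda>x. \<phi>x (x, t)) has_real_derivative \<phi>xx (x, t)) (at x)" for x t
  proof -
    have g: "((\<lambda>x. r\<^sup>2 - (x - c t)\<^sup>2) has_real_derivative - 2 * (x - c t)) (at x)"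
      by (auto intro!: derivative_eq_intros)
    have y: "((\<lambda>x. x - c t) has_real_derivative 1) (at x)" by (auto intro!: derivative_eq_intros)
    from DERIV_cmult[OF DERIV_mult[OF bump_power_deriv[OF g, of 0] y], of "- 6 * exp (\<mu> * t)"] show ?thesis
      unfolding \<phi>x_def \<phi>xx_def m_def by (rule DERIV_cong_ev[THEN iffD1, rotated 3]) (auto simp: algebra_simps power3_eq_cube power2_eq_square)
  qed
  have m0: "\<phi> z = 0 \<and> \<phi>t z = 0 \<and> \<phi>x z = 0" if "r \<le> \<bar>fst z - c (snd z)\<bar>" for z
  proof -
    have "r\<^sup>2 \<le> (fst z - c (snd z))\<^sup>2" using that tube(1) power_mono[of r "\<bar>fst z - c (snd z)\<bar>" 2] by simp
    then have "m z = 0" by (simp add: m_def)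
    then show ?thesis by (simp add: \<phi>_def \<phi>t_def \<phi>x_def)
  qed
  \<comment> \<open>A strict distance to the curve persists for nearby times. Since the tube stays
    inside the domain, this applies to every time outside a slice and yields the condition
    \<open>far\<close> of \<open>slice_integration\<close>.\<close>
  have ev0: "eventually (\<lambda>t. \<phi> (x, t) = 0 \<and> \<phi>t (x, t) = 0) (nhds s)" if "r < \<bar>x - c s\<bar>" for x s
  proof -
    have "isCont (\<lambda>t. \<bar>x - c t\<bar>) s"
      using c_cont by (intro continuous_intros) (simp add: continuous_on_eq_continuous_at)
    then have "((\<lambda>t. \<bar>x - c t\<bar>) \<longlongrightarrow> \<bar>x - c s\<bar>) (nhds s)"
      unfolding isCont_def using tendsto_at_iff_tendsto_nhds[of "\<lambda>t. \<bar>x - c t\<bar>" s] by simp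
    from order_tendstoD(1)[OF this that] show ?thesis
      by eventually_elim (use m0 in auto)
  qed
  have sub: "0 \<le> \<phi>t z + d * \<phi>xx z" if "z \<in> Q" for z
  proof -
    have "snd z \<in> {0..T}" using that Q_subset by auto
    from bump_subsolution[OF m_def[of z] tube(1) tube(7)[OF this] \<mu>_def]
    have "0 \<le> exp (\<mu> * snd z) * (\<mu> * m z ^ 3 + 6 * (m z)\<^sup>2 * (fst z - c (snd z)) * c' (snd z) + d * (24 * m z * (fst z - c (snd z))\<^sup>2 - 6 * (m z)\<^sup>2))"
      by simp
    then show ?thesis by (simp add: \<phi>t_def \<phi>xx_def algebra_simps)
  qed
  define q where "q z = indicator Q z * (vt z * \<phi> z) + indicator Q z * (v z * \<phi>t z)" for z
  have q1: "integrable lborel (\<lambda>z. indicator Q z * (vt z * \<phi> z))" and q2: "integrable lborel (\<lambda>z. indicator Q z * (v z * \<phi>t z))"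
    by (intro integrable_mult_continuous_on_Q ints \<phi>_cont)+
  have qi: "integrable lborel q" unfolding q_def using q1 q2 by simp
  have slice: "AE x in lborel. (LBINT t. q (x, t)) = (if x \<in> {l 0<..<L} then - (v0 x * \<phi> (x, 0)) else 0)"
    using lborel_pair_AE_integrable_x[OF qi] t_slices initial final AE_neq[of "l 0"] AE_neq[of "l T"]
  proof eventually_elim
    case (elim x)
    from elim(2) obtain K where g: "integrable lborel (\<lambda>t. vt (x, t))"
      and K: "\<And>s t. s \<le> t \<Longrightarrow> {x} \<times> {s..t} \<subseteq> Q \<Longrightarrow> K s = K t"
      and ae: "AE t in lborel. (x, t) \<in> Q \<longrightarrow> v (x, t) = (LBINT s:{..t}. vt (x, s)) + K t"
      by blast
    let ?V = "\<lambda>t. (LBINT s:{..t}. vt (x, s)) + K t"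
    define p where "p = (\<lambda>t. if t \<in> {t. (x, t) \<in> Q} then ?V t * \<phi> (x, t) else 0)"
    \<comment> \<open>Either the bump misses \<open>x\<close> for all times near \<open>s\<close>
      and the limit is zero, or \<open>x\<close> lies in the closed tube at time \<open>s\<close>,
      hence beyond the interface, and the trace is a genuine limit by
      \<open>slice_limit\<close>.\<close>
    have limit: "(p \<longlongrightarrow> (if x \<in> {l s<..<L} then b * \<phi> (x, s) else 0)) (at s within {0<..<T})"
      if s: "s = 0 \<or> s = T" and b: "x \<in> {l s<..<L} \<Longrightarrow> ess_tendsto {t. (x, t) \<in> Q} (\<lambda>t. v (x, t)) s b" for s b
    proof (cases "r < \<bar>x - c s\<bar>")
      case True
      have "eventually (\<lambda>t. p t = 0) (nhds s)"
        using ev0[OF True] by eventually_elim (simp add: p_def)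
      then have "eventually (\<lambda>t. p t = 0) (at s within {0<..<T})"
        by (rule eventually_nhds_conv_at[THEN iffD1, THEN conjunct1, THEN filter_leD[OF at_le, rotated]]) simp
      moreover have "\<phi> (x, s) = 0" using m0[of "(x, s)"] True by simp
      ultimately show ?thesis by (simp add: tendsto_eventually)
    next
      case False
      have "s \<in> {0..T}" using s T_pos by auto
      then have x: "x \<in> {l s<..<L}" using tube(5,6)[of s] False by auto
      obtain k where k: "(?V \<longlongrightarrow> k) (at s within {0<..<T})" "eventually (\<lambda>t. (x, t) \<in> Q) (at s within {0<..<T})"
        "\<And>b. ess_tendsto {t. (x, t) \<in> Q} (\<lambda>t. v (x, t)) s b \<Longrightarrow> b = k"
        using slice_limit[OF s x g K ae] by blast
      have "b = k" using k(3) b x by blast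
      moreover have "isCont (\<lambda>t. \<phi> (x, t)) s"
        using slice_cont(1)[OF \<phi>_cont(1)] by (simp add: continuous_on_eq_continuous_at)
      then have "((\<lambda>t. \<phi> (x, t)) \<longlongrightarrow> \<phi> (x, s)) (at s within {0<..<T})"
        unfolding isCont_def by (rule tendsto_within_subset) simp
      ultimately have "((\<lambda>t. ?V t * \<phi> (x, t)) \<longlongrightarrow> b * \<phi> (x, s)) (at s within {0<..<T})"
        using k(1) by (intro tendsto_mult) auto
      then have "(p \<longlongrightarrow> b * \<phi> (x, s)) (at s within {0<..<T})"
        by (rule Lim_transform_eventually) (use k(2) in eventually_elim, auto simp: p_def)
      then show ?thesis using x by simp
    qed
    have A: "(p \<longlongrightarrow> (if x \<in> {l 0<..<L} then v0 x * \<phi> (x, 0) else 0)) (at_right 0)"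
      using limit[of 0 "v0 x"] elim(3) T_pos by (simp add: at_within_Ioo_at_right)
    have B: "(p \<longlongrightarrow> 0) (at_left T)"
      using limit[of T 0] elim(4) T_pos by (simp add: at_within_Ioo_at_left cong: if_cong)
    have ac: "abscont 0 T (\<lambda>t. \<phi> (x, t)) (\<lambda>t. \<phi>t (x, t))"
      by (rule abscont_C1)
        (use \<phi>_t slice_cont(1)[OF \<phi>_cont(2)] in \<open>auto intro: has_field_derivative_at_within continuous_on_subset\<close>)
    have q_eq: "(\<lambda>t. indicator {t. (x, t) \<in> Q} t * (1 * vt (x, t) * \<phi> (x, t) + v (x, t) * \<phi>t (x, t))) = (\<lambda>t. q (x, t))"
      by (auto simp: q_def indicator_def)
    have "(LBINT t. indicator {t. (x, t) \<in> Q} t * (1 * vt (x, t) * \<phi> (x, t) + v (x, t) * \<phi>t (x, t)))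
        = 0 - (if x \<in> {l 0<..<L} then v0 x * \<phi> (x, 0) else 0)"
    proof (rule slice_integration[where H = "\<lambda>y. y" and H' = "\<lambda>_. 1", OF T_pos _ _ g _ _ _ _ ac _ A[unfolded p_def] B[unfolded p_def]])
      show "open {t. (x, t) \<in> Q}" by (rule open_slice(1)[OF open_Q])
      show "{t. (x, t) \<in> Q} \<subseteq> {0<..<T}" using Q_iff by auto
      show "K s = K t" if "s \<le> t" "{s..t} \<subseteq> {t. (x, t) \<in> Q}" for s t
        using that by (intro K) auto
      show "AE t in lborel. t \<in> {t. (x, t) \<in> Q} \<longrightarrow> v (x, t) = ?V t" using ae by simp
      show "integrable lborel (\<lambda>t. indicator {t. (x, t) \<in> Q} t * (1 * vt (x, t) * \<phi> (x, t) + v (x, t) * \<phi>t (x, t)))"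
        unfolding q_eq by (rule elim(1))
      fix \<tau> assume \<tau>: "\<tau> \<in> {0<..<T}" "\<tau> \<notin> {t. (x, t) \<in> Q}"
      then have "r < \<bar>x - c \<tau>\<bar>" using tube(5,6)[of \<tau>] by (auto simp: Q_iff)
      then show "eventually (\<lambda>t. \<phi> (x, t) = 0 \<and> \<phi>t (x, t) = 0) (nhds \<tau>)" by (rule ev0)
    qed (auto intro: continuous_intros)
    then show ?case unfolding q_eq by simp
  qed
  have vxx_i: "integrable lborel (\<lambda>z. indicator Q z * (vxx z * \<phi> z))" and v_i: "integrable lborel (\<lambda>z. indicator Q z * (v z * \<phi>xx z))"
    by (intro integrable_mult_continuous_on_Q ints \<phi>_cont)+
  \<comment> \<open>No boundary terms arise: at both ends of a slice the bump vanishes because the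
    tube stays inside the domain, and \<open>v\<close> has zero traces.\<close>
  have parts: "(LBINT z. indicator Q z * (vxx z * \<phi> z)) = (LBINT z. indicator Q z * (v z * \<phi>xx z))"
  proof -
    have "(LBINT t. (LBINT x. indicator Q (x, t) * (vxx (x, t) * \<phi> (x, t))))
        = (LBINT t. (LBINT x. indicator Q (x, t) * (v (x, t) * \<phi>xx (x, t))))"
    proof (rule integral_cong_AE)
      show "AE t in lborel. (LBINT x. indicator Q (x, t) * (vxx (x, t) * \<phi> (x, t)))
        = (LBINT x. indicator Q (x, t) * (v (x, t) * \<phi>xx (x, t)))"
        using x_slices
      proof eventually_elim
        case (elim t)
        show ?case
        proof (cases "t \<in> {0<..<T}")
          case False
          then have "(x, t) \<notin> Q" for x by (auto simp: Q_iff)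
          then show ?thesis by simp
        next
          case True
          with elim obtain W Z where W: "W (l t) = 0" "W L = 0"
            and ae: "AE x in lborel. x \<in> {l t<..<L} \<longrightarrow> v (x, t) = W x \<and> vx (x, t) = Z x"
            and acW: "abscont (l t) L W Z" and acZ: "abscont (l t) L Z (\<lambda>x. vxx (x, t))"
            by blast
          have le: "l t \<le> L" using l_less[of t] by simp
          have tT: "t \<in> {0..T}" using True by auto
          have ac\<phi>: "abscont (l t) L (\<lambda>x. \<phi> (x, t)) (\<lambda>x. \<phi>x (x, t))"
            by (rule abscont_C1)
              (use \<phi>_x slice_cont(2)[OF \<phi>_cont(3)] in \<open>auto intro: has_field_derivative_at_within continuous_on_subset\<close>)
          have ac\<phi>x: "abscont (l t) L (\<lambda>x. \<phi>x (x, t)) (\<lambda>x. \<phi>xx (x, t))"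
            by (rule abscont_C1)
              (use \<phi>x_x slice_cont(2)[OF \<phi>_cont(4)] in \<open>auto intro: has_field_derivative_at_within continuous_on_subset\<close>)
          have ends: "\<phi> (l t, t) = 0" "\<phi> (L, t) = 0"
            using m0[of "(l t, t)"] m0[of "(L, t)"] tube(5,6)[OF tT] by auto
          note ac = abscont_mult[OF le acZ ac\<phi>] and ac' = abscont_mult[OF le acW ac\<phi>x]
          have i1: "set_integrable lborel {l t<..L} (\<lambda>x. vxx (x, t) * \<phi> (x, t))"
            by (rule set_integrable_mult_continuous[OF abscontD(1)[OF acZ] abscont_continuous_on[OF ac\<phi>]])
          have i2: "set_integrable lborel {l t<..L} (\<lambda>x. Z x * \<phi>x (x, t))"
            by (rule set_integrable_mult_continuous[OF abscontD(1)[OF acW] abscont_continuous_on[OF ac\<phi>x]])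
          have i3: "set_integrable lborel {l t<..L} (\<lambda>x. W x * \<phi>xx (x, t))"
            using set_integrable_mult_continuous[OF abscontD(1)[OF ac\<phi>x] abscont_continuous_on[OF acW]] by (simp add: mult.commute)
          have "0 = (LBINT x:{l t<..L}. vxx (x, t) * \<phi> (x, t) + Z x * \<phi>x (x, t))"
            using abscontD(2)[OF ac order_refl le order_refl] ends by simp
          then have 1: "(LBINT x:{l t<..L}. vxx (x, t) * \<phi> (x, t)) = - (LBINT x:{l t<..L}. Z x * \<phi>x (x, t))"
            unfolding set_integral_add(2)[OF i1 i2] by simp
          have "0 = (LBINT x:{l t<..L}. Z x * \<phi>x (x, t) + W x * \<phi>xx (x, t))"
            using abscontD(2)[OF ac' order_refl le order_refl] W by simp
          then have 2: "(LBINT x:{l t<..L}. W x * \<phi>xx (x, t)) = - (LBINT x:{l t<..L}. Z x * \<phi>x (x, t))"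
            unfolding set_integral_add(2)[OF i2 i3] by simp
          have "(LBINT x. indicator Q (x, t) * (vxx (x, t) * \<phi> (x, t))) = (LBINT x:{l t<..L}. vxx (x, t) * \<phi> (x, t))"
            unfolding set_lebesgue_integral_def
          proof (rule integral_cong_AE)
            show "AE x in lborel. indicator Q (x, t) * (vxx (x, t) * \<phi> (x, t)) = indicat_real {l t<..L} x *\<^sub>R (vxx (x, t) * \<phi> (x, t))"
              using AE_neq[of L] by eventually_elim (use True in \<open>auto simp: Q_iff indicator_def\<close>)
            show "(\<lambda>x. indicat_real {l t<..L} x *\<^sub>R (vxx (x, t) * \<phi> (x, t))) \<in> borel_measurable lborel"
              using i1 unfolding set_integrable_def by auto
          qed measurable
          also have "\<dots> = (LBINT x:{l t<..L}. W x * \<phi>xx (x, t))" using 1 2 by simp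
          also have "\<dots> = (LBINT x. indicator Q (x, t) * (v (x, t) * \<phi>xx (x, t)))"
            unfolding set_lebesgue_integral_def
          proof (rule integral_cong_AE)
            show "AE x in lborel. indicat_real {l t<..L} x *\<^sub>R (W x * \<phi>xx (x, t)) = indicator Q (x, t) * (v (x, t) * \<phi>xx (x, t))"
              using AE_neq[of L] ae by eventually_elim (use True in \<open>auto simp: Q_iff indicator_def\<close>)
            show "(\<lambda>x. indicat_real {l t<..L} x *\<^sub>R (W x * \<phi>xx (x, t))) \<in> borel_measurable lborel"
              using i3 unfolding set_integrable_def by auto
          qed measurable
          finally show ?thesis .
        qed
      qed
      show "(\<lambda>t. \<integral>x. indicator Q (x, t) * (vxx (x, t) * \<phi> (x, t)) \<partial>lborel) \<in> borel_measurable lborel"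
        using lborel_pair_iterated_t(2)[OF vxx_i] by auto
      show "(\<lambda>t. \<integral>x. indicator Q (x, t) * (v (x, t) * \<phi>xx (x, t)) \<partial>lborel) \<in> borel_measurable lborel"
        using lborel_pair_iterated_t(2)[OF v_i] by auto
    qed
    then show ?thesis unfolding lborel_pair_iterated_t(1)[OF vxx_i] lborel_pair_iterated_t(1)[OF v_i] .
  qed
  have "(LBINT z. q z) = (LBINT z. indicator Q z * (vt z * \<phi> z)) + (LBINT z. indicator Q z * (v z * \<phi>t z))"
    unfolding q_def by (rule Bochner_Integration.integral_add[OF q1 q2])
  also have "(LBINT z. indicator Q z * (vt z * \<phi> z)) = (LBINT z. d * (indicator Q z * (vxx z * \<phi> z)))"
    by (rule integral_cong_AE) (use heat in \<open>auto elim!: eventually_mono\<close>)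
  also have "\<dots> = d * (LBINT z. indicator Q z * (v z * \<phi>xx z))" using parts by simp
  also have "\<dots> + (LBINT z. indicator Q z * (v z * \<phi>t z)) = (LBINT z. d * (indicator Q z * (v z * \<phi>xx z)) + indicator Q z * (v z * \<phi>t z))"
    using v_i q2 by simp
  also have "\<dots> \<le> (\<integral>z. 0 \<partial>(lborel :: (real \<times> real) measure))"
  proof (rule integral_mono_AE)
    show "integrable lborel (\<lambda>z. d * (indicator Q z * (v z * \<phi>xx z)) + indicator Q z * (v z * \<phi>t z))"
      using v_i q2 by simp
    show "AE z in lborel. d * (indicator Q z * (v z * \<phi>xx z)) + indicator Q z * (v z * \<phi>t z) \<le> 0"
      using v_nonpos
    proof eventually_elim
      case (elim z)
      show ?case
      proof (cases "z \<in> Q")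
        case True
        have "v z * (\<phi>t z + d * \<phi>xx z) \<le> 0"
          using elim sub[OF True] by (rule mult_nonpos_nonneg)
        then show ?thesis using True by (simp add: algebra_simps)
      qed simp
    qed
  qed simp
  finally have q_le: "(LBINT x. (LBINT t. q (x, t))) \<le> 0"
    unfolding lborel_pair_integral_x[OF qi] by simp
  have \<phi>0: "0 \<le> \<phi> (x, 0)" for x by (simp add: \<phi>_def m_def)
  have nonneg: "AE x in lborel. 0 \<le> (LBINT t. q (x, t))"
    using slice v0_nonpos
  proof eventually_elim
    case (elim x)
    show ?case
    proof (cases "x \<in> {l 0<..<L}")
      case True
      then have "v0 x * \<phi> (x, 0) \<le> 0" using elim(2) \<phi>0[of x] by (simp add: mult_nonpos_nonneg)
      then show ?thesis using elim(1) True by simp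
    next
      case False
      then show ?thesis using elim(1) by (simp only: if_False order_refl)
    qed
  qed
  have "(LBINT x. (LBINT t. q (x, t))) = 0"
    using q_le integral_nonneg_AE[OF nonneg] by linarith
  then have "AE x in lborel. (LBINT t. q (x, t)) = 0"
    using integral_nonneg_eq_0_iff_AE[OF lborel_pair_integrable_x[OF qi] nonneg] by simp
  then have "AE x in lborel. x \<in> {x0 - r<..<x0 + r} \<longrightarrow> x \<in> {l 0<..<L} \<longrightarrow> v0 x = 0"
    using slice
  proof eventually_elim
    case (elim x)
    show ?case
    proof (intro impI)
      assume x: "x \<in> {x0 - r<..<x0 + r}" "x \<in> {l 0<..<L}"
      have "(x - x0)\<^sup>2 < r\<^sup>2" using x(1) abs_le_square_iff[of r "x - x0"] tube(1) by auto
      then have "\<phi> (x, 0) > 0" by (simp add: \<phi>_def m_def tube(2))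
      then show "v0 x = 0" using elim x(2) by simp
    qed
  qed
  with tube(1) show ?thesis by blast
qed

text \<open>The final state is understood as a trace, so its existence has to be derived from the
  time regularity of \<open>v\<close> along almost every slice.\<close>

lemma final_trace_exists:
  "AE x in lborel. x \<in> {l T<..<L} \<longrightarrow> (\<exists>k. ess_tendsto {t. (x, t) \<in> Q} (\<lambda>t. v (x, t)) T k)"
  using t_slices
proof eventually_elim
  case (elim x)
  then obtain K where g: "integrable lborel (\<lambda>t. vt (x, t))"
    and K: "\<And>s t. s \<le> t \<Longrightarrow> {x} \<times> {s..t} \<subseteq> Q \<Longrightarrow> K s = K t"
    and ae: "AE t in lborel. (x, t) \<in> Q \<longrightarrow> v (x, t) = (LBINT s:{..t}. vt (x, s)) + K t"
    by blast
  show ?case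
  proof
    assume x: "x \<in> {l T<..<L}"
    from slice_limit[OF disjI2[OF refl] x g K ae]
    show "\<exists>k. ess_tendsto {t. (x, t) \<in> Q} (\<lambda>t. v (x, t)) T k" by blast
  qed
qed

text \<open>The neighbourhoods given by \<open>initial_zero_near\<close> vary with the point, and
  uncountably many null sets cannot be united; shrinking to intervals with rational ends leaves
  countably many.\<close>

theorem initial_zero_if_final_zero:
  assumes final: "AE x in lborel. x \<in> {l T<..<L} \<longrightarrow> ess_tendsto {t. (x, t) \<in> Q} (\<lambda>t. v (x, t)) T 0"
  shows "AE x in lborel. x \<in> {l 0<..<L} \<longrightarrow> v0 x = 0"
proof -
  let ?P = "\<lambda>a b. AE x in lborel. x \<in> {a<..<b} \<longrightarrow> x \<in> {l 0<..<L} \<longrightarrow> v0 x = 0"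
  have "AE x in lborel. \<forall>a\<in>\<rat>. \<forall>b\<in>\<rat>. ?P a b \<longrightarrow> x \<in> {a<..<b} \<longrightarrow> x \<in> {l 0<..<L} \<longrightarrow> v0 x = 0"
    by (intro AE_ball_countable[THEN iffD2] ballI countable_rat) (auto intro: AE_impI)
  then show ?thesis
  proof eventually_elim
    case (elim x)
    show ?case
    proof
      assume x: "x \<in> {l 0<..<L}"
      then obtain r where r: "r > 0" "?P (x - r) (x + r)" using initial_zero_near[OF final] by blast
      obtain a where a: "a \<in> \<rat>" "x - r < a" "a < x" using Rats_dense_in_real[of "x - r" x] r by auto
      obtain b where b: "b \<in> \<rat>" "x < b" "b < x + r" using Rats_dense_in_real[of x "x + r"] r by auto
      have "?P a b" using r(2) by eventually_elim (use a b in auto)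
      then show "v0 x = 0" using elim a b x by simp
    qed
  qed
qed

end

section \<open>Passage to Borel representatives\<close>

lemma ess_tendsto_cong_AE:
  assumes "AE s in lborel. s \<in> S \<longrightarrow> f s = g s"
  shows "ess_tendsto S f p c \<longleftrightarrow> ess_tendsto S g p c"
proof -
  have "(AE s in lborel. s \<in> S \<longrightarrow> F s = f s) \<longleftrightarrow> (AE s in lborel. s \<in> S \<longrightarrow> F s = g s)" for F
  proof
    assume "AE s in lborel. s \<in> S \<longrightarrow> F s = f s"
    with assms show "AE s in lborel. s \<in> S \<longrightarrow> F s = g s" by eventually_elim simp
  next
    assume "AE s in lborel. s \<in> S \<longrightarrow> F s = g s"
    with assms show "AE s in lborel. s \<in> S \<longrightarrow> F s = f s" by eventually_elim simp
  qed
  then show ?thesis unfolding ess_tendsto_def AE_completion_iff by simp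
qed

text \<open>The problem is stated for the completed measure, the slice arguments for Borel
  functions. A function measurable for the completion agrees almost everywhere with a Borel one,
  which is then set to zero off \<open>Q\<close>.\<close>

lemma borel_representative:
  fixes f :: "'a::euclidean_space \<Rightarrow> real"
  assumes Q [measurable]: "Q \<in> sets borel" and f: "L2_on Q f"
  obtains g where "g \<in> borel_measurable borel" "\<And>z. z \<notin> Q \<Longrightarrow> g z = 0" "AE z in lborel. z \<in> Q \<longrightarrow> f z = g z"
    "integrable lborel (\<lambda>z. (g z)\<^sup>2)"
proof -
  have fm: "(\<lambda>z. indicator Q z *\<^sub>R f z) \<in> borel_measurable lebesgue"
    and fi: "integrable lebesgue (\<lambda>z. indicator Q z *\<^sub>R (f z)\<^sup>2)"
    using f unfolding L2_on_def set_borel_measurable_def set_integrable_def by auto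
  obtain g0 where g0: "g0 \<in> borel_measurable lborel" "AE z in lborel. indicator Q z *\<^sub>R f z = g0 z"
    using completion_ex_borel_measurable_real[OF fm] by auto
  define g where "g z = indicator Q z * g0 z" for z
  have gm [measurable]: "g \<in> borel_measurable borel" unfolding g_def using g0(1) by simp
  have ae: "AE z in lborel. z \<in> Q \<longrightarrow> f z = g z"
    using g0(2) by eventually_elim (auto simp: g_def)
  have "AE z in lborel. indicator Q z *\<^sub>R (f z)\<^sup>2 = (g z)\<^sup>2"
    using ae by eventually_elim (auto simp: g_def indicator_def)
  then have ae2: "AE z in lebesgue. indicator Q z *\<^sub>R (f z)\<^sup>2 = (g z)\<^sup>2" by (rule AE_completion)
  have g2m: "(\<lambda>z. (g z)\<^sup>2) \<in> borel_measurable lborel" by simp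
  have "integrable lebesgue (\<lambda>z. (g z)\<^sup>2)"
    using fi integrable_cong_AE[OF borel_measurable_integrable[OF fi] measurable_completion[OF g2m] ae2] by simp
  then have "integrable lborel (\<lambda>z. (g z)\<^sup>2)"
    by (simp add: integrable_completion[OF g2m])
  moreover have "g z = 0" if "z \<notin> Q" for z using that by (simp add: g_def)
  ultimately show ?thesis using gm ae by (intro that[of g])
qed

lemma LINT_lebesgue_representative:
  fixes f g h :: "'a::euclidean_space \<Rightarrow> real"
  assumes Q [measurable]: "Q \<in> sets borel" and f: "set_borel_measurable lebesgue Q f"
    and g [measurable]: "g \<in> borel_measurable borel" and off: "\<And>z. z \<notin> Q \<Longrightarrow> g z = 0"
    and ae: "AE z in lborel. z \<in> Q \<longrightarrow> f z = g z" and h [measurable]: "h \<in> borel_measurable borel"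
  shows "(LINT z:Q|lebesgue. f z * h z) = (LBINT z. g z * h z)"
proof -
  have gh: "(\<lambda>z. g z * h z) \<in> borel_measurable lborel" by simp
  have "h \<in> borel_measurable lborel" by simp
  then have hm: "h \<in> borel_measurable lebesgue" by (rule measurable_completion)
  have "(\<lambda>z. (indicator Q z *\<^sub>R f z) * h z) \<in> borel_measurable lebesgue"
    using f hm unfolding set_borel_measurable_def by (rule borel_measurable_times)
  then have fh: "(\<lambda>z. indicator Q z *\<^sub>R (f z * h z)) \<in> borel_measurable lebesgue" by (simp add: mult.assoc)
  have "AE z in lborel. indicator Q z *\<^sub>R (f z * h z) = g z * h z"
    using ae by eventually_elim (use off in \<open>auto simp: indicator_def\<close>)
  then have "AE z in lebesgue. indicator Q z *\<^sub>R (f z * h z) = g z * h z" by (rule AE_completion)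
  then have "(LINT z:Q|lebesgue. f z * h z) = (\<integral>z. g z * h z \<partial>lebesgue)"
    unfolding set_lebesgue_integral_def
    by (rule integral_cong_AE[OF fh measurable_completion[OF gh]])
  then show ?thesis by (simp add: integral_completion[OF gh])
qed

text \<open>Products of one-dimensional test functions are test functions on \<open>Q\<close>, so
  the given weak formulation specialises to products, and changing representatives does not alter
  the integrals.\<close>

lemma has_weak_deriv_representative:
  fixes w g w' g' :: "real \<times> real \<Rightarrow> real"
  assumes Q: "Q \<in> sets borel" and wd: "L2_on Q w" "L2_on Q g"
    and w': "w' \<in> borel_measurable borel" "\<And>z. z \<notin> Q \<Longrightarrow> w' z = 0" "AE z in lborel. z \<in> Q \<longrightarrow> w z = w' z"
    and g': "g' \<in> borel_measurable borel" "\<And>z. z \<notin> Q \<Longrightarrow> g' z = 0" "AE z in lborel. z \<in> Q \<longrightarrow> g z = g' z"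
  shows "has_weak_deriv Q (0, 1) w g \<Longrightarrow> weak_deriv_t Q w' g'"
    and "has_weak_deriv Q (1, 0) w g \<Longrightarrow> weak_deriv_x Q w' g'"
proof -
  have wm: "set_borel_measurable lebesgue Q w" "set_borel_measurable lebesgue Q g" using wd by (auto simp: L2_on_def)
  have key: "(LBINT z. w' z * dir_deriv e \<phi> z) = - (LBINT z. g' z * \<phi> z)"
    if "has_weak_deriv Q e w g" "test_function Q \<phi>" "dir_deriv e \<phi> \<in> borel_measurable borel" "\<phi> \<in> borel_measurable borel"
    for e \<phi>
    using that LINT_lebesgue_representative[OF Q wm(1) w' that(3)] LINT_lebesgue_representative[OF Q wm(2) g' that(4)]
    unfolding has_weak_deriv_def by metis
  have bm: "(\<lambda>z::real \<times> real. f (fst z) * h (snd z)) \<in> borel_measurable borel"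
    if "test_function {a<..<b} f" "test_function {c<..<d} h" for f h a b c d
    using that by (intro borel_measurable_tensor borel_measurable_continuous_onI test_function_integrable(2))
  show "weak_deriv_t Q w' g'" if wk: "has_weak_deriv Q (0, 1) w g"
    unfolding weak_deriv_t_def
  proof (intro allI impI)
    fix a b c d :: real and \<alpha> \<beta> :: "real \<Rightarrow> real"
    assume sub: "{a<..<b} \<times> {c<..<d} \<subseteq> Q" and \<alpha>: "test_function {a<..<b} \<alpha>" and \<beta>: "test_function {c<..<d} \<beta>"
    have eq: "dir_deriv (0, 1) (\<lambda>z::real \<times> real. \<alpha> (fst z) * \<beta> (snd z)) = (\<lambda>z. \<alpha> (fst z) * deriv \<beta> (snd z))"
      by (rule Ck_tensor(3)) (use \<alpha> \<beta> in \<open>auto simp: test_function_def\<close>)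
    from key[OF wk test_function_tensor[OF \<alpha> \<beta> sub], unfolded eq, OF bm[OF \<alpha> test_function_deriv[OF \<beta>]] bm[OF \<alpha> \<beta>]]
    show "(LBINT z. w' z * (\<alpha> (fst z) * deriv \<beta> (snd z))) = - (LBINT z. g' z * (\<alpha> (fst z) * \<beta> (snd z)))" .
  qed
  show "weak_deriv_x Q w' g'" if wk: "has_weak_deriv Q (1, 0) w g"
    unfolding weak_deriv_x_def
  proof (intro allI impI)
    fix a b c d :: real and \<alpha> \<beta> :: "real \<Rightarrow> real"
    assume sub: "{a<..<b} \<times> {c<..<d} \<subseteq> Q" and \<alpha>: "test_function {a<..<b} \<alpha>" and \<beta>: "test_function {c<..<d} \<beta>"
    have eq: "dir_deriv (1, 0) (\<lambda>z::real \<times> real. \<alpha> (fst z) * \<beta> (snd z)) = (\<lambda>z. deriv \<alpha> (fst z) * \<beta> (snd z))"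
      by (rule Ck_tensor(2)) (use \<alpha> \<beta> in \<open>auto simp: test_function_def\<close>)
    from key[OF wk test_function_tensor[OF \<alpha> \<beta> sub], unfolded eq, OF bm[OF test_function_deriv[OF \<alpha>] \<beta>] bm[OF \<alpha> \<beta>]]
    show "(LBINT z. w' z * (deriv \<alpha> (fst z) * \<beta> (snd z))) = - (LBINT z. g' z * (\<alpha> (fst z) * \<beta> (snd z)))" .
  qed
qed

section \<open>The interface as an absolutely continuous function\<close>

lemma eq_on_Icc_if_AE_eq:
  fixes f g :: "real \<Rightarrow> real"
  assumes "a < b" and f: "continuous_on UNIV f" and g: "continuous_on UNIV g"
    and ae: "AE t in lborel. t \<in> {a<..<b} \<longrightarrow> f t = g t" and t: "t \<in> {a..b}"
  shows "f t = g t"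
proof (rule ccontr)
  assume ne: "f t \<noteq> g t"
  have "open {t. f t \<noteq> g t}" by (intro open_Collect_neq f g)
  then obtain e where e: "e > 0" "ball t e \<subseteq> {t. f t \<noteq> g t}" using ne open_contains_ball by blast
  have lt: "max a (t - e) < min b (t + e)" using e(1) t \<open>a < b\<close> by auto
  have "AE s in lborel. s \<in> {max a (t - e)<..<min b (t + e)} \<longrightarrow> f s = g s"
    using ae by eventually_elim auto
  then obtain s where s: "s \<in> {max a (t - e)<..<min b (t + e)}" "f s = g s"
    by (rule AE_Ioo_witness[OF _ lt])
  have "s \<in> ball t e" using s(1) by (auto simp: dist_real_def)
  then show False using e(2) s(2) by auto
qed

lemma integrable_mult_test_function:
  fixes u :: "real \<Rightarrow> real"
  assumes u: "integrable lborel u" and f: "test_function {a<..<b} f"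
  shows "integrable lborel (\<lambda>x. u x * f x)"
proof -
  obtain B where B: "\<And>x. \<bar>f x\<bar> \<le> B" "B \<ge> 0" using test_function_bounded[OF f] by blast
  have [measurable]: "f \<in> borel_measurable borel"
    using test_function_integrable(2)[OF f] by (rule borel_measurable_continuous_onI)
  show ?thesis
  proof (rule Bochner_Integration.integrable_bound[where f = "\<lambda>x. B * u x"])
    show "(\<lambda>x. u x * f x) \<in> borel_measurable lborel" using u by auto
    show "AE x in lborel. norm (u x * f x) \<le> norm (B * u x)"
    proof (rule AE_I2)
      fix x
      from mult_right_mono[OF B(1)[of x], of "\<bar>u x\<bar>"] show "norm (u x * f x) \<le> norm (B * u x)"
        using B(2) by (simp add: abs_mult mult.commute)
    qed
  qed (use u in simp)
qed

text \<open>The one-dimensional case is read off from the rectangle lemma: tensoring with the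
  indicator of \<open>(0, 1)\<close> in a dummy variable \<open>x\<close> gives functions on the
  plane related by the same weak time derivative, and any good \<open>x\<close> delivers the
  constant \<open>c\<close>. Continuity of \<open>k\<close> upgrades equality almost everywhere to
  all of \<open>[0, T]\<close>.\<close>

lemma abscont_if_has_weak_deriv:
  fixes l l' k k' :: "real \<Rightarrow> real"
  assumes "0 < T" and wd: "has_weak_deriv {0<..<T} 1 l l'" and L2: "L2_on {0<..<T} l" "L2_on {0<..<T} l'"
    and k: "continuous_on UNIV k" "\<And>t. t \<in> {0<..<T} \<Longrightarrow> l t = k t"
    and k': "k' \<in> borel_measurable borel" "\<And>t. t \<notin> {0<..<T} \<Longrightarrow> k' t = 0" "AE t in lborel. t \<in> {0<..<T} \<longrightarrow> l' t = k' t"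
      "integrable lborel (\<lambda>t. (k' t)\<^sup>2)"
  shows "abscont 0 T k k'"
proof -
  let ?I = "indicat_real {0<..<T}" and ?J = "indicat_real {0<..<1::real}"
  have II: "integrable lborel ?I" using \<open>0 < T\<close> by (intro integrable_real_indicator) auto
  have JI: "integrable lborel ?J" by (intro integrable_real_indicator) auto
  have [measurable]: "k \<in> borel_measurable borel" "k' \<in> borel_measurable borel"
    using k(1) k'(1) by (auto intro: borel_measurable_continuous_onI)
  have k'i: "integrable lborel k'"
  proof (rule Bochner_Integration.integrable_bound[where f = "\<lambda>t. ?I t + (k' t)\<^sup>2"])
    show "integrable lborel (\<lambda>t. ?I t + (k' t)\<^sup>2)" using II k'(4) by simp
    have "\<bar>y\<bar> \<le> 1 + y\<^sup>2" for y :: real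
    proof -
      have "0 \<le> (\<bar>y\<bar> - 1)\<^sup>2" "0 \<le> \<bar>y\<bar>" by auto
      then show ?thesis by (simp add: power2_eq_square algebra_simps)
    qed
    then show "AE t in lborel. norm (k' t) \<le> norm (?I t + (k' t)\<^sup>2)"
      using k'(2) by (intro AE_I2) (auto simp: indicator_def)
  qed simp
  have ki: "integrable lborel (\<lambda>t. ?I t * k t)"
  proof -
    have "integrable lborel (\<lambda>t. indicator {0..T} t *\<^sub>R k t)"
      by (rule borel_integrable_compact) (use k(1) in \<open>auto intro: continuous_on_subset\<close>)
    from integrable_mult_indicator[OF _ this, of "{0<..<T}"]
    have "integrable lborel (\<lambda>t. ?I t *\<^sub>R (indicator {0..T} t *\<^sub>R k t))" by simp
    moreover have "(\<lambda>t. ?I t *\<^sub>R (indicator {0..T} t *\<^sub>R k t)) = (\<lambda>t. ?I t * k t)" by (auto simp: indicator_def)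
    ultimately show ?thesis by simp
  qed
  have weak: "(LBINT t. ?I t * k t * deriv \<beta> t) = - (LBINT t. k' t * \<beta> t)"
    if \<beta>: "test_function {0<..<T} \<beta>" for \<beta>
  proof -
    have dd: "dir_deriv 1 \<beta> = deriv \<beta>"
      using Ck_Suc_realD(3)[of 0 \<beta>] \<beta> unfolding test_function_def by blast
    have m: "\<beta> \<in> borel_measurable borel" "deriv \<beta> \<in> borel_measurable borel"
      using test_function_integrable(2)[OF \<beta>] test_function_integrable(2)[OF test_function_deriv[OF \<beta>]]
      by (auto intro: borel_measurable_continuous_onI)
    have lm: "set_borel_measurable lebesgue {0<..<T} l" "set_borel_measurable lebesgue {0<..<T} l'"
      using L2 by (auto simp: L2_on_def)
    have "(LINT t:{0<..<T}|lebesgue. l t * deriv \<beta> t) = (LBINT t. ?I t * k t * deriv \<beta> t)"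
      by (rule LINT_lebesgue_representative[OF _ lm(1) _ _ _ m(2)]) (use k(2) in \<open>auto simp: indicator_def\<close>)
    moreover have "(LINT t:{0<..<T}|lebesgue. l' t * \<beta> t) = (LBINT t. k' t * \<beta> t)"
      by (rule LINT_lebesgue_representative[OF _ lm(2) k'(1) _ k'(3) m(1)]) (use k'(2) in auto)
    moreover have "(LINT t:{0<..<T}|lebesgue. l t * deriv \<beta> t) = - (LINT t:{0<..<T}|lebesgue. l' t * \<beta> t)"
      using wd \<beta> unfolding has_weak_deriv_def dd[symmetric] by blast
    ultimately show ?thesis by simp
  qed
  have "AE x in lborel. x \<in> {0<..<1} \<longrightarrow> (\<exists>c. AE t in lborel. t \<in> {0<..<T} \<longrightarrow>
      ?J (fst (x, t)) * (?I (snd (x, t)) * k (snd (x, t))) = (LBINT s:{..t}. ?J (fst (x, s)) * k' (snd (x, s))) + c)"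
  proof (rule weak_deriv_on_rectangle)
    show "integrable lborel (\<lambda>z. ?J (fst z) * (?I (snd z) * k (snd z)))" by (rule integrable_tensor[OF JI ki])
    show "integrable lborel (\<lambda>z. ?J (fst z) * k' (snd z))" by (rule integrable_tensor[OF JI k'i])
    fix \<alpha> \<beta> :: "real \<Rightarrow> real"
    assume \<alpha>: "test_function {0<..<1} \<alpha>" and \<beta>: "test_function {0<..<T} \<beta>"
    note J\<alpha> = integrable_mult_test_function[OF JI \<alpha>]
    have "(LBINT z. ?J (fst z) * (?I (snd z) * k (snd z)) * (\<alpha> (fst z) * deriv \<beta> (snd z)))
        = (LBINT z. (?J (fst z) * \<alpha> (fst z)) * (?I (snd z) * k (snd z) * deriv \<beta> (snd z)))"
      by (simp add: mult_ac)
    also have "\<dots> = (LBINT x. ?J x * \<alpha> x) * (LBINT t. ?I t * k t * deriv \<beta> t)"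
      by (rule integral_tensor[OF J\<alpha> integrable_mult_test_function[OF ki test_function_deriv[OF \<beta>]]])
    also have "\<dots> = - ((LBINT x. ?J x * \<alpha> x) * (LBINT t. k' t * \<beta> t))"
      by (simp add: weak[OF \<beta>])
    also have "\<dots> = - (LBINT z. (?J (fst z) * \<alpha> (fst z)) * (k' (snd z) * \<beta> (snd z)))"
      by (subst integral_tensor[OF J\<alpha> integrable_mult_test_function[OF k'i \<beta>]]) simp
    also have "(LBINT z. (?J (fst z) * \<alpha> (fst z)) * (k' (snd z) * \<beta> (snd z)))
        = (LBINT z. ?J (fst z) * k' (snd z) * (\<alpha> (fst z) * \<beta> (snd z)))"
      by (simp add: mult_ac)
    finally show "(LBINT z. ?J (fst z) * (?I (snd z) * k (snd z)) * (\<alpha> (fst z) * deriv \<beta> (snd z)))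
        = - (LBINT z. ?J (fst z) * k' (snd z) * (\<alpha> (fst z) * \<beta> (snd z)))" .
  qed
  then obtain x :: real where x: "x \<in> {0<..<1}" and "\<exists>c. AE t in lborel. t \<in> {0<..<T} \<longrightarrow>
      ?J (fst (x, t)) * (?I (snd (x, t)) * k (snd (x, t))) = (LBINT s:{..t}. ?J (fst (x, s)) * k' (snd (x, s))) + c"
    by (rule AE_Ioo_witness) simp
  then obtain c where c: "AE t in lborel. t \<in> {0<..<T} \<longrightarrow> ?I t * k t = (LBINT s:{..t}. k' s) + c"
    by auto
  have "k t = (LBINT s:{..t}. k' s) + c" if "t \<in> {0..T}" for t
  proof (rule eq_on_Icc_if_AE_eq[OF \<open>0 < T\<close> k(1) _ _ that])
    show "continuous_on UNIV (\<lambda>t. (LBINT s:{..t}. k' s) + c)"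
      using isCont_primitive[OF k'i] by (intro continuous_intros) (simp add: continuous_at_imp_continuous_on)
    show "AE t in lborel. t \<in> {0<..<T} \<longrightarrow> k t = (LBINT s:{..t}. k' s) + c"
      using c by eventually_elim auto
  qed
  then show ?thesis
    by (intro abscont_cong[OF abscont_add_const[OF abscont_primitive[OF k'i], of 0 T c]]) auto
qed

theorem theorem4:
  fixes L T d\<^sub>l d\<^sub>r l\<^sub>l l\<^sub>0 l\<^sub>r :: real
    and \<omega>\<^sub>l \<omega>\<^sub>r :: "real set"
    and u\<^sub>0 v\<^sub>0 l :: "real \<Rightarrow> real"
    and h\<^sub>l h\<^sub>r u v :: "real \<times> real \<Rightarrow> real"
  assumes "L > 0" and "T > 0" and "d\<^sub>l > 0" and "d\<^sub>r > 0"
    and "0 < l\<^sub>l" and "l\<^sub>l < l\<^sub>0" and "l\<^sub>0 < l\<^sub>r" and "l\<^sub>r < L"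
    and "open \<omega>\<^sub>l" and "compact (closure \<omega>\<^sub>l)" and "closure \<omega>\<^sub>l \<subseteq> {0<..<l\<^sub>l}"
    and "open \<omega>\<^sub>r" and "compact (closure \<omega>\<^sub>r)" and "closure \<omega>\<^sub>r \<subseteq> {l\<^sub>r<..<L}"
    and "H10_on {0<..<l\<^sub>0} u\<^sub>0" and "AE x\<in>{0<..<l\<^sub>0} in lebesgue. u\<^sub>0 x \<ge> 0"
    and "H10_on {l\<^sub>0<..<L} v\<^sub>0" and "AE x\<in>{l\<^sub>0<..<L} in lebesgue. v\<^sub>0 x \<le> 0"
    and "\<not> (AE x\<in>{l\<^sub>0<..<L} in lebesgue. v\<^sub>0 x = 0)"
    and "L2_on (\<omega>\<^sub>l \<times> {0<..<T}) h\<^sub>l" and "L2_on (\<omega>\<^sub>r \<times> {0<..<T}) h\<^sub>r"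
    and "AE z\<in>\<omega>\<^sub>r \<times> {0<..<T} in lebesgue. h\<^sub>r z = 0"
    and "strong_solution L T d\<^sub>l d\<^sub>r l\<^sub>l l\<^sub>r \<omega>\<^sub>l \<omega>\<^sub>r h\<^sub>l h\<^sub>r u\<^sub>0 v\<^sub>0 l\<^sub>0 u v l"
    and "\<forall>t\<in>{0..T}. l t < L"
  shows "\<exists>v\<^sub>T. time_trace (Q_right T L l) {l T<..<L} v T v\<^sub>T \<and>
              \<not> (AE x\<in>{l T<..<L} in lebesgue. v\<^sub>T x = 0)"
proof -
  define Q where Q_eq: "Q = Q_right T L l"
  obtain v\<^sub>x l' where l_cont: "continuous_on {0..T} l" and l0: "l 0 = l\<^sub>0"
    and l_low: "\<And>t. t \<in> {0..T} \<Longrightarrow> l\<^sub>l < l t"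
    and l2: "L2_on {0<..<T} l" "L2_on {0<..<T} l'" "has_weak_deriv {0<..<T} 1 l l'"
    and ph: "phase Q d\<^sub>r (\<lambda>z. indicat_real (\<omega>\<^sub>r \<times> {0<..<T}) z * h\<^sub>r z) v v\<^sub>x"
    and tr: "lateral_trace Q T v (\<lambda>_. L) (\<lambda>_. 0)" "lateral_trace Q T v l (\<lambda>_. 0)"
    and init: "time_trace Q {l\<^sub>0<..<L} v 0 v\<^sub>0"
    using assms(23) unfolding strong_solution_def Let_def Q_eq by blast
  obtain v\<^sub>t v\<^sub>x\<^sub>x where L2: "L2_on Q v" "L2_on Q v\<^sub>x" "L2_on Q v\<^sub>t" "L2_on Q v\<^sub>x\<^sub>x"
    and wd: "has_weak_deriv Q (1, 0) v v\<^sub>x" "has_weak_deriv Q (0, 1) v v\<^sub>t" "has_weak_deriv Q (1, 0) v\<^sub>x v\<^sub>x\<^sub>x"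
    and pde: "AE z\<in>Q in lebesgue. v\<^sub>t z - d\<^sub>r * v\<^sub>x\<^sub>x z = indicat_real (\<omega>\<^sub>r \<times> {0<..<T}) z * h\<^sub>r z"
    using ph unfolding phase_def by blast
  \<comment> \<open>The interface frozen outside \<open>[0, T]\<close>: continuous on the whole line
    with values in \<open>(0, L)\<close>, as the locale demands, and without effect on
    \<open>Q\<close>.\<close>
  define k where "k t = l (max 0 (min T t))" for t
  have clamp: "max 0 (min T t) \<in> {0..T}" for t using \<open>T > 0\<close> by auto
  have k_eq: "k t = l t" if "t \<in> {0..T}" for t using that by (simp add: k_def)
  have k_cont: "continuous_on UNIV k"
    unfolding k_def by (rule continuous_on_compose2[OF l_cont]) (use clamp in \<open>auto intro!: continuous_intros\<close>)
  have Qk: "Q = Q_right T L k"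
    using k_eq by (auto simp: Q_eq Q_right_def)
  have Qb: "Q \<in> sets borel"
  proof -
    have "Q = {z. 0 < snd z} \<inter> {z. snd z < T} \<inter> {z. k (snd z) < fst z} \<inter> {z. fst z < L}"
      by (auto simp: Qk Q_right_def)
    moreover have "continuous_on UNIV (\<lambda>z::real \<times> real. k (snd z))"
      by (intro continuous_on_compose2[OF k_cont] continuous_intros) auto
    ultimately have "open Q" by (auto intro!: open_Int open_Collect_less continuous_intros)
    then show ?thesis by simp
  qed
  obtain w where w: "w \<in> borel_measurable borel" "\<And>z. z \<notin> Q \<Longrightarrow> w z = 0" "AE z in lborel. z \<in> Q \<longrightarrow> v z = w z"
    "integrable lborel (\<lambda>z. (w z)\<^sup>2)" using borel_representative[OF Qb L2(1)] by blast
  obtain wx where wx: "wx \<in> borel_measurable borel" "\<And>z. z \<notin> Q \<Longrightarrow> wx z = 0" "AE z in lborel. z \<in> Q \<longrightarrow> v\<^sub>x z = wx z"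
    "integrable lborel (\<lambda>z. (wx z)\<^sup>2)" using borel_representative[OF Qb L2(2)] by blast
  obtain wt where wt: "wt \<in> borel_measurable borel" "\<And>z. z \<notin> Q \<Longrightarrow> wt z = 0" "AE z in lborel. z \<in> Q \<longrightarrow> v\<^sub>t z = wt z"
    "integrable lborel (\<lambda>z. (wt z)\<^sup>2)" using borel_representative[OF Qb L2(3)] by blast
  obtain wxx where wxx: "wxx \<in> borel_measurable borel" "\<And>z. z \<notin> Q \<Longrightarrow> wxx z = 0" "AE z in lborel. z \<in> Q \<longrightarrow> v\<^sub>x\<^sub>x z = wxx z"
    "integrable lborel (\<lambda>z. (wxx z)\<^sup>2)" using borel_representative[OF Qb L2(4)] by blast
  obtain k' where k': "k' \<in> borel_measurable borel" "\<And>t. t \<notin> {0<..<T} \<Longrightarrow> k' t = 0" "AE t in lborel. t \<in> {0<..<T} \<longrightarrow> l' t = k' t"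
    "integrable lborel (\<lambda>t. (k' t)\<^sup>2)" using borel_representative[OF _ l2(2)] by auto
  \<comment> \<open>The quantifiers over \<open>p\<close> and \<open>c\<close> stand inside the
    almost everywhere statement, so one null set serves the traces at 0 and at \<open>T\<close> for
    all values.\<close>
  have x_cong: "AE x in lborel. \<forall>p c. ess_tendsto {t. (x, t) \<in> Q} (\<lambda>t. v (x, t)) p c \<longleftrightarrow> ess_tendsto {t. (x, t) \<in> Q} (\<lambda>t. w (x, t)) p c"
    using lborel_pair_AE[OF w(3)]
  proof eventually_elim
    case (elim x)
    then show ?case using ess_tendsto_cong_AE[of "{t. (x, t) \<in> Q}" "\<lambda>t. v (x, t)" "\<lambda>t. w (x, t)"] by simp
  qed
  have t_cong: "AE t in lborel. \<forall>p c. ess_tendsto {x. (x, t) \<in> Q} (\<lambda>x. v (x, t)) p c \<longleftrightarrow> ess_tendsto {x. (x, t) \<in> Q} (\<lambda>x. w (x, t)) p c"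
    using lborel_pair_AE_t[OF w(3)]
  proof eventually_elim
    case (elim t)
    then show ?case using ess_tendsto_cong_AE[of "{x. (x, t) \<in> Q}" "\<lambda>x. v (x, t)" "\<lambda>x. w (x, t)"] by simp
  qed
  have "right_phase L T d\<^sub>r k k' v\<^sub>0 w wx wt wxx"
  proof (rule right_phase.intro, unfold Qk[symmetric])
    show "0 < T" "0 < d\<^sub>r" "continuous_on UNIV k" by fact+
    show "0 < k t" for t using l_low[OF clamp[of t]] \<open>0 < l\<^sub>l\<close> by (simp add: k_def)
    show "k t < L" for t using assms(24) clamp[of t] by (auto simp: k_def)
    show "abscont 0 T k k'"
      by (rule abscont_if_has_weak_deriv[OF \<open>0 < T\<close> l2(3,1,2) k_cont _ k']) (auto simp: k_eq)
    show "k' \<in> borel_measurable borel" "integrable lborel (\<lambda>t. (k' t)\<^sup>2)" by fact+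
    show "w \<in> borel_measurable borel" "wx \<in> borel_measurable borel" "wt \<in> borel_measurable borel" "wxx \<in> borel_measurable borel"
      "integrable lborel (\<lambda>z. (w z)\<^sup>2)" "integrable lborel (\<lambda>z. (wx z)\<^sup>2)" "integrable lborel (\<lambda>z. (wt z)\<^sup>2)" "integrable lborel (\<lambda>z. (wxx z)\<^sup>2)"
      by fact+
    show "w z = 0" "wx z = 0" "wt z = 0" "wxx z = 0" if "z \<notin> Q" for z using that w wx wt wxx by auto
    show "weak_deriv_t Q w wt"
      by (rule has_weak_deriv_representative(1)[OF Qb L2(1,3) w(1-3) wt(1-3) wd(2)])
    show "weak_deriv_x Q w wx"
      by (rule has_weak_deriv_representative(2)[OF Qb L2(1,2) w(1-3) wx(1-3) wd(1)])
    show "weak_deriv_x Q wx wxx"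
      by (rule has_weak_deriv_representative(2)[OF Qb L2(2,4) wx(1-3) wxx(1-3) wd(3)])
    show "AE z in lborel. wt z = d\<^sub>r * wxx z"
      using pde[unfolded AE_completion_iff] assms(22)[unfolded AE_completion_iff] wt(3) wxx(3)
    proof eventually_elim
      case (elim z)
      show ?case
      proof (cases "z \<in> Q")
        case True
        \<comment> \<open>Inside the control region the source vanishes because
          \<open>h\<^sub>r\<close> does, outside it because of the indicator.\<close>
        have "indicat_real (\<omega>\<^sub>r \<times> {0<..<T}) z * h\<^sub>r z = 0" using elim(2) by (cases "z \<in> \<omega>\<^sub>r \<times> {0<..<T}") auto
        then have "v\<^sub>t z - d\<^sub>r * v\<^sub>x\<^sub>x z = 0" using elim(1) True by metis
        then show ?thesis using elim(3,4) True by simp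
      qed (simp add: wt(2) wxx(2))
    qed
    show "AE t in lborel. t \<in> {0<..<T} \<longrightarrow> ess_tendsto {x. (x, t) \<in> Q} (\<lambda>x. w (x, t)) L 0"
      using tr(1)[unfolded lateral_trace_def AE_completion_iff] t_cong by eventually_elim blast
    show "AE t in lborel. t \<in> {0<..<T} \<longrightarrow> ess_tendsto {x. (x, t) \<in> Q} (\<lambda>x. w (x, t)) (k t) 0"
      using tr(2)[unfolded lateral_trace_def AE_completion_iff] t_cong
      by eventually_elim (use k_eq in auto)
    show "AE x in lborel. x \<in> {k 0<..<L} \<longrightarrow> ess_tendsto {t. (x, t) \<in> Q} (\<lambda>t. w (x, t)) 0 (v\<^sub>0 x)"
      using init[unfolded time_trace_def AE_completion_iff] x_cong
      by eventually_elim (use k_eq[of 0] l0 \<open>T > 0\<close> in auto)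
    show "AE x in lborel. x \<in> {k 0<..<L} \<longrightarrow> v\<^sub>0 x \<le> 0"
      using assms(18)[unfolded AE_completion_iff] by eventually_elim (use k_eq[of 0] l0 \<open>T > 0\<close> in auto)
  qed
  then interpret right_phase L T d\<^sub>r k k' v\<^sub>0 w wx wt wxx Q
    using eq_reflection[OF Qk] .
  have kT: "k T = l T" "k 0 = l\<^sub>0" using k_eq[of T] k_eq[of 0] l0 \<open>T > 0\<close> by auto
  \<comment> \<open>For almost every \<open>x\<close> a trace value merely exists; choice collects
    these values into a function. By \<open>x_cong\<close> the trace of \<open>v\<close> exists
    wherever that of the representative \<open>w\<close> does.\<close>
  define v\<^sub>T where "v\<^sub>T x = (SOME c. ess_tendsto {t. (x, t) \<in> Q} (\<lambda>t. v (x, t)) T c)" for x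
  have trace: "AE x in lborel. x \<in> {l T<..<L} \<longrightarrow> ess_tendsto {t. (x, t) \<in> Q} (\<lambda>t. v (x, t)) T (v\<^sub>T x)"
    using final_trace_exists x_cong
  proof eventually_elim
    case (elim x)
    show ?case
    proof
      assume "x \<in> {l T<..<L}"
      then have "\<exists>c. ess_tendsto {t. (x, t) \<in> Q} (\<lambda>t. v (x, t)) T c" using elim kT by auto
      then show "ess_tendsto {t. (x, t) \<in> Q} (\<lambda>t. v (x, t)) T (v\<^sub>T x)" unfolding v\<^sub>T_def by (rule someI_ex)
    qed
  qed
  have "\<not> (AE x\<in>{l T<..<L} in lebesgue. v\<^sub>T x = 0)"
  proof
    assume "AE x\<in>{l T<..<L} in lebesgue. v\<^sub>T x = 0"
    then have "AE x in lborel. x \<in> {k T<..<L} \<longrightarrow> ess_tendsto {t. (x, t) \<in> Q} (\<lambda>t. w (x, t)) T 0"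
      unfolding AE_completion_iff using trace x_cong
    proof eventually_elim
      case (elim x)
      then show ?case using kT by (metis (no_types, lifting))
    qed
    from initial_zero_if_final_zero[OF this] have "AE x\<in>{l\<^sub>0<..<L} in lebesgue. v\<^sub>0 x = 0"
      unfolding AE_completion_iff kT .
    with assms(19) show False by blast
  qed
  moreover have "time_trace (Q_right T L l) {l T<..<L} v T v\<^sub>T"
    unfolding time_trace_def AE_completion_iff Q_eq[symmetric] by (rule trace)
  ultimately show ?thesis by blast
qed

end
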